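(* Let $\vec p=(p_1,\dots,p_n)$ with $1<\vec p<\infty$ and let $1<u'\le\infty$. Let either $1<\frac{n}{\sum_{i=1}^n 1/p_i}<t<r<\infty$ or $1<\frac{n}{\sum_{i=1}^n 1/p_i}\le t<r=\infty$. Then there is a constant $C>0$ such that for all $\{f_j\}_{j\in\mathbb N_0}\in\mathcal H_{\vec p\,'}^{t',r'}(\ell^{u'})$ $$\left\|\left(\sum_{j=0}^\infty(\mathcal Mf_j)^{u'}\right)^{1/u'}\right\|_{\mathcal H_{\vec p\,'}^{t',r'}}\le C\left\|\left(\sum_{j=0}^\infty|f_j|^{u'}\right)^{1/u'}\right\|_{\mathcal H_{\vec p\,'}^{t',r'}}$$ (with suprema over $j$ in place of the sums if $u'=\infty$).
   Context: Functions are complex-valued and measurable on $\mathbb R^n$. $\mathbb N_0=\{0,1,2,\dots\}$. Inequalities for vectors are componentwise. For $1\le s\le\infty$, $s'$ is the conjugate exponent, and $\vec p\,'=(p_1',\dots,p_n')$. Mixed Lebesgue norm: $$\|f\|_{L^{\vec p}}=\Big(\int_{\mathbb R}\cdots\Big(\int_{\mathbb R}|f(x_1,\dots,x_n)|^{p_1}dx_1\Big)^{p_2/p_1}\cdots dx_n\Big)^{1/p_n}.$$ Dyadic cubes: $Q_{j,k}=\prod_{i=1}^n[2^{-j}k_i,2^{-j}(k_i+1))$, $j\in\mathbb Z$, $k\in\mathbb Z^n$. Scalar blocks: a measurable function $b$ is a $(\vec p\,',t')$-block supported on a cube $Q$ if $b$ is supported in $Q$ and $\|b\|_{L^{\vec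 p\,'}}\le|Q|^{\frac1t-\frac1n\sum_{i=1}^n\frac1{p_i}}$. The space $\mathcal H_{\vec p\,'}^{t',r'}$ is the set of measurable $f$ of the form $f=\sum_{(j,k)\in\mathbb Z\times\mathbb Z^n}\lambda_{j,k}b_{j,k}$, converging almost everywhere, with $\lambda=\{\lambda_{j,k}\}\in\ell^{r'}(\mathbb Z^{n+1})$ and each $b_{j,k}$ a $(\vec p\,',t')$-block supported on $Q_{j,k}$; $\|f\|_{\mathcal H_{\vec p\,'}^{t',r'}}=\inf_\lambda\|\lambda\|_{\ell^{r'}}$ over all $\lambda$ admitting such a representation. Vector-valued blocks: a sequence $\vec b=\{b_m\}_{m\in\mathbb N_0}$ of measurable functions is an $\ell^{u'}$-valued $(\vec p\,',t')$-block supported on a cube $Q$ if $\vec b$ is supported in $Q$ and $\big\|\big(\sum_{m=0}^\infty|b_m|^{u'}\big)^{1/u'}\big\|_{L^{\vec p\,'}}\le|Q|^{\frac1t-\frac1n\sum_{i=1}^n\frac1{p_i}}$ (supremum over $m$ if $u'=\infty$). The space $\mathcal H_{\vec p\,'}^{t',r'}(\ell^{u'})$ is the set of sequences $\vec f=\{f_m\}_{m\in\mathbb N_0}$ of measurable functions of the form $\vec f=\sum_{(j,k)\in\mathbb Z^{n+1}}\lambda_{j,k}\vec b_{j,k}$, converging almost everywhere, with $\{\lambda_{j,k}\}\in\ell^{r'}(\mathbb Z^{n+1})$ and each $\vec b_{j,k}$ an $\ell^{u'}$-valued $(\vec p\,',t')$-block supported on $Q_{j,k}$; its norm is the infimum of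 $\|\lambda\|_{\ell^{r'}}$ over such representations. Hardy-Littlewood maximal operator: $\mathcal Mf(x)=\sup_{B\ni x}\frac1{|B|}\int_B|f(y)|\,dy$, the supremum being over all balls $B$ containing $x$. *)

theory Defs
  imports "HOL-Analysis.Analysis"
begin

text \<open>
  The space \<open>R^n\<close> is \<open>real ^ 'n\<close> with \<open>'n\<close> a finite linearly ordered index type; the order on
  \<open>'n\<close> fixes which coordinate is \<open>x\<^sub>1\<close>, ..., \<open>x\<^sub>n\<close>, since mixed norms depend on the order of
  integration.  All norms take values in \<open>[0, \<infinity>]\<close>.
\<close>

text \<open>Powers of extended nonnegative numbers, used for exponents \<open>a > 0\<close> only.\<close>

definition epowr :: "ennreal \<Rightarrow> real \<Rightarrow> ennreal" where
  "epowr x a = (if x = \<infinity> then \<infinity> else ennreal (enn2real x powr a))"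

text \<open>
  The conjugate exponent, from \<open>1/s + 1/s' = 1\<close>.  On \<open>ennreal\<close> it is correct for all
  \<open>1 \<le> s \<le> \<infinity>\<close>, including \<open>1' = \<infinity>\<close> and \<open>\<infinity>' = 1\<close>; on \<open>real\<close> only for \<open>1 < s\<close>.
\<close>

definition conj_exp :: "'a::{inverse,minus,one} \<Rightarrow> 'a" where
  "conj_exp s = inverse (1 - inverse s)"

lemma conj_exp_top: "conj_exp (\<infinity>::ennreal) = 1"
  and conj_exp_one: "conj_exp (1::ennreal) = \<infinity>"
  by (simp_all add: conj_exp_def)

lemma conj_exp_ennreal:
  assumes "1 < s"
  shows "conj_exp (ennreal s) = ennreal (conj_exp s)"
proof -
  have "1 - inverse (ennreal s) = ennreal (1 - inverse s)"
    using assms by (simp add: inverse_ennreal ennreal_minus flip: ennreal_1)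
  moreover have "0 < 1 - inverse s"
    using assms by (simp add: field_simps)
  ultimately show ?thesis
    unfolding conj_exp_def by (simp add: inverse_ennreal)
qed

definition lq_norm :: "ennreal \<Rightarrow> ('i \<Rightarrow> ennreal) \<Rightarrow> ennreal" where
  "lq_norm q a =
     (if q = \<infinity> then (SUP i. a i)
      else epowr (\<Sum>\<^sub>\<infinity>i. epowr (a i) (enn2real q)) (1 / enn2real q))"

definition upd_coord :: "real ^ 'n \<Rightarrow> 'n \<Rightarrow> real \<Rightarrow> real ^ 'n" where
  "upd_coord x i s = (\<chi> l. if l = i then s else x $ l)"

definition coord_norm ::
    "real ^ 'n \<Rightarrow> 'n \<Rightarrow> (real ^ 'n \<Rightarrow> ennreal) \<Rightarrow> real ^ 'n \<Rightarrow> ennreal" where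
  "coord_norm p i F x =
     epowr (\<integral>\<^sup>+ s. epowr (F (upd_coord x i s)) (p $ i) \<partial>lebesgue) (1 / p $ i)"

text \<open>
  The norm in \<open>x\<^sub>1\<close> is taken first (innermost) and the one in \<open>x\<^sub>n\<close> last.  The resulting
  function is constant, so its value at \<open>0\<close> is the mixed norm.
\<close>

definition mixed_norm ::
    "real ^ 'n::{finite,linorder}
      \<Rightarrow> (real ^ 'n::{finite,linorder} \<Rightarrow> ennreal) \<Rightarrow> ennreal" where
  "mixed_norm p F = fold (coord_norm p) (sorted_list_of_set UNIV) F 0"

definition dyadic_cube :: "int \<times> (int ^ 'n::finite) \<Rightarrow> (real ^ 'n::finite) set" where
  "dyadic_cube = (\<lambda>(j, k).
     {x. \<forall>i. 2 powi (- j) * of_int (k $ i) \<le> x $ i \<and> x $ i < 2 powi (- j) * (of_int (k $ i) + 1)})"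

text \<open>
  The objects below carry the parameters \<open>p\<close>, \<open>t\<close>, \<open>r\<close> whose conjugates \<open>p'\<close>, \<open>t'\<close>, \<open>r'\<close> appear
  in the names of the blocks and of the block spaces.  The parameter \<open>v\<close> of the vector-valued
  notions is the exponent of the sequence space itself (commonly written \<open>u'\<close>).
\<close>

definition block_bound ::
    "real ^ 'n::finite \<Rightarrow> real \<Rightarrow> (real ^ 'n::finite) set \<Rightarrow> ennreal" where
  "block_bound p t Q =
     ennreal (measure lebesgue Q powr (1 / t - 1 / real CARD('n) * (\<Sum>i\<in>UNIV. 1 / p $ i)))"

definition is_block ::
    "real ^ 'n::{finite,linorder} \<Rightarrow> real \<Rightarrow> (real ^ 'n::{finite,linorder}) set
      \<Rightarrow> (real ^ 'n::{finite,linorder} \<Rightarrow> complex) \<Rightarrow> bool" where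
  "is_block p t Q b \<longleftrightarrow>
     b \<in> borel_measurable lebesgue \<and> (\<forall>x. x \<notin> Q \<longrightarrow> b x = 0) \<and>
     mixed_norm (\<chi> i. conj_exp (p $ i)) (\<lambda>x. ennreal (cmod (b x))) \<le> block_bound p t Q"

definition is_vec_block ::
    "real ^ 'n::{finite,linorder} \<Rightarrow> real \<Rightarrow> ennreal
      \<Rightarrow> (real ^ 'n::{finite,linorder}) set
      \<Rightarrow> (nat \<Rightarrow> real ^ 'n::{finite,linorder} \<Rightarrow> complex) \<Rightarrow> bool" where
  "is_vec_block p t v Q b \<longleftrightarrow>
     (\<forall>m. b m \<in> borel_measurable lebesgue) \<and> (\<forall>m x. x \<notin> Q \<longrightarrow> b m x = 0) \<and>
     mixed_norm (\<chi> i. conj_exp (p $ i)) (\<lambda>x. lq_norm v (\<lambda>m. ennreal (cmod (b m x))))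
       \<le> block_bound p t Q"

text \<open>
  The index set of a block decomposition carries no order, so the sums are unconditional
  (\<open>has_sum\<close>).
\<close>

definition block_rep ::
    "real ^ 'n::{finite,linorder} \<Rightarrow> real \<Rightarrow> ennreal
      \<Rightarrow> (real ^ 'n::{finite,linorder} \<Rightarrow> complex)
      \<Rightarrow> (int \<times> (int ^ 'n::{finite,linorder}) \<Rightarrow> complex) \<Rightarrow> bool" where
  "block_rep p t r f lam \<longleftrightarrow>
     lq_norm (conj_exp r) (\<lambda>i. ennreal (cmod (lam i))) < \<infinity> \<and>
     (\<exists>b. (\<forall>i. is_block p t (dyadic_cube i) (b i)) \<and>
          (AE x in lebesgue. ((\<lambda>i. lam i * b i x) has_sum f x) UNIV))"

definition vec_block_rep ::
    "real ^ 'n::{finite,linorder} \<Rightarrow> real \<Rightarrow> ennreal \<Rightarrow> ennreal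
      \<Rightarrow> (nat \<Rightarrow> real ^ 'n::{finite,linorder} \<Rightarrow> complex)
      \<Rightarrow> (int \<times> (int ^ 'n::{finite,linorder}) \<Rightarrow> complex) \<Rightarrow> bool" where
  "vec_block_rep p t r v f lam \<longleftrightarrow>
     lq_norm (conj_exp r) (\<lambda>i. ennreal (cmod (lam i))) < \<infinity> \<and>
     (\<exists>b. (\<forall>i. is_vec_block p t v (dyadic_cube i) (b i)) \<and>
          (AE x in lebesgue. \<forall>m. ((\<lambda>i. lam i * b i m x) has_sum f m x) UNIV))"

definition vec_block_space ::
    "real ^ 'n::{finite,linorder} \<Rightarrow> real \<Rightarrow> ennreal \<Rightarrow> ennreal
      \<Rightarrow> (nat \<Rightarrow> real ^ 'n::{finite,linorder} \<Rightarrow> complex) set" where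
  "vec_block_space p t r v =
     {f. (\<forall>m. f m \<in> borel_measurable lebesgue) \<and> (\<exists>lam. vec_block_rep p t r v f lam)}"

text \<open>The norm is \<open>\<infinity>\<close> exactly outside the block space (infimum of the empty set).\<close>

definition block_norm ::
    "real ^ 'n::{finite,linorder} \<Rightarrow> real \<Rightarrow> ennreal
      \<Rightarrow> (real ^ 'n::{finite,linorder} \<Rightarrow> complex) \<Rightarrow> ennreal" where
  "block_norm p t r f =
     (INF lam\<in>{lam. block_rep p t r f lam}. lq_norm (conj_exp r) (\<lambda>i. ennreal (cmod (lam i))))"

text \<open>
  Maximal functions and \<open>\<ell>\<^sup>q\<close> sums of functions take values in \<open>[0, \<infinity>]\<close>.  Such a function belongs
  to the block space only if it is finite almost everywhere, and is then identified with its
  finite part; otherwise its norm is \<open>\<infinity>\<close>.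
\<close>

definition block_norm_ext ::
    "real ^ 'n::{finite,linorder} \<Rightarrow> real \<Rightarrow> ennreal
      \<Rightarrow> (real ^ 'n::{finite,linorder} \<Rightarrow> ennreal) \<Rightarrow> ennreal" where
  "block_norm_ext p t r G =
     (if AE x in lebesgue. G x < \<infinity> then block_norm p t r (\<lambda>x. complex_of_real (enn2real (G x)))
      else \<infinity>)"

definition maximal_op :: "(real ^ 'n::finite \<Rightarrow> complex) \<Rightarrow> real ^ 'n::finite \<Rightarrow> ennreal" where
  "maximal_op f x =
     (SUP (c, \<rho>)\<in>{(c, \<rho>). 0 < \<rho> \<and> x \<in> ball c \<rho>}.
        (\<integral>\<^sup>+y\<in>ball c \<rho>. ennreal (cmod (f y)) \<partial>lebesgue) / emeasure lebesgue (ball c \<rho>))"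

end

theory Submission
  imports Defs
begin

text \<open>
  Let \<open>G\<close> be the pointwise \<open>\<ell>\<^sup>u\<^sup>'\<close> norm of the sequence \<open>f\<close>.  Given \<open>G = \<Sum> \<lambda>\<^sub>Q b\<^sub>Q\<close>, put
  \<open>S = \<Sum> |\<lambda>\<^sub>Q b\<^sub>Q| \<ge> G\<close> and split every \<open>|f\<^sub>j|\<close> into the pieces \<open>|f\<^sub>j| |\<lambda>\<^sub>Q b\<^sub>Q| / S\<close>; by sublinearity
  it suffices to treat the sequence of pieces belonging to one cube \<open>Q\<close>.  On the neighbours of \<open>Q\<close>
  the Fefferman--Stein inequality in the mixed norm bounds its maximal function.  On the cubes of
  side \<open>2\<^sup>m\<close> times that of \<open>Q\<close> near \<open>Q\<close>, the maximal function is controlled by the mean of the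
  piece and gives \<open>2 powr (- m n / t)\<close> times a block.  Each cube receives contributions from
  \<open>2\<^sup>m\<^sup>n\<close> cubes \<open>Q\<close> of level \<open>m\<close>, which by Hoelder costs \<open>2 powr (m n / r)\<close> in \<open>\<ell>\<^sup>r\<^sup>'\<close>; the sum over
  \<open>m\<close> converges because \<open>t < r\<close>.

  For the Fefferman--Stein inequality, the maximal operator is dominated by an iteration of
  one-dimensional dyadic maximal operators on two shifted grids.  Such an operator, acting on
  functions with values in an iterated norm space \<open>E\<close>, is bounded on \<open>L\<^sup>p(E)\<close> for every
  \<open>1 < p < \<infinity>\<close> as soon as it is bounded on one \<open>L\<^sup>q(E)\<close>: for \<open>p < q\<close> by a Calderon--Zygmund
  stopping time argument, for \<open>p > q\<close> by the Garsia--Neveu lemma.  Since by Fubini boundedness on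
  \<open>L\<^sup>q(E)\<close> implies boundedness on \<open>L\<^sup>q(L\<^sup>q(E))\<close>, the norm can be built up one variable at a time.
\<close>

section \<open>Powers and Lebesgue norms of functions with values in \<open>[0, \<infinity>]\<close>\<close>

text \<open>No Bochner integral occurs: all functions are \<open>[0, \<infinity>]\<close>-valued,
  the norm of \<open>E\<close> is a functional on such functions, and Minkowski's integral
  inequality is the only link between norm and integral. The dyadic operators are first cut down to
  finitely many generations below a coarsest one, so that first-passage times exist and finite
  quantities can be absorbed. All constants are independent of this truncation, which monotone
  convergence then removes. Fubini adds a variable only at the exponent of that very variable.
  Between two variables the exponent must therefore be moved freely, upwards as well as downwards,
  which is why both extrapolation arguments occur. The quotients by \<open>S\<close> decompose a
  function only where \<open>S\<close> is finite, so the blocks must be shown to sum almost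
  everywhere. Cubes inside a unit cube are summable because \<open>t < r\<close>. Cubes containing
  it are summable because \<open>n / t\<close> is less than the sum of the \<open>1 / p $ i\<close>,
  or, at the endpoint of this condition, because \<open>r' = 1\<close> and the coefficients
  themselves are summable.\<close>

lemma epowr_top [simp]: "epowr top a = top"
  by (simp add: epowr_def)

lemma epowr_ennreal: "0 \<le> x \<Longrightarrow> epowr (ennreal x) a = ennreal (x powr a)"
  by (simp add: epowr_def)

lemma epowr_0 [simp]: "epowr 0 a = 0"
  by (simp add: epowr_def)

lemma epowr_1_left [simp]: "epowr 1 a = 1"
  by (simp add: epowr_def)

lemma epowr_1_right [simp]: "epowr x 1 = x"
  by (cases x) (auto simp: epowr_ennreal)

lemma epowr_mono: "0 \<le> a \<Longrightarrow> x \<le> y \<Longrightarrow> epowr x a \<le> epowr y a"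
  by (cases x; cases y) (auto simp: epowr_ennreal powr_mono2 top_unique)

lemma epowr_eq_0_iff [simp]: "epowr x a = 0 \<longleftrightarrow> x = 0"
  by (cases x) (auto simp: epowr_ennreal)

lemma epowr_eq_top_iff [simp]: "epowr x a = top \<longleftrightarrow> x = top"
  by (cases x) (auto simp: epowr_ennreal)

lemma epowr_less_top_iff [simp]: "epowr x a < top \<longleftrightarrow> x < top"
  by (simp flip: less_top)

lemma epowr_mult: "epowr (x * y) a = epowr x a * epowr y a"
proof (cases "x = top \<or> y = top")
  case True
  then show ?thesis by (auto simp: ennreal_top_mult ennreal_mult_top)
next
  case False
  then show ?thesis
    by (cases x; cases y) (auto simp: epowr_ennreal powr_mult simp flip: ennreal_mult)
qed

lemma epowr_epowr: "epowr (epowr x a) b = epowr x (a * b)"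
  by (cases x) (auto simp: epowr_ennreal powr_powr)

lemma epowr_add: "epowr x (a + b) = epowr x a * epowr x b"
  by (cases x) (auto simp: epowr_ennreal powr_add simp flip: ennreal_mult)

lemma epowr_inverse: "0 < x \<Longrightarrow> x < top \<Longrightarrow> epowr (inverse x) a = inverse (epowr x a)"
  by (cases x) (auto simp: epowr_ennreal inverse_ennreal inverse_powr)

lemma epowr_le_iff:
  assumes "0 < a"
  shows "epowr x a \<le> y \<longleftrightarrow> x \<le> epowr y (1 / a)"
proof
  assume "epowr x a \<le> y"
  then have "epowr (epowr x a) (1 / a) \<le> epowr y (1 / a)" using assms by (intro epowr_mono) auto
  then show "x \<le> epowr y (1 / a)" using assms by (simp add: epowr_epowr)
next
  assume "x \<le> epowr y (1 / a)"
  then have "epowr x a \<le> epowr (epowr y (1 / a)) a" using assms by (intro epowr_mono) auto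
  then show "epowr x a \<le> y" using assms by (simp add: epowr_epowr)
qed

lemma epowr_SUP:
  assumes "0 < a"
  shows "epowr (SUP i\<in>I. f i) a = (SUP i\<in>I. epowr (f i) a)"
proof (rule antisym)
  show "epowr (SUP i\<in>I. f i) a \<le> (SUP i\<in>I. epowr (f i) a)"
    unfolding epowr_le_iff[OF assms]
    by (intro SUP_least) (auto simp: epowr_le_iff[OF assms, symmetric] intro: SUP_upper)
  show "(SUP i\<in>I. epowr (f i) a) \<le> epowr (SUP i\<in>I. f i) a"
    by (intro SUP_least epowr_mono SUP_upper) (use assms in auto)
qed

lemma measurable_epowr [measurable]:
  assumes [measurable]: "f \<in> borel_measurable M"
  shows "(\<lambda>x. epowr (f x) a) \<in> borel_measurable M"
  unfolding epowr_def by measurable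

text \<open>The graph of the convex function \<open>x powr q\<close> lies above its tangent at
  \<open>a\<close>. The terms are arranged so that nothing is subtracted, which lets the inequality
  pass to \<open>ennreal\<close>.\<close>

lemma young_tangent:
  fixes q x a :: real
  assumes "1 < q" "0 \<le> x" "0 \<le> a"
  shows "q * a powr (q - 1) * x \<le> x powr q + (q - 1) * a powr q"
proof -
  have "x * a powr (q - 1) \<le> x powr q / q + (a powr (q - 1)) powr (q / (q - 1)) / (q / (q - 1))"
    using assms by (intro Youngs_inequality) (auto simp: field_simps)
  also have "(a powr (q - 1)) powr (q / (q - 1)) = a powr q"
    using assms by (simp add: powr_powr)
  finally have "q * (x * a powr (q - 1)) \<le> q * (x powr q / q + a powr q / (q / (q - 1)))"
    using assms by (intro mult_left_mono) auto
  also have "\<dots> = x powr q + (q - 1) * a powr q"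
    using assms by (simp add: field_simps)
  finally show ?thesis by (simp add: mult_ac)
qed

lemma young_tangent_ennreal:
  assumes "1 < q" "0 \<le> a"
  shows "ennreal (q * a powr (q - 1)) * x \<le> epowr x q + ennreal ((q - 1) * a powr q)"
proof (cases x)
  case (real r)
  then show ?thesis
    using young_tangent[of q r a] assms
    by (auto simp: epowr_ennreal simp flip: ennreal_mult ennreal_plus intro!: ennreal_leI)
qed auto

text \<open>The tangent inequality is integrated against \<open>w\<close>, with the weighted mean of
  \<open>g\<close> as the point of tangency. In this form without division it includes weights of
  total mass zero, and with an indicator as weight it is Hoelder's inequality.\<close>

lemma jensen_weight:
  assumes q: "1 \<le> q" and [measurable]: "g \<in> borel_measurable M" "w \<in> borel_measurable M"
    and fin: "(\<integral>\<^sup>+x. w x \<partial>M) < top"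
  shows "epowr (\<integral>\<^sup>+x. g x * w x \<partial>M) q
    \<le> epowr (\<integral>\<^sup>+x. w x \<partial>M) (q - 1) * (\<integral>\<^sup>+x. epowr (g x) q * w x \<partial>M)"
proof (cases "(\<integral>\<^sup>+x. w x \<partial>M) = 0")
  case True
  then have "AE x in M. w x = 0"
    by (simp add: nn_integral_0_iff_AE)
  then have "(\<integral>\<^sup>+x. g x * w x \<partial>M) = 0"
    by (subst nn_integral_0_iff_AE) (auto elim!: AE_mp)
  then show ?thesis by simp
next
  case W0: False
  define R where "R = (\<integral>\<^sup>+x. epowr (g x) q * w x \<partial>M)"
  define X where "X = (\<integral>\<^sup>+x. g x * w x \<partial>M)"
  obtain W where W: "(\<integral>\<^sup>+x. w x \<partial>M) = ennreal W" "0 < W"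
    using fin W0 by (cases "\<integral>\<^sup>+x. w x \<partial>M") (auto simp: less_le)
  show ?thesis
  proof (cases "q = 1 \<or> R = top")
    case True
    then show ?thesis
      using W by (auto simp: epowr_ennreal R_def ennreal_mult_top)
  next
    case False
    then have q: "1 < q" using q by auto
    have tang: "ennreal (q * a powr (q - 1)) * X \<le> R + ennreal ((q - 1) * a powr q) * ennreal W"
      if "0 \<le> a" for a
    proof -
      have "ennreal (q * a powr (q - 1)) * X
          = (\<integral>\<^sup>+x. (ennreal (q * a powr (q - 1)) * g x) * w x \<partial>M)"
        unfolding X_def by (subst nn_integral_cmult[symmetric]) (auto simp: mult_ac)
      also have "\<dots> \<le> (\<integral>\<^sup>+x. (epowr (g x) q + ennreal ((q - 1) * a powr q)) * w x \<partial>M)"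
        by (intro nn_integral_mono mult_right_mono young_tangent_ennreal q that) auto
      also have "\<dots> = R + ennreal ((q - 1) * a powr q) * ennreal W"
        unfolding R_def W(1)[symmetric] by (simp add: distrib_right nn_integral_add nn_integral_cmult)
      finally show ?thesis .
    qed
    obtain r where r: "R = ennreal r" "0 \<le> r" using False by (cases R) auto
    \<comment> \<open>The mean \<open>X / W\<close> can be formed only for finite \<open>X\<close>.
      The tangent at 1 already bounds \<open>X\<close>.\<close>
    have "X \<noteq> top"
    proof
      assume "X = top"
      then have "ennreal (q * 1 powr (q - 1)) * X = top" using q by (simp add: ennreal_mult_top)
      moreover have "R + ennreal ((q - 1) * 1 powr q) * ennreal W \<noteq> top"
        using r by (simp add: ennreal_mult_eq_top_iff)
      ultimately show False using tang[of 1] by (simp add: top_unique)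
    qed
    then obtain x where x: "X = ennreal x" "0 \<le> x" by (cases X) auto
    \<comment> \<open>The tangent at \<open>x / W\<close> gives the sharpest of these
      bounds.\<close>
    have "ennreal (q * (x / W) powr (q - 1) * x) \<le> ennreal (r + (q - 1) * (x / W) powr q * W)"
      using tang[of "x / W"] x r W q by (simp add: ennreal_mult ennreal_plus)
    then have "q * (x / W) powr (q - 1) * x \<le> r + (q - 1) * (x / W) powr q * W"
      using r q W by (subst (asm) ennreal_le_iff) auto
    moreover have "(x / W) powr (q - 1) * x = (x / W) powr q * W"
      using x W by (cases "x = 0") (auto simp: powr_diff field_simps)
    ultimately have "(x / W) powr q * W \<le> r"
      by (simp add: algebra_simps)
    moreover have "x powr q = (x / W) powr q * W * W powr (q - 1)"
      using W by (simp add: powr_divide powr_diff field_simps)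
    ultimately have "x powr q \<le> r * W powr (q - 1)"
      using W by (simp add: mult_right_mono)
    then show ?thesis
      unfolding X_def[symmetric] R_def[symmetric] using x r W
      by (simp add: epowr_ennreal mult.commute flip: ennreal_mult)
  qed
qed

section \<open>Lebesgue norms, Minkowski's inequality and sums as integrals\<close>

definition lp :: "real \<Rightarrow> 'a measure \<Rightarrow> ('a \<Rightarrow> ennreal) \<Rightarrow> ennreal" where
  "lp q M g = epowr (\<integral>\<^sup>+x. epowr (g x) q \<partial>M) (1 / q)"

lemma lp_mono: "0 < q \<Longrightarrow> (\<And>x. x \<in> space M \<Longrightarrow> g x \<le> h x) \<Longrightarrow> lp q M g \<le> lp q M h"
  unfolding lp_def by (intro epowr_mono nn_integral_mono) auto

lemma epowr_lp: "0 < q \<Longrightarrow> epowr (lp q M g) q = (\<integral>\<^sup>+x. epowr (g x) q \<partial>M)"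
  by (simp add: lp_def epowr_epowr)

lemma lp_cmult:
  assumes [measurable]: "g \<in> borel_measurable M" and q: "0 < q"
  shows "lp q M (\<lambda>x. c * g x) = c * lp q M g"
proof -
  have "(\<integral>\<^sup>+x. epowr (c * g x) q \<partial>M) = epowr c q * (\<integral>\<^sup>+x. epowr (g x) q \<partial>M)"
    by (simp add: epowr_mult nn_integral_cmult)
  then show ?thesis using q by (simp add: lp_def epowr_mult epowr_epowr)
qed

lemma lp_SUP:
  assumes "\<And>n::nat. g n \<in> borel_measurable M" "incseq g" "0 < q"
  shows "lp q M (\<lambda>x. SUP n. g n x) = (SUP n. lp q M (g n))"
proof -
  have [measurable]: "\<And>n. g n \<in> borel_measurable M" by fact
  have "(\<integral>\<^sup>+x. epowr (SUP n. g n x) q \<partial>M) = (\<integral>\<^sup>+x. (SUP n. epowr (g n x) q) \<partial>M)"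
    using assms by (simp add: epowr_SUP)
  also have "\<dots> = (SUP n. \<integral>\<^sup>+x. epowr (g n x) q \<partial>M)"
    using assms by (intro nn_integral_monotone_convergence_SUP)
      (auto simp: incseq_def le_fun_def intro!: epowr_mono)
  finally show ?thesis using assms by (simp add: lp_def epowr_SUP)
qed

text \<open>
  Jensen's inequality with the weight \<open>w s = lp q N (G s)\<close> and Tonelli give Minkowski's inequality;
  a small integrable function is added to keep the weight positive.
\<close>

theorem minkowski_lp:
  assumes M: "sigma_finite_measure M" and N: "sigma_finite_measure N"
    and q: "1 \<le> q" and G: "case_prod G \<in> borel_measurable (M \<Otimes>\<^sub>M N)"
  shows "lp q N (\<lambda>z. \<integral>\<^sup>+s. G s z \<partial>M) \<le> (\<integral>\<^sup>+s. lp q N (G s) \<partial>M)"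
proof -
  interpret M: sigma_finite_measure M by fact
  interpret N: sigma_finite_measure N by fact
  interpret P: pair_sigma_finite M N ..
  have G' [measurable]: "(\<lambda>p. G (fst p) (snd p)) \<in> borel_measurable (M \<Otimes>\<^sub>M N)"
    using G by (simp add: case_prod_unfold)
  have [measurable]: "(\<lambda>p. G (snd p) (fst p)) \<in> borel_measurable (N \<Otimes>\<^sub>M M)"
    using measurable_compose[OF measurable_pair_swap' G] by (simp add: case_prod_unfold)
  define w where "w s = lp q N (G s)" for s
  have w [measurable]: "w \<in> borel_measurable M"
    unfolding w_def lp_def by measurable
  define W where "W = (\<integral>\<^sup>+s. w s \<partial>M)"
  show ?thesis
  proof (cases "W = top")
    case True
    then show ?thesis by (simp add: W_def w_def)
  next
    case False
    obtain h where h [measurable]: "h \<in> borel_measurable M" and hfin: "(\<integral>\<^sup>+s. h s \<partial>M) \<noteq> \<infinity>"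
      and hpos: "\<And>s. s \<in> space M \<Longrightarrow> 0 < h s \<and> h s < \<infinity>"
      using M.Ex_finite_integrable_function by auto
    have key: "lp q N (\<lambda>z. \<integral>\<^sup>+s. G s z \<partial>M) \<le> W + ennreal e * (\<integral>\<^sup>+s. h s \<partial>M)" if e: "0 < e" for e
    proof -
      define v where "v s = w s + ennreal e * h s" for s
      have [measurable]: "v \<in> borel_measurable M" unfolding v_def by measurable
      have V: "(\<integral>\<^sup>+s. v s \<partial>M) = W + ennreal e * (\<integral>\<^sup>+s. h s \<partial>M)"
        unfolding v_def W_def by (simp add: nn_integral_add nn_integral_cmult)
      also have "\<dots> < top" using False hfin by (simp add: less_top ennreal_mult_less_top)
      finally have Vfin: "(\<integral>\<^sup>+s. v s \<partial>M) < top" .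
      have vAE: "AE s in M. v s \<noteq> top"
        using nn_integral_PInf_AE[of v M] Vfin by (simp add: less_top)
      have vpos: "0 < v s" if "s \<in> space M" for s
        using hpos[OF that] e unfolding v_def
        by (intro add_nonneg_pos) (auto simp: ennreal_zero_less_mult_iff)
      \<comment> \<open>Jensen's inequality is applied to the quotient of \<open>G s z\<close> by
        \<open>v s\<close> with weight \<open>v\<close>. Since \<open>w s \<le> v s\<close>,
        integrating the \<open>q\<close>-th power of this quotient over \<open>z\<close> gives at
        most 1.\<close>
      have "epowr (\<integral>\<^sup>+s. G s z \<partial>M) q
          \<le> epowr (\<integral>\<^sup>+s. v s \<partial>M) (q - 1) * (\<integral>\<^sup>+s. epowr (G s z * inverse (v s)) q * v s \<partial>M)"
        if "z \<in> space N" for z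
      proof -
        have [measurable]: "(\<lambda>s. G s z) \<in> borel_measurable M"
          using measurable_compose[OF measurable_Pair2'[OF that] G] by simp
        have "(\<integral>\<^sup>+s. G s z \<partial>M) = (\<integral>\<^sup>+s. G s z * inverse (v s) * v s \<partial>M)"
        proof (intro nn_integral_cong_AE, use vAE AE_space in eventually_elim)
          fix s assume s: "v s \<noteq> top" "s \<in> space M"
          then have "inverse (v s) * v s = 1"
            using vpos[OF s(2)]
            by (auto simp: divide_ennreal_def[symmetric] divide_eq_1_ennreal mult.commute)
          then show "G s z = G s z * inverse (v s) * v s" by (simp add: mult.assoc)
        qed
        then show ?thesis using jensen_weight[OF q _ _ Vfin, of "\<lambda>s. G s z * inverse (v s)"] by simp
      qed
      then have "(\<integral>\<^sup>+z. epowr (\<integral>\<^sup>+s. G s z \<partial>M) q \<partial>N) \<le> (\<integral>\<^sup>+z. epowr (\<integral>\<^sup>+s. v s \<partial>M) (q - 1)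
          * (\<integral>\<^sup>+s. epowr (G s z * inverse (v s)) q * v s \<partial>M) \<partial>N)"
        by (intro nn_integral_mono)
      also have "\<dots> = epowr (\<integral>\<^sup>+s. v s \<partial>M) (q - 1)
          * (\<integral>\<^sup>+z. (\<integral>\<^sup>+s. epowr (G s z * inverse (v s)) q * v s \<partial>M) \<partial>N)"
        by (intro nn_integral_cmult) measurable
      also have "(\<integral>\<^sup>+z. (\<integral>\<^sup>+s. epowr (G s z * inverse (v s)) q * v s \<partial>M) \<partial>N)
          = (\<integral>\<^sup>+s. (\<integral>\<^sup>+z. epowr (G s z * inverse (v s)) q * v s \<partial>N) \<partial>M)"
        by (intro P.Fubini') (simp add: case_prod_unfold)
      also have "\<dots> \<le> (\<integral>\<^sup>+s. v s \<partial>M)"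
      proof (intro nn_integral_mono_AE, use vAE AE_space in eventually_elim)
        fix s assume s: "v s \<noteq> top" "s \<in> space M"
        have [measurable]: "(\<lambda>z. G s z) \<in> borel_measurable N"
          using measurable_compose[OF measurable_Pair1'[OF s(2)] G] by simp
        have "(\<integral>\<^sup>+z. epowr (G s z * inverse (v s)) q * v s \<partial>N)
            = epowr (w s) q * inverse (epowr (v s) q) * v s"
          using s vpos[OF s(2)] q
          by (simp add: epowr_mult nn_integral_multc epowr_inverse less_top w_def epowr_lp)
        also have "epowr (w s) q * inverse (epowr (v s) q) \<le> epowr (v s) q * inverse (epowr (v s) q)"
          using q by (intro mult_right_mono epowr_mono) (auto simp: v_def)
        also have "\<dots> = 1"
          using vpos[OF s(2)] s by (auto simp: divide_ennreal_def[symmetric] divide_eq_1_ennreal)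
        finally show "(\<integral>\<^sup>+z. epowr (G s z * inverse (v s)) q * v s \<partial>N) \<le> v s"
          by (simp add: mult_right_mono)
      qed
      also have "epowr (\<integral>\<^sup>+s. v s \<partial>M) (q - 1) * (\<integral>\<^sup>+s. v s \<partial>M) = epowr (\<integral>\<^sup>+s. v s \<partial>M) q"
        using epowr_add[of "\<integral>\<^sup>+s. v s \<partial>M" "q - 1" 1] by simp
      finally have "(\<integral>\<^sup>+z. epowr (\<integral>\<^sup>+s. G s z \<partial>M) q \<partial>N) \<le> epowr (\<integral>\<^sup>+s. v s \<partial>M) q"
        by (simp add: mult_left_mono)
      then have "lp q N (\<lambda>z. \<integral>\<^sup>+s. G s z \<partial>M) \<le> epowr (epowr (\<integral>\<^sup>+s. v s \<partial>M) q) (1 / q)"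
        unfolding lp_def using q by (intro epowr_mono) auto
      then show ?thesis using q V by (simp add: epowr_epowr)
    qed
    obtain H where H: "(\<integral>\<^sup>+s. h s \<partial>M) = ennreal H" "0 \<le> H"
      using hfin by (cases "\<integral>\<^sup>+s. h s \<partial>M") auto
    have "lp q N (\<lambda>z. \<integral>\<^sup>+s. G s z \<partial>M) \<le> W"
    proof (rule ennreal_le_epsilon)
      fix e :: real assume e: "0 < e"
      \<comment> \<open>The summand 1 in the denominator covers \<open>H = 0\<close>.\<close>
      have "lp q N (\<lambda>z. \<integral>\<^sup>+s. G s z \<partial>M) \<le> W + ennreal (e / (H + 1)) * ennreal H"
        using key[of "e / (H + 1)"] e H by simp
      also have "\<dots> \<le> W + ennreal e"
        using e H by (intro add_left_mono) (auto simp: field_simps simp flip: ennreal_mult intro!: ennreal_leI)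
      finally show "lp q N (\<lambda>z. \<integral>\<^sup>+s. G s z \<partial>M) \<le> W + ennreal e" .
    qed
    then show ?thesis by (simp add: W_def w_def)
  qed
qed

text \<open>Sums become integrals over counting measure, so that Tonelli, Minkowski and monotone
  convergence apply to them. Countability supplies an increasing sequence \<open>U n\<close> of
  finite sets exhausting the index type.\<close>

lemma infsum_ennreal_eq_nn_integral:
  fixes f :: "'i::countable \<Rightarrow> ennreal"
  shows "(\<Sum>\<^sub>\<infinity>i. f i) = (\<integral>\<^sup>+i. f i \<partial>count_space UNIV)"
proof (rule antisym)
  show "(\<Sum>\<^sub>\<infinity>i. f i) \<le> (\<integral>\<^sup>+i. f i \<partial>count_space UNIV)"
    unfolding nonneg_infsum_complete[of UNIV f, simplified]
  proof (intro SUP_least)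
    fix F :: "'i set" assume "F \<in> Collect finite"
    then have "sum f F = (\<integral>\<^sup>+i. f i * indicator F i \<partial>count_space UNIV)"
      by (subst nn_integral_count_space'[of F]) (auto simp: indicator_def)
    also have "\<dots> \<le> (\<integral>\<^sup>+i. f i \<partial>count_space UNIV)"
      by (intro nn_integral_mono) (auto simp: indicator_def)
    finally show "sum f F \<le> (\<integral>\<^sup>+i. f i \<partial>count_space UNIV)" .
  qed
  define U where "U n = {i::'i. to_nat i < n}" for n
  have fin: "finite (U n)" for n
    unfolding U_def using finite_vimageI[of "{..<n}" "to_nat :: 'i \<Rightarrow> nat"]
    by (simp add: vimage_def)
  have "(\<integral>\<^sup>+i. f i \<partial>count_space UNIV) = (\<integral>\<^sup>+i. (SUP n. f i * indicator (U n) i) \<partial>count_space UNIV)"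
  proof (intro nn_integral_cong)
    fix i :: 'i
    have "f i \<le> (SUP n. f i * indicator (U n) i)"
      by (rule SUP_upper2[of "Suc (to_nat i)"]) (auto simp: U_def)
    moreover have "(SUP n. f i * indicator (U n) i) \<le> f i"
      by (intro SUP_least) (auto simp: indicator_def)
    ultimately show "f i = (SUP n. f i * indicator (U n) i)" by simp
  qed
  also have "\<dots> = (SUP n. \<integral>\<^sup>+i. f i * indicator (U n) i \<partial>count_space UNIV)"
    by (intro nn_integral_monotone_convergence_SUP)
      (auto simp: incseq_def le_fun_def U_def indicator_def)
  also have "\<dots> \<le> (\<Sum>\<^sub>\<infinity>i. f i)"
    unfolding nonneg_infsum_complete[of UNIV f, simplified]
  proof (intro SUP_least)
    fix n
    have "(\<integral>\<^sup>+i. f i * indicator (U n) i \<partial>count_space UNIV) = sum f (U n)"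
      using fin by (subst nn_integral_count_space'[of "U n"]) (auto simp: indicator_def)
    then show "(\<integral>\<^sup>+i. f i * indicator (U n) i \<partial>count_space UNIV)
        \<le> (SUP F\<in>Collect finite. sum f F)"
      using fin by (auto intro!: SUP_upper2[of "U n"])
  qed
  finally show "(\<integral>\<^sup>+i. f i \<partial>count_space UNIV) \<le> (\<Sum>\<^sub>\<infinity>i. f i)" .
qed

lemma lq_norm_ennreal:
  fixes a :: "'i::countable \<Rightarrow> ennreal"
  shows "0 \<le> q \<Longrightarrow> lq_norm (ennreal q) a = lp q (count_space UNIV) a"
  by (simp add: lq_norm_def lp_def infsum_ennreal_eq_nn_integral)

section \<open>From weak type to strong type\<close>

text \<open>A power is the integral of its derivative from 0 to \<open>x\<close>; an infinite
  \<open>x\<close> is reached through the integers by monotonicity.\<close>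

lemma layer_cake:
  assumes a: "0 < a"
  shows "(\<integral>\<^sup>+l. (if 0 < l \<and> ennreal l < x then ennreal (a * l powr (a - 1)) else 0) \<partial>lborel) = epowr x a"
    (is "?I x = _")
proof -
  have fin: "?I (ennreal r) = epowr (ennreal r) a" if "0 \<le> r" for r
  proof -
    have "((\<lambda>l. a * l powr (a - 1)) has_integral a * (r powr (a - 1 + 1) / (a - 1 + 1))) {0..r}"
      using a that by (intro has_integral_mult_right has_integral_powr_from_0) auto
    then have "((\<lambda>l. indicator {0..r} l * (a * l powr (a - 1))) has_integral r powr a) UNIV"
      using a has_integral_restrict_UNIV[of "{0..r}" "\<lambda>l. a * l powr (a - 1)" "r powr a"]
      by (simp add: indicator_def of_bool_def if_distrib[of "\<lambda>c. c * _"] cong: if_cong)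
    then have "(\<integral>\<^sup>+l. ennreal (indicator {0..r} l * (a * l powr (a - 1))) \<partial>lborel) = ennreal (r powr a)"
      using a by (intro nn_integral_has_integral_lborel) (auto simp: indicator_def)
    \<comment> \<open>The strict inequalities and the closed interval disagree only at the two
      endpoints.\<close>
    moreover have "?I (ennreal r) = (\<integral>\<^sup>+l. ennreal (indicator {0..r} l * (a * l powr (a - 1))) \<partial>lborel)"
    proof (intro nn_integral_cong_AE, use AE_lborel_singleton[of r] AE_lborel_singleton[of 0]
        in eventually_elim)
      fix l :: real assume "l \<noteq> r" "l \<noteq> 0"
      then show "(if 0 < l \<and> ennreal l < ennreal r then ennreal (a * l powr (a - 1)) else 0)
          = ennreal (indicator {0..r} l * (a * l powr (a - 1)))"
        by (auto simp: indicator_def ennreal_less_iff)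
    qed
    ultimately show ?thesis using that by (simp add: epowr_ennreal)
  qed
  show ?thesis
  proof (cases x)
    case (real r)
    then show ?thesis using fin by simp
  next
    case top
    have "epowr top a = (SUP n::nat. epowr (of_nat n) a)"
      using epowr_SUP[OF a, of "of_nat" UNIV] by (simp add: ennreal_SUP_of_nat_eq_top)
    also have "\<dots> \<le> ?I top"
    proof (rule SUP_least)
      fix n :: nat
      have "epowr (of_nat n) a = ?I (ennreal (real n))"
        by (subst fin) (auto simp: ennreal_of_nat_eq_real_of_nat)
      also have "\<dots> \<le> ?I top" by (intro nn_integral_mono) auto
      finally show "epowr (of_nat n) a \<le> ?I top" .
    qed
    finally show ?thesis using top by (simp add: top_unique)
  qed
qed

text \<open>Tonelli. The extra factor \<open>g\<close> allows the right sides of weak type estimates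
  at all levels to be assembled into one integral of \<open>g\<close> against a power of
  \<open>f\<close>.\<close>

lemma layer_cake_weighted:
  assumes M: "sigma_finite_measure M" and a: "0 < a"
    and [measurable]: "f \<in> borel_measurable M" "g \<in> borel_measurable M"
  shows "(\<integral>\<^sup>+x. g x * epowr (f x) a \<partial>M)
    = (\<integral>\<^sup>+l. (if 0 < l then ennreal (a * l powr (a - 1)) * (\<integral>\<^sup>+x. g x * (if ennreal l < f x then 1 else 0) \<partial>M) else 0) \<partial>lborel)"
proof -
  interpret M: sigma_finite_measure M by fact
  interpret P: pair_sigma_finite lborel M ..
  have "(\<integral>\<^sup>+x. g x * epowr (f x) a \<partial>M)
      = (\<integral>\<^sup>+x. \<integral>\<^sup>+l. g x * (if 0 < l \<and> ennreal l < f x then ennreal (a * l powr (a - 1)) else 0) \<partial>lborel \<partial>M)"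
    by (simp add: nn_integral_cmult layer_cake[OF a])
  also have "\<dots> = (\<integral>\<^sup>+l. \<integral>\<^sup>+x. g x * (if 0 < l \<and> ennreal l < f x then ennreal (a * l powr (a - 1)) else 0) \<partial>M \<partial>lborel)"
    by (intro P.Fubini') measurable
  also have "\<dots> = (\<integral>\<^sup>+l. (if 0 < l then ennreal (a * l powr (a - 1)) * (\<integral>\<^sup>+x. g x * (if ennreal l < f x then 1 else 0) \<partial>M) else 0) \<partial>lborel)"
    by (intro nn_integral_cong)
      (auto simp: nn_integral_cmult[symmetric] mult_ac intro!: nn_integral_cong)
  finally show ?thesis .
qed

lemma layer_cake_emeasure:
  assumes M: "sigma_finite_measure M" and a: "0 < a"
    and [measurable]: "f \<in> borel_measurable M"
  shows "(\<integral>\<^sup>+x. epowr (f x) a \<partial>M)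
    = (\<integral>\<^sup>+l. (if 0 < l then ennreal (a * l powr (a - 1)) * emeasure M {x\<in>space M. ennreal l < f x} else 0) \<partial>lborel)"
proof -
  have "(\<integral>\<^sup>+x. (if ennreal l < f x then 1 else 0) \<partial>M) = emeasure M {x\<in>space M. ennreal l < f x}" for l
    by (rule trans[OF _ nn_integral_indicator]) (auto simp: indicator_def intro!: nn_integral_cong)
  then show ?thesis
    using layer_cake_weighted[OF M a, of f "\<lambda>_. 1"] by (simp cong: if_cong)
qed

text \<open>With \<open>c = 2 powr p * p / (p - 1)\<close>, integrating the weak type estimate over
  all levels bounds the integral of \<open>A ^ p\<close> by \<open>c\<close> times that of
  \<open>G * A ^ (p - 1)\<close>. Absorbing half of the left side turns \<open>c\<close> into
  \<open>(2 * c) powr p\<close>.\<close>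

definition doob_const :: "real \<Rightarrow> real" where
  "doob_const p = (2 * (2 powr p * p / (p - 1))) powr p"

text \<open>Doob's argument: integrate the weak estimate against the powers of the level, then
  absorb. The gap between the levels \<open>2 * l\<close> and \<open>l\<close> costs only the factor
  \<open>2 powr p\<close>; it leaves room for arguments that lose one \<open>l\<close> to a triangle
  inequality.\<close>

lemma weak_type_imp_strong_type:
  assumes fin: "finite_measure M" and p: "1 < p"
    and A [measurable]: "A \<in> borel_measurable M" and G [measurable]: "G \<in> borel_measurable M"
    and weak: "\<And>l. 0 < l \<Longrightarrow> ennreal l * emeasure M {x\<in>space M. ennreal (2 * l) < A x}
      \<le> (\<integral>\<^sup>+x. G x * (if ennreal l < A x then 1 else 0) \<partial>M)"
  shows "(\<integral>\<^sup>+x. epowr (A x) p \<partial>M) \<le> ennreal (doob_const p) * (\<integral>\<^sup>+x. epowr (G x) p \<partial>M)"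
proof -
  interpret finite_measure M by fact
  have sf: "sigma_finite_measure M" ..
  define c where "c = 2 powr p * p / (p - 1)"
  have c: "0 < c" using p by (simp add: c_def)
  define I where "I = (\<integral>\<^sup>+x. epowr (G x) p \<partial>M)"
  have trunc: "(\<integral>\<^sup>+x. epowr (min (A x) (of_nat n)) p \<partial>M) \<le> ennreal (doob_const p) * I" for n :: nat
  proof -
    \<comment> \<open>Absorption needs a finite left side. A bounded function on a finite measure
      space provides it, and the bound is independent of the truncation level.\<close>
    define B where "B x = min (A x) (of_nat n)" for x
    have [measurable]: "B \<in> borel_measurable M" unfolding B_def by measurable
    have weakB: "ennreal l * emeasure M {x\<in>space M. ennreal l < B x * inverse 2}
      \<le> (\<integral>\<^sup>+x. G x * (if ennreal l < B x then 1 else 0) \<partial>M)" if l: "0 < l" for l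
    proof -
      have eq: "ennreal l < y * inverse 2 \<longleftrightarrow> ennreal (2 * l) < y" for y
      proof (cases y)
        case (real r)
        then have "y * inverse 2 = ennreal (r / 2)"
          by (simp add: ennreal_half[symmetric] del: ennreal_half flip: ennreal_mult)
        then show ?thesis using l real by (auto simp: ennreal_less_iff)
      qed (auto simp: ennreal_top_mult)
      show ?thesis
      \<comment> \<open>Below the truncation level both superlevel sets are unchanged; above it the
        one on the left is empty.\<close>
      proof (cases "2 * l < real n")
        case True
        then have "ennreal (2 * l) < B x \<longleftrightarrow> ennreal (2 * l) < A x"
          "ennreal l < B x \<longleftrightarrow> ennreal l < A x" for x
          using l by (auto simp: B_def ennreal_of_nat_eq_real_of_nat ennreal_less_iff)
        then show ?thesis using weak[OF l] by (simp add: eq)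
      next
        case False
        then have "\<not> ennreal (2 * l) < B x" for x
          by (auto simp: B_def ennreal_of_nat_eq_real_of_nat ennreal_less_iff not_less)
        then show ?thesis by (simp add: eq)
      qed
    qed
    have half: "epowr (inverse 2) p = ennreal (inverse (2 powr p))"
      using epowr_inverse[of 2 p] epowr_ennreal[of 2 p] by (simp add: inverse_ennreal)
    have "(\<integral>\<^sup>+x. epowr (B x) p \<partial>M) * ennreal (inverse (2 powr p)) = (\<integral>\<^sup>+x. epowr (B x * inverse 2) p \<partial>M)"
      by (simp add: epowr_mult half nn_integral_multc)
    also have "\<dots> = (\<integral>\<^sup>+l. (if 0 < l then ennreal (p * l powr (p - 1)) *
        emeasure M {x\<in>space M. ennreal l < B x * inverse 2} else 0) \<partial>lborel)"
      using p by (intro layer_cake_emeasure[OF sf]) auto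
    \<comment> \<open>The factor \<open>l\<close> of the weak estimate is split off from
      \<open>l powr (p - 1)\<close>. What remains is, up to \<open>p / (p - 1)\<close>, the layer
      cake density for the exponent \<open>p - 1\<close>.\<close>
    also have "\<dots> \<le> (\<integral>\<^sup>+l. ennreal (p / (p - 1)) * (if 0 < l then ennreal ((p - 1) * l powr (p - 1 - 1)) *
        (\<integral>\<^sup>+x. G x * (if ennreal l < B x then 1 else 0) \<partial>M) else 0) \<partial>lborel)"
    proof (intro nn_integral_mono)
      fix l :: real
      show "(if 0 < l then ennreal (p * l powr (p - 1)) *
          emeasure M {x\<in>space M. ennreal l < B x * inverse 2} else 0)
        \<le> ennreal (p / (p - 1)) * (if 0 < l then ennreal ((p - 1) * l powr (p - 1 - 1)) *
        (\<integral>\<^sup>+x. G x * (if ennreal l < B x then 1 else 0) \<partial>M) else 0)"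
      proof (cases "0 < l")
        case True
        have e1: "ennreal (p * l powr (p - 1)) = ennreal (p * l powr (p - 1 - 1)) * ennreal l"
          using True p by (subst ennreal_mult[symmetric]) (auto simp: powr_diff field_simps power2_eq_square)
        have e2: "ennreal (p / (p - 1)) * ennreal ((p - 1) * l powr (p - 1 - 1)) = ennreal (p * l powr (p - 1 - 1))"
          using True p by (subst ennreal_mult[symmetric]) auto
        show ?thesis
          using mult_left_mono[OF weakB[OF True], of "ennreal (p * l powr (p - 1 - 1))"] True
          by (simp only: if_True e1 mult.assoc[symmetric] e2) simp
      qed simp
    qed
    also have "\<dots> = ennreal (p / (p - 1)) * (\<integral>\<^sup>+x. G x * epowr (B x) (p - 1) \<partial>M)"
      using p by (subst layer_cake_weighted[OF sf]) (auto intro!: nn_integral_cmult)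
    finally have "(\<integral>\<^sup>+x. epowr (B x) p \<partial>M) * ennreal (inverse (2 powr p)) * ennreal (2 powr p)
        \<le> ennreal (p / (p - 1)) * (\<integral>\<^sup>+x. G x * epowr (B x) (p - 1) \<partial>M) * ennreal (2 powr p)"
      by (intro mult_right_mono) auto
    then have "(\<integral>\<^sup>+x. epowr (B x) p \<partial>M) \<le> ennreal c * (\<integral>\<^sup>+x. G x * epowr (B x) (p - 1) \<partial>M)"
      using p by (simp add: c_def mult_ac ennreal_mult[symmetric] flip: mult.assoc)
    also have "\<dots> = (\<integral>\<^sup>+x. ennreal c * (G x * epowr (B x) (p - 1)) \<partial>M)"
      by (simp add: nn_integral_cmult)
    also have "\<dots> \<le> (\<integral>\<^sup>+x. ennreal (1 / 2) * epowr (B x) p + ennreal ((2 * c) powr p / 2) * epowr (G x) p \<partial>M)"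
    proof (intro nn_integral_mono)
      fix x
      obtain b where b: "B x = ennreal b" "0 \<le> b"
        using le_less_trans[of "B x" "of_nat n" top]
        by (cases "B x") (auto simp: B_def of_nat_less_top)
      show "ennreal c * (G x * epowr (B x) (p - 1))
          \<le> ennreal (1 / 2) * epowr (B x) p + ennreal ((2 * c) powr p / 2) * epowr (G x) p"
      proof (cases "G x")
        case (real g)
        \<comment> \<open>Young's inequality with a small factor on one side. If
          \<open>b \<le> 2 * c * g\<close>, the power of \<open>g\<close> dominates; otherwise
          \<open>c * g\<close> is less than half of \<open>b\<close>.\<close>
        have "c * (g * b powr (p - 1)) \<le> 1 / 2 * b powr p + (2 * c) powr p / 2 * g powr p"
        proof (cases "b \<le> 2 * c * g")
          case True
          have "c * (g * b powr (p - 1)) \<le> c * (g * (2 * c * g) powr (p - 1))"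
            using True b real p c by (intro mult_left_mono powr_mono2) auto
          also have "\<dots> = (2 * c) powr p / 2 * g powr p"
          proof (cases "g = 0")
            case False
            have "(2 * c) powr p * g powr p = (2 * c * g) powr p" by (simp add: powr_mult)
            also have "\<dots> = (2 * c * g) powr (p - 1) * (2 * c * g)"
              using False real c powr_add[of "2 * c * g" "p - 1" 1] by simp
            finally show ?thesis by (simp add: mult_ac)
          qed simp
          finally show ?thesis by (simp add: add_increasing)
        next
          case False
          then have "c * (g * b powr (p - 1)) = (c * g) * b powr (p - 1)" by simp
          also have "\<dots> \<le> (b / 2) * b powr (p - 1)"
            using False by (intro mult_right_mono) auto
          also have "\<dots> = 1 / 2 * b powr p"
            using b p powr_add[of b "p - 1" 1] by (cases "b = 0") auto
          finally show ?thesis by (simp add: add_increasing2)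
        qed
        then have "ennreal (c * (g * b powr (p - 1)))
            \<le> ennreal (1 / 2 * b powr p + (2 * c) powr p / 2 * g powr p)"
          by (rule ennreal_leI)
        then show ?thesis using b real c
          by (subst (asm) ennreal_plus) (auto simp: epowr_ennreal ennreal_mult' simp del: ennreal_half
              times_divide_eq_left times_divide_eq_right)
      next
        case top
        then show ?thesis using c by (simp add: ennreal_mult_top)
      qed
    qed
    also have "\<dots> = ennreal (1 / 2) * (\<integral>\<^sup>+x. epowr (B x) p \<partial>M) + ennreal ((2 * c) powr p / 2) * I"
      by (simp only: I_def) (subst nn_integral_add, auto simp: nn_integral_cmult)
    finally have le: "(\<integral>\<^sup>+x. epowr (B x) p \<partial>M)
        \<le> ennreal (1 / 2) * (\<integral>\<^sup>+x. epowr (B x) p \<partial>M) + ennreal ((2 * c) powr p / 2) * I" .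
    \<comment> \<open>Finiteness of the integral of \<open>B ^ p\<close> permits subtracting half of
      it.\<close>
    have "(\<integral>\<^sup>+x. epowr (B x) p \<partial>M) \<le> (\<integral>\<^sup>+x. epowr (of_nat n) p \<partial>M)"
      using p by (intro nn_integral_mono epowr_mono) (auto simp: B_def)
    also have "\<dots> < top"
      using emeasure_finite by (auto simp: ennreal_mult_eq_top_iff less_top[symmetric])
    finally obtain J where J: "(\<integral>\<^sup>+x. epowr (B x) p \<partial>M) = ennreal J" "0 \<le> J"
      by (cases "\<integral>\<^sup>+x. epowr (B x) p \<partial>M") auto
    have "ennreal J \<le> ennreal ((2 * c) powr p) * I"
    proof (cases I)
      case (real i)
      have "ennreal J \<le> ennreal (1 / 2 * J + (2 * c) powr p / 2 * i)"
        using le real J unfolding J(1)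
        by (subst ennreal_plus) (auto simp: ennreal_mult' simp del: ennreal_half
            times_divide_eq_left times_divide_eq_right)
      then have "J \<le> 1 / 2 * J + (2 * c) powr p / 2 * i"
        using real J by (subst (asm) ennreal_le_iff) auto
      then show ?thesis using real by (simp flip: ennreal_mult)
    next
      case top
      then show ?thesis using c by (simp add: ennreal_mult_top)
    qed
    then show ?thesis using J by (simp add: B_def doob_const_def c_def)
  qed
  have "(\<integral>\<^sup>+x. epowr (A x) p \<partial>M) = (\<integral>\<^sup>+x. (SUP n::nat. epowr (min (A x) (of_nat n)) p) \<partial>M)"
  proof (intro nn_integral_cong)
    fix x
    have "A x = (SUP n::nat. min (A x) (of_nat n))"
    proof -
      have "A x = min (A x) (SUP n::nat. of_nat n)" by (simp add: ennreal_SUP_of_nat_eq_top)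
      also have "\<dots> = (SUP n::nat. min (A x) (of_nat n))"
        using inf_SUP[of "A x" "of_nat :: nat \<Rightarrow> ennreal" UNIV] by (simp add: inf_min)
      finally show ?thesis .
    qed
    then show "epowr (A x) p = (SUP n::nat. epowr (min (A x) (of_nat n)) p)"
      using epowr_SUP[of p "\<lambda>n::nat. min (A x) (of_nat n)" UNIV] p by simp
  qed
  also have "\<dots> = (SUP n::nat. \<integral>\<^sup>+x. epowr (min (A x) (of_nat n)) p \<partial>M)"
    using p by (intro nn_integral_monotone_convergence_SUP)
      (auto simp: incseq_def le_fun_def min_le_iff_disj intro!: epowr_mono min.mono)
  also have "\<dots> \<le> ennreal (doob_const p) * I"
    by (intro SUP_least trunc)
  finally show ?thesis by (simp add: I_def)
qed

section \<open>Averages over dyadic filtrations of the line\<close>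

text \<open>A partition is given by the integer index of the cell in which a point lies. Sharing a
  cell is then an equality of integers, and there are only countably many cells.\<close>

definition cell :: "(nat \<Rightarrow> real \<Rightarrow> int) \<Rightarrow> nat \<Rightarrow> real \<Rightarrow> real set" where
  "cell \<iota> k x = {y. \<iota> k y = \<iota> k x}"

definition avg :: "(nat \<Rightarrow> real \<Rightarrow> int) \<Rightarrow> nat \<Rightarrow> (real \<Rightarrow> ennreal) \<Rightarrow> real \<Rightarrow> ennreal" where
  "avg \<iota> k g x = (\<integral>\<^sup>+y. g y * indicator (cell \<iota> k x) y \<partial>lborel) / emeasure lborel (cell \<iota> k x)"

definition max_avg :: "(nat \<Rightarrow> real \<Rightarrow> int) \<Rightarrow> nat \<Rightarrow> (real \<Rightarrow> ennreal) \<Rightarrow> real \<Rightarrow> ennreal" where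
  "max_avg \<iota> K g x = (SUP k\<in>{..K}. avg \<iota> k g x)"

text \<open>Larger generations are finer, and generation 0 is the coarsest, so a first generation
  with a given property makes sense. \<open>vol_double\<close> is the regularity that compares a
  cell with its parent.\<close>

locale dyadic_filtration =
  fixes \<iota> :: "nat \<Rightarrow> real \<Rightarrow> int"
  assumes meas_index [measurable]: "\<And>k. \<iota> k \<in> borel \<rightarrow>\<^sub>M count_space UNIV"
    and nested_Suc: "\<And>k x y. \<iota> (Suc k) x = \<iota> (Suc k) y \<Longrightarrow> \<iota> k x = \<iota> k y"
    and vol_pos: "\<And>k x. 0 < emeasure lborel (cell \<iota> k x)"
    and vol_fin: "\<And>k x. emeasure lborel (cell \<iota> k x) < top"
    and vol_double: "\<And>k x. emeasure lborel (cell \<iota> k x) \<le> 2 * emeasure lborel (cell \<iota> (Suc k) x)"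
begin

lemma nested: "j \<le> k \<Longrightarrow> \<iota> k x = \<iota> k y \<Longrightarrow> \<iota> j x = \<iota> j y"
  by (induction k rule: dec_induct) (auto intro: nested_Suc)

lemma cell_cong: "\<iota> k x = \<iota> k y \<Longrightarrow> cell \<iota> k x = cell \<iota> k y"
  by (simp add: cell_def)

lemma mem_cell: "y \<in> cell \<iota> k x \<longleftrightarrow> \<iota> k y = \<iota> k x"
  by (simp add: cell_def)

lemma sets_cell [measurable]: "cell \<iota> k x \<in> sets borel"
proof -
  have "{y \<in> space borel. \<iota> k y = \<iota> k x} \<in> sets borel" by measurable
  then show ?thesis by (simp add: cell_def)
qed

lemma avg_cong: "\<iota> k x = \<iota> k y \<Longrightarrow> avg \<iota> k g x = avg \<iota> k g y"
  unfolding avg_def by (drule cell_cong) simp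

text \<open>A function constant on cells factors through the countable discrete space of
  indices.\<close>

lemma meas_indexed:
  fixes h :: "real \<Rightarrow> ennreal"
  assumes "\<And>x y. \<iota> k x = \<iota> k y \<Longrightarrow> h x = h y"
  shows "h \<in> borel_measurable borel"
proof -
  have "(\<lambda>m. h (SOME x. \<iota> k x = m)) \<in> borel_measurable (count_space UNIV)"
    by simp
  then have "(\<lambda>x. h (SOME z. \<iota> k z = \<iota> k x)) \<in> borel_measurable borel"
    by (rule measurable_compose[OF meas_index])
  moreover have "h (SOME z. \<iota> k z = \<iota> k x) = h x" for x
    by (rule assms) (rule someI[of "\<lambda>z. \<iota> k z = \<iota> k x" x], simp)
  ultimately show ?thesis by (simp only:)
qed

lemma meas_avg [measurable]: "avg \<iota> k g \<in> borel_measurable borel"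
  by (rule meas_indexed[of k]) (rule avg_cong)

lemma meas_max_avg [measurable]: "max_avg \<iota> K g \<in> borel_measurable borel"
  unfolding max_avg_def by measurable

lemma meas_vol [measurable]: "(\<lambda>x. emeasure lborel (cell \<iota> k x)) \<in> borel_measurable borel"
  by (rule meas_indexed[of k]) (drule cell_cong, simp)

lemma meas_avg_param [measurable]:
  assumes F: "case_prod F \<in> borel_measurable (borel \<Otimes>\<^sub>M M)"
  shows "(\<lambda>(x, y). avg \<iota> k (\<lambda>z. F z y) x) \<in> borel_measurable (borel \<Otimes>\<^sub>M M)"
proof -
  have [measurable]: "(\<lambda>q. F (snd q) (snd (fst q))) \<in> borel_measurable ((borel \<Otimes>\<^sub>M M) \<Otimes>\<^sub>M lborel)"
    using measurable_compose[OF _ F, of "\<lambda>q. (snd q, snd (fst q))" "(borel \<Otimes>\<^sub>M M) \<Otimes>\<^sub>M lborel"]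
    by simp
  have [measurable]: "(\<lambda>q. \<iota> k (snd q)) \<in> ((borel \<Otimes>\<^sub>M M) \<Otimes>\<^sub>M lborel) \<rightarrow>\<^sub>M count_space UNIV"
    by (rule measurable_compose[OF _ meas_index]) simp
  have [measurable]: "(\<lambda>q. \<iota> k (fst (fst q))) \<in> ((borel \<Otimes>\<^sub>M M) \<Otimes>\<^sub>M lborel) \<rightarrow>\<^sub>M count_space UNIV"
    by (rule measurable_compose[OF _ meas_index]) simp
  have eq: "(\<integral>\<^sup>+z. F z y * indicator (cell \<iota> k x) z \<partial>lborel)
      = (\<integral>\<^sup>+z. (if \<iota> k z = \<iota> k x then F z y else 0) \<partial>lborel)" for x y
    by (intro nn_integral_cong) (auto simp: cell_def)
  show ?thesis
    unfolding avg_def case_prod_unfold eq by measurable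
qed

lemma avg_mono: "(\<And>z. z \<in> cell \<iota> k x \<Longrightarrow> g z \<le> h z) \<Longrightarrow> avg \<iota> k g x \<le> avg \<iota> k h x"
  unfolding avg_def by (intro divide_right_mono_ennreal nn_integral_mono) (auto simp: indicator_def)

lemma avg_const: "avg \<iota> k (\<lambda>_. c) x = c"
  using vol_pos[of k x] vol_fin[of k x]
  by (simp add: avg_def nn_integral_cmult ennreal_mult_divide_eq)

lemma avg_le_iff_integral:
  "avg \<iota> k g x \<le> avg \<iota> k h x \<longleftrightarrow>
    (\<integral>\<^sup>+y. g y * indicator (cell \<iota> k x) y \<partial>lborel) \<le> (\<integral>\<^sup>+y. h y * indicator (cell \<iota> k x) y \<partial>lborel)"
proof -
  have v: "emeasure lborel (cell \<iota> k x) \<noteq> 0" "emeasure lborel (cell \<iota> k x) \<noteq> top"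
    using vol_pos[of k x] vol_fin[of k x] by auto
  have "a / v \<le> b / v \<longleftrightarrow> a \<le> b" if "v \<noteq> 0" "v \<noteq> top" for a b v :: ennreal
    using that ennreal_mult_le_mult_iff[of "inverse v" a b]
    by (simp add: divide_ennreal_def mult.commute)
  then show ?thesis using v by (simp add: avg_def)
qed

text \<open>Enlarging a cell to its parent can only increase the integral and at most doubles the
  volume.\<close>

lemma avg_parent:
  shows "avg \<iota> (Suc k) g x \<le> 2 * avg \<iota> k g x"
proof -
  let ?v = "emeasure lborel (cell \<iota> k x)" and ?w = "emeasure lborel (cell \<iota> (Suc k) x)"
  have v: "?v \<noteq> 0" "?v \<noteq> top" "?w \<noteq> 0" "?w \<noteq> top"
    using vol_pos[of k x] vol_fin[of k x] vol_pos[of "Suc k" x] vol_fin[of "Suc k" x] by auto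
  have inv: "inverse ?w \<le> 2 * inverse ?v"
  proof -
    have "?v * (inverse ?v * inverse ?w) \<le> 2 * ?w * (inverse ?v * inverse ?w)"
      by (intro mult_right_mono vol_double) auto
    moreover have "?v * inverse ?v = 1" "?w * inverse ?w = 1"
      using v by (auto simp: divide_ennreal_def[symmetric] divide_eq_1_ennreal)
    moreover have "?v * (inverse ?v * inverse ?w) = (?v * inverse ?v) * inverse ?w"
      "2 * ?w * (inverse ?v * inverse ?w) = 2 * inverse ?v * (?w * inverse ?w)"
      by (simp_all only: mult_ac)
    ultimately show ?thesis by simp
  qed
  have "avg \<iota> (Suc k) g x \<le> (\<integral>\<^sup>+y. g y * indicator (cell \<iota> k x) y \<partial>lborel) * inverse ?w"
    unfolding avg_def divide_ennreal_def
    by (intro mult_right_mono nn_integral_mono) (auto simp: indicator_def mem_cell dest: nested_Suc)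
  also have "\<dots> \<le> (\<integral>\<^sup>+y. g y * indicator (cell \<iota> k x) y \<partial>lborel) * (2 * inverse ?v)"
    by (intro mult_left_mono inv) auto
  finally show ?thesis by (simp add: avg_def divide_ennreal_def mult_ac)
qed

lemma avg_jensen:
  assumes q: "1 \<le> q" and [measurable]: "g \<in> borel_measurable borel"
  shows "epowr (avg \<iota> k g x) q \<le> avg \<iota> k (\<lambda>z. epowr (g z) q) x"
proof -
  let ?v = "emeasure lborel (cell \<iota> k x)"
  have v: "0 < ?v" "?v < top" "?v \<noteq> 0" "?v \<noteq> top" using vol_pos[of k x] vol_fin[of k x] by auto
  have "epowr (\<integral>\<^sup>+z. g z * indicator (cell \<iota> k x) z \<partial>lborel) q
      \<le> epowr ?v (q - 1) * (\<integral>\<^sup>+z. epowr (g z) q * indicator (cell \<iota> k x) z \<partial>lborel)"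
    using jensen_weight[OF q, of g lborel "indicator (cell \<iota> k x)"] v by simp
  then have "epowr (avg \<iota> k g x) q
      \<le> epowr ?v (q - 1) * (\<integral>\<^sup>+z. epowr (g z) q * indicator (cell \<iota> k x) z \<partial>lborel) * inverse (epowr ?v q)"
    using v by (auto simp: avg_def divide_ennreal_def epowr_mult epowr_inverse intro: mult_right_mono)
  also have "epowr ?v q = epowr ?v (q - 1) * ?v"
    using epowr_add[of ?v "q - 1" 1] by simp
  also have "inverse (epowr ?v (q - 1) * ?v) = inverse (epowr ?v (q - 1)) * inverse ?v"
    using v by (intro ennreal_inverse_mult) auto
  also have "epowr ?v (q - 1) * (\<integral>\<^sup>+z. epowr (g z) q * indicator (cell \<iota> k x) z \<partial>lborel)
      * (inverse (epowr ?v (q - 1)) * inverse ?v)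
    = (epowr ?v (q - 1) * inverse (epowr ?v (q - 1))) * avg \<iota> k (\<lambda>z. epowr (g z) q) x"
    by (simp add: avg_def divide_ennreal_def mult_ac)
  also have "epowr ?v (q - 1) * inverse (epowr ?v (q - 1)) = 1"
    using v by (subst divide_ennreal_def[symmetric]) (auto simp: divide_eq_1_ennreal)
  finally show ?thesis by simp
qed

text \<open>This says that \<open>B\<close> is a union of cells of generation \<open>k\<close>, that
  is, an event of the \<open>k\<close>-th sigma-algebra.\<close>

definition sat :: "nat \<Rightarrow> real set \<Rightarrow> bool" where
  "sat k B \<longleftrightarrow> (\<forall>x y. \<iota> k x = \<iota> k y \<longrightarrow> x \<in> B \<longrightarrow> y \<in> B)"

lemma sat_iff: "sat k B \<Longrightarrow> \<iota> k x = \<iota> k y \<Longrightarrow> x \<in> B \<longleftrightarrow> y \<in> B"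
  unfolding sat_def by metis

lemma sat_cell: "sat k (cell \<iota> k x)"
  by (auto simp: sat_def cell_def)

text \<open>Averaging is conditional expectation. Its kernel, the indicator of sharing a cell
  divided by the volume of that cell, is symmetric, so Tonelli moves it onto the indicator of
  \<open>B\<close>, which it leaves unchanged.\<close>

lemma integral_avg:
  assumes "sat k B" and B [measurable]: "B \<in> sets borel" and [measurable]: "g \<in> borel_measurable borel"
  shows "(\<integral>\<^sup>+x. avg \<iota> k g x * indicator B x \<partial>lborel) = (\<integral>\<^sup>+x. g x * indicator B x \<partial>lborel)"
proof -
  have "(\<integral>\<^sup>+x. avg \<iota> k g x * indicator B x \<partial>lborel)
      = (\<integral>\<^sup>+x. \<integral>\<^sup>+y. (if \<iota> k y = \<iota> k x then g y * (indicator B x / emeasure lborel (cell \<iota> k x)) else 0) \<partial>lborel \<partial>lborel)"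
  proof (intro nn_integral_cong)
    fix x
    have "avg \<iota> k g x * indicator B x
        = (\<integral>\<^sup>+y. (g y * indicator (cell \<iota> k x) y) * (indicator B x / emeasure lborel (cell \<iota> k x)) \<partial>lborel)"
      by (subst nn_integral_multc) (auto simp: avg_def divide_ennreal_def mult_ac)
    also have "\<dots> = (\<integral>\<^sup>+y. (if \<iota> k y = \<iota> k x then g y * (indicator B x / emeasure lborel (cell \<iota> k x)) else 0) \<partial>lborel)"
      by (intro nn_integral_cong) (auto simp: cell_def)
    finally show "avg \<iota> k g x * indicator B x
        = (\<integral>\<^sup>+y. (if \<iota> k y = \<iota> k x then g y * (indicator B x / emeasure lborel (cell \<iota> k x)) else 0) \<partial>lborel)" .
  qed
  also have "\<dots> = (\<integral>\<^sup>+y. \<integral>\<^sup>+x. (if \<iota> k y = \<iota> k x then g y * (indicator B x / emeasure lborel (cell \<iota> k x)) else 0) \<partial>lborel \<partial>lborel)"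
    by (intro lborel_pair.Fubini') measurable
  also have "\<dots> = (\<integral>\<^sup>+y. g y * indicator B y \<partial>lborel)"
  proof (intro nn_integral_cong)
    fix y
    have "(\<integral>\<^sup>+x. (if \<iota> k y = \<iota> k x then g y * (indicator B x / emeasure lborel (cell \<iota> k x)) else 0) \<partial>lborel)
      = (\<integral>\<^sup>+x. (g y * indicator B y / emeasure lborel (cell \<iota> k y)) * indicator (cell \<iota> k y) x \<partial>lborel)"
    proof (intro nn_integral_cong)
      fix x
      show "(if \<iota> k y = \<iota> k x then g y * (indicator B x / emeasure lborel (cell \<iota> k x)) else 0)
        = (g y * indicator B y / emeasure lborel (cell \<iota> k y)) * indicator (cell \<iota> k y) x"
      proof (cases "\<iota> k y = \<iota> k x")
        case True
        then have "indicator B x = (indicator B y :: ennreal)" "cell \<iota> k x = cell \<iota> k y"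
          using sat_iff[OF assms(1) True] cell_cong[OF True] by (auto simp: indicator_def)
        then show ?thesis using True by (simp add: mem_cell ennreal_times_divide)
      qed (auto simp: cell_def)
    qed
    also have "\<dots> = g y * indicator B y"
    proof -
      have "emeasure lborel (cell \<iota> k y) / emeasure lborel (cell \<iota> k y) = 1"
        using vol_pos[of k y] vol_fin[of k y] by (auto simp: divide_eq_1_ennreal)
      then show ?thesis
        by (subst nn_integral_cmult) (auto simp: ennreal_divide_times)
    qed
    finally show "(\<integral>\<^sup>+x. (if \<iota> k y = \<iota> k x then g y * (indicator B x / emeasure lborel (cell \<iota> k x)) else 0) \<partial>lborel)
      = g y * indicator B y" .
  qed
  finally show ?thesis .
qed

lemma sat_integral_mono:
  assumes "sat k B" "B \<in> sets borel" "g \<in> borel_measurable borel" "h \<in> borel_measurable borel"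
    and "\<And>x. x \<in> B \<Longrightarrow> avg \<iota> k g x \<le> avg \<iota> k h x"
  shows "(\<integral>\<^sup>+x. g x * indicator B x \<partial>lborel) \<le> (\<integral>\<^sup>+x. h x * indicator B x \<partial>lborel)"
  unfolding integral_avg[OF assms(1,2,3), symmetric] integral_avg[OF assms(1,2,4), symmetric]
  by (intro nn_integral_mono) (auto simp: indicator_def assms(5))

text \<open>The superlevel set of \<open>A K\<close> is split by the first generation at which
  \<open>A\<close> exceeds \<open>l\<close>. The \<open>k\<close>-th piece depends on generations up
  to \<open>k\<close> only, hence is a union of cells of generation \<open>k\<close>, on each of
  which the averages are compared.\<close>

lemma stopping_integral_mono:
  fixes A :: "nat \<Rightarrow> real \<Rightarrow> ennreal"
  assumes adapted: "\<And>k x y. \<iota> k x = \<iota> k y \<Longrightarrow> A k x = A k y"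
    and inc: "\<And>x. incseq (\<lambda>k. A k x)"
    and D: "sat 0 D" "D \<in> sets borel"
    and g [measurable]: "g \<in> borel_measurable borel" and h [measurable]: "h \<in> borel_measurable borel"
    and stop: "\<And>k x. k \<le> K \<Longrightarrow> l < A k x \<Longrightarrow> (\<And>j. j < k \<Longrightarrow> A j x \<le> l) \<Longrightarrow> avg \<iota> k g x \<le> avg \<iota> k h x"
  shows "(\<integral>\<^sup>+x. g x * indicator (D \<inter> {x. l < A K x}) x \<partial>lborel)
    \<le> (\<integral>\<^sup>+x. h x * indicator (D \<inter> {x. l < A K x}) x \<partial>lborel)"
proof -
  have [measurable]: "A k \<in> borel_measurable borel" for k
    by (rule meas_indexed[of k]) (rule adapted)
  note D(2) [measurable]
  define B where "B k = D \<inter> {x \<in> space borel. l < A k x \<and> (\<forall>j\<in>{..<k}. A j x \<le> l)}" for k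
  have B_meas [measurable]: "B k \<in> sets borel" for k unfolding B_def by measurable
  have B_sat: "sat k (B k)" for k
    unfolding sat_def
  proof (intro allI impI)
    fix x y assume e: "\<iota> k x = \<iota> k y" and x: "x \<in> B k"
    have "A j x = A j y" if "j \<le> k" for j
      using adapted nested[OF that e] by blast
    moreover have "y \<in> D" using sat_iff[OF D(1) nested[OF _ e]] x by (auto simp: B_def)
    ultimately show "y \<in> B k" using x by (auto simp: B_def)
  qed
  have split: "indicator (D \<inter> {x. l < A K x}) x = (\<Sum>k\<le>K. indicator (B k) x :: ennreal)" for x
  proof (cases "x \<in> D \<and> l < A K x")
    case True
    define m where "m = (LEAST k. l < A k x)"
    have m: "l < A m x" "m \<le> K" "\<And>j. j < m \<Longrightarrow> \<not> l < A j x"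
      unfolding m_def using True by (auto intro: LeastI Least_le dest: not_less_Least)
    have "x \<in> B k \<longleftrightarrow> k = m" for k
    proof (cases k m rule: linorder_cases)
      case less
      then show ?thesis using m(3)[OF less] by (auto simp: B_def)
    next
      case equal
      then show ?thesis using m True by (auto simp: B_def not_less)
    next
      case greater
      then show ?thesis using m(1) by (auto simp: B_def not_le)
    qed
    then have "(\<Sum>k\<le>K. indicator (B k) x :: ennreal) = (\<Sum>k\<le>K. if k = m then 1 else 0)"
      by (intro sum.cong) (auto simp: indicator_def)
    then show ?thesis using m True by (simp add: sum.delta)
  next
    case False
    have "x \<notin> B k" if "k \<le> K" for k
      using False incseqD[OF inc that] by (auto simp: B_def dest: order.strict_trans2)
    then show ?thesis using False by (auto simp: indicator_def)
  qed
  have "(\<integral>\<^sup>+x. g x * indicator (D \<inter> {x. l < A K x}) x \<partial>lborel)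
      = (\<Sum>k\<le>K. \<integral>\<^sup>+x. g x * indicator (B k) x \<partial>lborel)"
    unfolding split sum_distrib_left by (subst nn_integral_sum) auto
  also have "\<dots> \<le> (\<Sum>k\<le>K. \<integral>\<^sup>+x. h x * indicator (B k) x \<partial>lborel)"
    by (intro sum_mono sat_integral_mono[OF B_sat]) (auto simp: B_def intro: stop)
  also have "\<dots> = (\<integral>\<^sup>+x. h x * indicator (D \<inter> {x. l < A K x}) x \<partial>lborel)"
    unfolding split sum_distrib_left by (subst nn_integral_sum) auto
  finally show ?thesis .
qed

text \<open>The hypothesis is the conditional form, in the spirit of Garsia and Neveu, of the weak type
  estimate of \<open>weak_type_imp_strong_type\<close>.\<close>

lemma garsia:
  fixes A :: "nat \<Rightarrow> real \<Rightarrow> ennreal"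
  assumes adapted: "\<And>k x y. \<iota> k x = \<iota> k y \<Longrightarrow> A k x = A k y"
    and inc: "\<And>x. incseq (\<lambda>k. A k x)"
    and G [measurable]: "G \<in> borel_measurable borel" and p: "1 < p"
    and stop: "\<And>k x l. 0 < l \<Longrightarrow> k \<le> K \<Longrightarrow> ennreal l < A k x \<Longrightarrow> (\<And>j. j < k \<Longrightarrow> A j x \<le> ennreal l) \<Longrightarrow>
      avg \<iota> k (\<lambda>y. ennreal l * (if ennreal (2 * l) < A K y then 1 else 0)) x \<le> avg \<iota> k G x"
  shows "(\<integral>\<^sup>+x. epowr (A K x) p \<partial>lborel) \<le> ennreal (doob_const p) * (\<integral>\<^sup>+x. epowr (G x) p \<partial>lborel)"
proof -
  have [measurable]: "A k \<in> borel_measurable borel" for k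
    by (rule meas_indexed[of k]) (rule adapted)
  \<comment> \<open>The passage from weak to strong type is available on finite measures only, so it
    is carried out on one coarsest cell at a time.\<close>
  have local: "(\<integral>\<^sup>+x. epowr (A K x) p * indicator (cell \<iota> 0 x0) x \<partial>lborel)
      \<le> (\<integral>\<^sup>+x. (ennreal (doob_const p) * epowr (G x) p) * indicator (cell \<iota> 0 x0) x \<partial>lborel)" for x0
  proof -
    define D where "D = cell \<iota> 0 x0"
    define M where "M = density lborel (indicator D)"
    have [measurable]: "D \<in> sets borel" by (simp add: D_def)
    have [simp]: "space M = UNIV" "sets M = sets borel" by (simp_all add: M_def)
    have [measurable_cong]: "sets M = sets borel" by simp
    have int: "(\<integral>\<^sup>+x. f x \<partial>M) = (\<integral>\<^sup>+x. f x * indicator D x \<partial>lborel)"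
      if [measurable]: "f \<in> borel_measurable borel" for f
      unfolding M_def by (subst nn_integral_density) (auto simp: mult.commute)
    have "emeasure M UNIV = emeasure lborel D"
      unfolding M_def by (subst emeasure_density) (auto simp: D_def)
    then have "finite_measure M"
      using vol_fin[of 0 x0] by (intro finite_measureI) (auto simp: D_def)
    then have "(\<integral>\<^sup>+x. epowr (A K x) p \<partial>M) \<le> ennreal (doob_const p) * (\<integral>\<^sup>+x. epowr (G x) p \<partial>M)"
    proof (rule weak_type_imp_strong_type[OF _ p])
      fix l :: real assume l: "0 < l"
      have "ennreal l * emeasure M {x \<in> space M. ennreal (2 * l) < A K x}
          = (\<integral>\<^sup>+x. ennreal l * indicator {x. ennreal (2 * l) < A K x} x \<partial>M)"
        by (subst nn_integral_cmult_indicator) auto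
      also have "\<dots> = (\<integral>\<^sup>+x. (ennreal l * (if ennreal (2 * l) < A K x then 1 else 0))
          * indicator (D \<inter> {x. ennreal l < A K x}) x \<partial>lborel)"
      proof -
        \<comment> \<open>Exceeding \<open>2 * l\<close> implies exceeding \<open>l\<close>, so the
          left integrand lives on the set that the stopping lemma handles.\<close>
        have "ennreal l < A K x" if "ennreal (2 * l) < A K x" for x
          using that l by (intro le_less_trans[OF _ that] ennreal_leI) auto
        then show ?thesis
          by (subst int) (auto intro!: nn_integral_cong simp: indicator_def)
      qed
      also have "\<dots> \<le> (\<integral>\<^sup>+x. G x * indicator (D \<inter> {x. ennreal l < A K x}) x \<partial>lborel)"
      proof (rule stopping_integral_mono[OF adapted inc])
        show "sat 0 D" by (simp add: D_def sat_cell)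
      qed (use stop[OF l] in auto)
      also have "\<dots> = (\<integral>\<^sup>+x. G x * (if ennreal l < A K x then 1 else 0) \<partial>M)"
        by (subst int) (auto intro!: nn_integral_cong simp: indicator_def)
      finally show "ennreal l * emeasure M {x \<in> space M. ennreal (2 * l) < A K x}
        \<le> (\<integral>\<^sup>+x. G x * (if ennreal l < A K x then 1 else 0) \<partial>M)" .
    qed auto
    then show ?thesis
      by (simp add: int D_def nn_integral_cmult mult.assoc)
  qed
  \<comment> \<open>The line is the union of the coarsest cells, and the local estimates add up with
    the same constant.\<close>
  have "(\<integral>\<^sup>+x. epowr (A K x) p * indicator UNIV x \<partial>lborel)
      \<le> (\<integral>\<^sup>+x. (ennreal (doob_const p) * epowr (G x) p) * indicator UNIV x \<partial>lborel)"
    by (rule sat_integral_mono[of 0]) (auto simp: sat_def avg_le_iff_integral local)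
  then show ?thesis by (simp add: nn_integral_cmult)
qed

lemma max_avg_cong: "\<iota> K x = \<iota> K y \<Longrightarrow> max_avg \<iota> K g x = max_avg \<iota> K g y"
  unfolding max_avg_def by (rule SUP_cong[OF refl], rule avg_cong, rule nested[of _ K]) auto

lemma max_avg_incseq: "incseq (\<lambda>K. max_avg \<iota> K g x)"
  unfolding max_avg_def by (auto simp: incseq_def intro!: SUP_subset_mono)

lemma less_max_avgD:
  "l < max_avg \<iota> k g x \<Longrightarrow> (\<And>j. j < k \<Longrightarrow> max_avg \<iota> j g x \<le> l) \<Longrightarrow> l < avg \<iota> k g x"
proof -
  assume l: "l < max_avg \<iota> k g x" and less: "\<And>j. j < k \<Longrightarrow> max_avg \<iota> j g x \<le> l"
  from l obtain j where j: "j \<le> k" "l < avg \<iota> j g x"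
    unfolding max_avg_def less_SUP_iff by auto
  have "avg \<iota> j g x \<le> max_avg \<iota> j g x" unfolding max_avg_def by (auto intro: SUP_upper)
  with less[of j] j have "\<not> j < k" by (meson leD order.strict_trans2)
  with j show "l < avg \<iota> k g x" by simp
qed

text \<open>On a stopping cell the function to be averaged is at most \<open>l\<close>, while the
  average of \<open>g\<close>, which caused the stop, exceeds \<open>l\<close>. So
  \<open>garsia\<close> applies with \<open>G = g\<close>.\<close>

theorem doob:
  assumes p: "1 < p" and [measurable]: "g \<in> borel_measurable borel"
  shows "(\<integral>\<^sup>+x. epowr (max_avg \<iota> K g x) p \<partial>lborel) \<le> ennreal (doob_const p) * (\<integral>\<^sup>+x. epowr (g x) p \<partial>lborel)"
proof (rule garsia[OF max_avg_cong max_avg_incseq _ p])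
  fix k x and l :: real
  assume "ennreal l < max_avg \<iota> k g x" "\<And>j. j < k \<Longrightarrow> max_avg \<iota> j g x \<le> ennreal l"
  then have "ennreal l < avg \<iota> k g x" by (rule less_max_avgD)
  have "avg \<iota> k (\<lambda>y. ennreal l * (if ennreal (2 * l) < max_avg \<iota> K g y then 1 else 0)) x
      \<le> avg \<iota> k (\<lambda>y. ennreal l) x" by (intro avg_mono) auto
  also have "\<dots> \<le> avg \<iota> k g x" using \<open>ennreal l < avg \<iota> k g x\<close> by (simp add: avg_const)
  finally show "avg \<iota> k (\<lambda>y. ennreal l * (if ennreal (2 * l) < max_avg \<iota> K g y then 1 else 0)) x
    \<le> avg \<iota> k g x" .
qed auto

end

section \<open>Dyadic maximal functions with values in a lattice\<close>

text \<open>\<open>\<rho>\<close> plays the norm of a Banach lattice of functions on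
  \<open>M\<close>, extended by allowing infinite values. The \<open>minkowski\<close> axiom
  replaces the norm inequality for Bochner integrals, and \<open>meas\<close> makes the norm of a
  parameter-dependent function integrable in the extended sense.\<close>

locale lattice_norm =
  fixes M :: "'y measure" and \<rho> :: "('y \<Rightarrow> ennreal) \<Rightarrow> ennreal"
  assumes mono: "\<And>g h. (\<And>y. y \<in> space M \<Longrightarrow> g y \<le> h y) \<Longrightarrow> \<rho> g \<le> \<rho> h"
    and meas: "\<And>F :: real \<Rightarrow> 'y \<Rightarrow> ennreal.
      case_prod F \<in> borel_measurable (borel \<Otimes>\<^sub>M M) \<Longrightarrow> (\<lambda>s. \<rho> (F s)) \<in> borel_measurable borel"
    and minkowski: "\<And>F :: real \<Rightarrow> 'y \<Rightarrow> ennreal. case_prod F \<in> borel_measurable (borel \<Otimes>\<^sub>M M) \<Longrightarrow>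
      \<rho> (\<lambda>y. \<integral>\<^sup>+s. F s y \<partial>lborel) \<le> (\<integral>\<^sup>+s. \<rho> (F s) \<partial>lborel)"
    and cmult: "\<And>c g. g \<in> borel_measurable M \<Longrightarrow> c < top \<Longrightarrow> \<rho> (\<lambda>y. c * g y) \<le> c * \<rho> g"
    and add: "\<And>g h. g \<in> borel_measurable M \<Longrightarrow> h \<in> borel_measurable M \<Longrightarrow> \<rho> (\<lambda>y. g y + h y) \<le> \<rho> g + \<rho> h"
begin

lemma zero: "\<rho> (\<lambda>_. 0) = 0"
  using cmult[of "\<lambda>_. 0" 0] by simp

end

text \<open>The supremum is that of the lattice, formed at each \<open>y\<close> before any norm is
  taken. It can be much larger in norm than the supremum of the norms of the averages, so scalar
  estimates do not settle its boundedness.\<close>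

definition vmax :: "(nat \<Rightarrow> real \<Rightarrow> int) \<Rightarrow> nat \<Rightarrow> (real \<Rightarrow> 'y \<Rightarrow> ennreal) \<Rightarrow> real \<Rightarrow> 'y \<Rightarrow> ennreal" where
  "vmax \<iota> K F x y = (SUP k\<in>{..K}. avg \<iota> k (\<lambda>z. F z y) x)"

definition max_bounded ::
    "'y measure \<Rightarrow> (('y \<Rightarrow> ennreal) \<Rightarrow> ennreal) \<Rightarrow> (nat \<Rightarrow> real \<Rightarrow> int) \<Rightarrow> real \<Rightarrow> ennreal \<Rightarrow> bool" where
  "max_bounded M \<rho> \<iota> q C \<longleftrightarrow> (\<forall>K F. case_prod F \<in> borel_measurable (borel \<Otimes>\<^sub>M M) \<longrightarrow>
     (\<integral>\<^sup>+x. epowr (\<rho> (vmax \<iota> K F x)) q \<partial>lborel) \<le> C * (\<integral>\<^sup>+x. epowr (\<rho> (F x)) q \<partial>lborel))"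

section \<open>Changing the exponent of a lattice-valued dyadic maximal operator\<close>

locale normed_filtration = lattice_norm M \<rho> + dyadic_filtration \<iota>
  for M :: "'y measure" and \<rho> \<iota>
begin

lemma vmax_cong: "\<iota> K x = \<iota> K y \<Longrightarrow> vmax \<iota> K F x = vmax \<iota> K F y"
  unfolding vmax_def by (rule ext, rule SUP_cong[OF refl], rule avg_cong, rule nested[of _ K]) auto

lemma vmax_incseq: "incseq (\<lambda>K. vmax \<iota> K F x y)"
  unfolding vmax_def by (auto simp: incseq_def intro!: SUP_subset_mono)

lemma meas_SUP_avg:
  assumes F: "case_prod F \<in> borel_measurable (borel \<Otimes>\<^sub>M M)"
  shows "(\<lambda>(x, y). SUP k\<in>{a..b}. avg \<iota> k (\<lambda>z. F z y) x) \<in> borel_measurable (borel \<Otimes>\<^sub>M M)"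
  using meas_avg_param[OF F] unfolding case_prod_unfold by measurable

lemma meas_vmax:
  assumes F: "case_prod F \<in> borel_measurable (borel \<Otimes>\<^sub>M M)"
  shows "case_prod (vmax \<iota> K F) \<in> borel_measurable (borel \<Otimes>\<^sub>M M)"
  using meas_SUP_avg[OF F, of 0 K] by (simp add: vmax_def[abs_def] atMost_atLeast0)

lemma meas_section:
  "case_prod F \<in> borel_measurable (borel \<Otimes>\<^sub>M M) \<Longrightarrow> F x \<in> borel_measurable M"
  using measurable_compose[OF measurable_Pair1'[of x borel M]] by fastforce

lemma meas_section2:
  "case_prod F \<in> borel_measurable (borel \<Otimes>\<^sub>M M) \<Longrightarrow> y \<in> space M \<Longrightarrow> (\<lambda>z. F z y) \<in> borel_measurable borel"
  using measurable_compose[OF measurable_Pair2'[of y M borel]] by fastforce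

text \<open>An average is an integral against the kernel \<open>c\<close>, so this is Minkowski's
  inequality followed by homogeneity in the finite factor \<open>c z\<close>.\<close>

lemma norm_avg_le:
  assumes F: "case_prod F \<in> borel_measurable (borel \<Otimes>\<^sub>M M)"
  shows "\<rho> (\<lambda>y. avg \<iota> k (\<lambda>z. F z y) x) \<le> avg \<iota> k (\<lambda>z. \<rho> (F z)) x"
proof -
  define c where "c z = (indicator (cell \<iota> k x) z / emeasure lborel (cell \<iota> k x) :: ennreal)" for z
  have c: "c z < top" for z
    using vol_pos[of k x] by (auto simp: c_def indicator_def less_top[symmetric] ennreal_divide_eq_top_iff)
  have [measurable]: "c \<in> borel_measurable borel" unfolding c_def by measurable
  have [measurable]: "(\<lambda>s. \<rho> (F s)) \<in> borel_measurable borel" by (rule meas[OF F])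
  have avg_eq: "avg \<iota> k g x = (\<integral>\<^sup>+z. c z * g z \<partial>lborel)" if [measurable]: "g \<in> borel_measurable borel" for g
    unfolding avg_def c_def divide_ennreal_def
    by (subst nn_integral_multc[symmetric]) (auto simp: mult_ac)
  have F': "(\<lambda>q. F (fst q) (snd q)) \<in> borel_measurable (borel \<Otimes>\<^sub>M M)"
    using F by (simp add: case_prod_unfold)
  have "\<rho> (\<lambda>y. avg \<iota> k (\<lambda>z. F z y) x) \<le> \<rho> (\<lambda>y. \<integral>\<^sup>+z. c z * F z y \<partial>lborel)"
    by (rule mono) (subst avg_eq, auto intro: meas_section2[OF F])
  also have "\<dots> \<le> (\<integral>\<^sup>+z. \<rho> (\<lambda>y. c z * F z y) \<partial>lborel)"
    by (rule minkowski) (use F' in \<open>simp add: case_prod_unfold\<close>)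
  also have "\<dots> \<le> (\<integral>\<^sup>+z. c z * \<rho> (F z) \<partial>lborel)"
    by (intro nn_integral_mono cmult c meas_section[OF F])
  also have "\<dots> = avg \<iota> k (\<lambda>z. \<rho> (F z)) x" by (simp add: avg_eq)
  finally show ?thesis .
qed

text \<open>At a first passage of the norm above \<open>l\<close>, the generations before the stop
  contribute at most \<open>l\<close>. Where the full norm exceeds \<open>2 * l\<close>, the later
  generations must therefore contribute at least \<open>l\<close>. Inside the stopping cell they see
  only the restriction of \<open>F\<close> to it, and the bound at \<open>q\<close> controls their
  mean. The resulting majorant is a scalar maximal function, bounded at the exponent
  \<open>p / q > 1\<close>; hence the second Doob constant.\<close>

theorem max_bounded_up:
  assumes bd: "max_bounded M \<rho> \<iota> q C" and q: "1 \<le> q" "q < p"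
  shows "max_bounded M \<rho> \<iota> p (ennreal (doob_const p) * epowr C (p / q) * ennreal (doob_const (p / q)))"
  unfolding max_bounded_def
proof (intro allI impI)
  fix K and F :: "real \<Rightarrow> 'y \<Rightarrow> ennreal"
  assume F: "case_prod F \<in> borel_measurable (borel \<Otimes>\<^sub>M M)"
  define A where "A k x = \<rho> (vmax \<iota> k F x)" for k x
  define h where "h z = epowr (\<rho> (F z)) q" for z
  have [measurable]: "(\<lambda>z. \<rho> (F z)) \<in> borel_measurable borel" by (rule meas[OF F])
  have [measurable]: "h \<in> borel_measurable borel" unfolding h_def by measurable
  \<comment> \<open>Up to \<open>C\<close>, this is the maximal function of the averages of order
    \<open>q\<close>.\<close>
  define G where "G x = epowr (C * max_avg \<iota> K h x) (1 / q)" for x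
  have [measurable]: "G \<in> borel_measurable borel" unfolding G_def by measurable
  have adapted: "A k x = A k y" if "\<iota> k x = \<iota> k y" for k x y
    unfolding A_def using vmax_cong[OF that] by metis
  have inc: "incseq (\<lambda>k. A k x)" for x
    unfolding A_def using vmax_incseq[of F x] by (auto simp: incseq_def intro!: mono)
  have "(\<integral>\<^sup>+x. epowr (A K x) p \<partial>lborel) \<le> ennreal (doob_const p) * (\<integral>\<^sup>+x. epowr (G x) p \<partial>lborel)"
  proof (rule garsia[OF adapted inc])
    fix k x and l :: real
    assume l: "0 < l" and k: "k \<le> K" and before: "\<And>j. j < k \<Longrightarrow> A j x \<le> ennreal l"
    \<comment> \<open>The contribution of the generations from the stopping generation on.\<close>
    define W where "W z y = (SUP j\<in>{k..K}. avg \<iota> j (\<lambda>w. F w y) z)" for z y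
    have W: "case_prod W \<in> borel_measurable (borel \<Otimes>\<^sub>M M)"
      using meas_SUP_avg[OF F, of k K] by (simp add: W_def[abs_def])
    have [measurable]: "(\<lambda>z. \<rho> (W z)) \<in> borel_measurable borel" by (rule meas[OF W])
    define S where "S = cell \<iota> k x"
    have [measurable]: "S \<in> sets borel" by (simp add: S_def)
    have ptw: "ennreal l * (if ennreal (2 * l) < A K z then 1 else 0) \<le> \<rho> (W z)" if z: "z \<in> S" for z
    proof (cases "ennreal (2 * l) < A K z")
      case True
      have zx: "\<iota> k z = \<iota> k x" using z by (simp add: S_def mem_cell)
      have "A K z \<le> ennreal l + \<rho> (W z)"
      proof (cases k)
        \<comment> \<open>A stop at the coarsest generation has no predecessor; then
          \<open>W\<close> is the whole maximal function.\<close>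
        case 0
        then have "W = vmax \<iota> K F" by (intro ext) (simp add: W_def vmax_def atMost_atLeast0)
        then show ?thesis by (simp add: A_def add_increasing)
      next
        case (Suc k')
        have "vmax \<iota> K F z y \<le> vmax \<iota> k' F z y + W z y" for y
          unfolding vmax_def
        proof (rule SUP_least)
          fix j assume "j \<in> {..K}"
          then consider "j \<in> {..k'}" | "j \<in> {k..K}" using Suc by fastforce
          then show "avg \<iota> j (\<lambda>z. F z y) z \<le> (SUP k\<in>{..k'}. avg \<iota> k (\<lambda>z. F z y) z) + W z y"
          proof cases
            case 1
            then show ?thesis by (intro add_increasing2 SUP_upper) auto
          next
            case 2
            then show ?thesis unfolding W_def by (intro add_increasing SUP_upper) auto
          qed
        qed
        then have "A K z \<le> \<rho> (\<lambda>y. vmax \<iota> k' F z y + W z y)" unfolding A_def by (intro mono)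
        also have "\<dots> \<le> A k' z + \<rho> (W z)"
          unfolding A_def by (intro add meas_section[OF meas_vmax[OF F]] meas_section[OF W])
        also have "A k' z = A k' x" using nested_Suc[of k' z x] zx Suc by (intro adapted) simp
        also have "A k' x \<le> ennreal l" using Suc by (intro before) simp
        finally show ?thesis by (simp add: add_right_mono)
      qed
      then have "ennreal l + ennreal l \<le> ennreal l + \<rho> (W z)"
        using True l by (simp flip: ennreal_plus)
      then show ?thesis using True by (simp add: ennreal_add_left_cancel_le)
    qed auto
    \<comment> \<open>Cells of generation at least \<open>k\<close> that meet \<open>S\<close> lie
      in \<open>S\<close>, so this localisation changes none of the averages entering
      \<open>W\<close> on \<open>S\<close>. It makes the global bound at \<open>q\<close> act on one
      cell.\<close>
    define F' where "F' z y = indicator S z * F z y" for z y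
    have F': "case_prod F' \<in> borel_measurable (borel \<Otimes>\<^sub>M M)"
      using F unfolding F'_def case_prod_unfold by measurable
    have "(\<integral>\<^sup>+z. epowr (\<rho> (W z)) q * indicator S z \<partial>lborel) \<le> (\<integral>\<^sup>+z. epowr (\<rho> (vmax \<iota> K F' z)) q \<partial>lborel)"
    proof (intro nn_integral_mono)
      fix z
      have "W z y \<le> vmax \<iota> K F' z y" if z: "z \<in> S" for y
        unfolding W_def
      proof (rule SUP_least)
        fix j assume j: "j \<in> {k..K}"
        have "avg \<iota> j (\<lambda>w. F w y) z \<le> avg \<iota> j (\<lambda>w. F' w y) z"
        proof (rule avg_mono)
          fix w assume "w \<in> cell \<iota> j z"
          then have "\<iota> k w = \<iota> k z" using nested[of k j w z] j by (simp add: mem_cell)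
          then have "w \<in> S" using z by (simp add: S_def mem_cell)
          then show "F w y \<le> F' w y" by (simp add: F'_def)
        qed
        also have "\<dots> \<le> vmax \<iota> K F' z y" unfolding vmax_def using j by (intro SUP_upper) auto
        finally show "avg \<iota> j (\<lambda>w. F w y) z \<le> vmax \<iota> K F' z y" .
      qed
      then show "epowr (\<rho> (W z)) q * indicator S z \<le> epowr (\<rho> (vmax \<iota> K F' z)) q"
        using q by (auto simp: indicator_def intro!: epowr_mono mono)
    qed
    also have "\<dots> \<le> C * (\<integral>\<^sup>+z. epowr (\<rho> (F' z)) q \<partial>lborel)"
      using bd F' by (simp add: max_bounded_def)
    also have "(\<integral>\<^sup>+z. epowr (\<rho> (F' z)) q \<partial>lborel) = (\<integral>\<^sup>+z. h z * indicator S z \<partial>lborel)"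
      by (intro nn_integral_cong) (auto simp: F'_def[abs_def] h_def indicator_def zero)
    finally have loc: "(\<integral>\<^sup>+z. epowr (\<rho> (W z)) q * indicator S z \<partial>lborel)
        \<le> C * (\<integral>\<^sup>+z. h z * indicator S z \<partial>lborel)" .
    have "avg \<iota> k (\<lambda>z. epowr (\<rho> (W z)) q) x \<le> C * avg \<iota> k h x"
      using loc unfolding avg_def S_def[symmetric] ennreal_times_divide by (intro divide_right_mono_ennreal)
    then have "epowr (avg \<iota> k (\<lambda>z. \<rho> (W z)) x) q \<le> C * avg \<iota> k h x"
      using avg_jensen[OF q(1), of "\<lambda>z. \<rho> (W z)" k x] by simp
    then have "avg \<iota> k (\<lambda>z. \<rho> (W z)) x \<le> epowr (C * avg \<iota> k h x) (1 / q)"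
      using q by (simp add: epowr_le_iff)
    moreover have "epowr (C * avg \<iota> k h x) (1 / q) \<le> G z" if "z \<in> S" for z
    proof -
      have "avg \<iota> k h x = avg \<iota> k h z" using that by (intro avg_cong) (simp add: S_def mem_cell)
      also have "\<dots> \<le> max_avg \<iota> K h z" unfolding max_avg_def using k by (intro SUP_upper) auto
      finally show ?thesis unfolding G_def using q by (intro epowr_mono mult_left_mono) auto
    qed
    ultimately have "avg \<iota> k (\<lambda>z. \<rho> (W z)) x \<le> G z" if "z \<in> S" for z
      using that by (meson order_trans)
    then have "avg \<iota> k (\<lambda>_. avg \<iota> k (\<lambda>z. \<rho> (W z)) x) x \<le> avg \<iota> k G x"
      by (intro avg_mono) (simp add: S_def)
    moreover have "avg \<iota> k (\<lambda>y. ennreal l * (if ennreal (2 * l) < A K y then 1 else 0)) x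
        \<le> avg \<iota> k (\<lambda>z. \<rho> (W z)) x"
      by (intro avg_mono ptw) (simp add: S_def)
    ultimately show "avg \<iota> k (\<lambda>y. ennreal l * (if ennreal (2 * l) < A K y then 1 else 0)) x \<le> avg \<iota> k G x"
      by (simp add: avg_const)
  qed (use q in auto)
  also have "(\<integral>\<^sup>+x. epowr (G x) p \<partial>lborel) = epowr C (p / q) * (\<integral>\<^sup>+x. epowr (max_avg \<iota> K h x) (p / q) \<partial>lborel)"
    by (simp add: G_def epowr_epowr epowr_mult nn_integral_cmult)
  also have "(\<integral>\<^sup>+x. epowr (max_avg \<iota> K h x) (p / q) \<partial>lborel)
      \<le> ennreal (doob_const (p / q)) * (\<integral>\<^sup>+x. epowr (h x) (p / q) \<partial>lborel)"
    using q by (intro doob) auto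
  also have "(\<integral>\<^sup>+x. epowr (h x) (p / q) \<partial>lborel) = (\<integral>\<^sup>+x. epowr (\<rho> (F x)) p \<partial>lborel)"
    using q by (simp add: h_def epowr_epowr)
  finally show "(\<integral>\<^sup>+x. epowr (\<rho> (vmax \<iota> K F x)) p \<partial>lborel)
      \<le> ennreal (doob_const p) * epowr C (p / q) * ennreal (doob_const (p / q)) * (\<integral>\<^sup>+x. epowr (\<rho> (F x)) p \<partial>lborel)"
    by (simp add: A_def mult_left_mono mult.assoc)
qed

text \<open>
  This is the good part of a Calderon--Zygmund decomposition at height \<open>l\<close>: on every stopping cell,
  \<open>F\<close> is replaced by its average, except on top cells, where it is replaced by \<open>0\<close> because there
  is no parent cell to bound the average.  Off the stopping cells no average changes.
\<close>

lemma stopped_function: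
  assumes F: "case_prod F \<in> borel_measurable (borel \<Otimes>\<^sub>M M)" and l: "0 < l"
  shows "\<exists>g. case_prod g \<in> borel_measurable (borel \<Otimes>\<^sub>M M)
    \<and> (\<forall>z. \<rho> (g z) \<le> min (ennreal (2 * l)) (max_avg \<iota> K (\<lambda>z. \<rho> (F z)) z))
    \<and> (\<forall>z. max_avg \<iota> K (\<lambda>z. \<rho> (F z)) z \<le> ennreal l \<longrightarrow>
          (\<forall>y\<in>space M. vmax \<iota> K F z y \<le> vmax \<iota> K g z y))"
proof -
  define h where "h z = \<rho> (F z)" for z
  have [measurable]: "h \<in> borel_measurable borel" using meas[OF F] by (simp add: h_def[abs_def])
  \<comment> \<open>Allowing \<open>j = K\<close> makes the stopping time total. A cell that never
    stops is averaged at the last generation, which preserves the averages of all generations up to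
    \<open>K\<close>.\<close>
  define P where "P z j \<longleftrightarrow> j = K \<or> ennreal l < avg \<iota> j h z" for z j
  define \<tau> where "\<tau> z = (LEAST j. P z j)" for z
  have \<tau>_meas [measurable]: "\<tau> \<in> borel \<rightarrow>\<^sub>M count_space UNIV"
    unfolding \<tau>_def P_def by measurable
  have \<tau>_P: "P z (\<tau> z)" for z unfolding \<tau>_def by (rule LeastI[of _ K]) (simp add: P_def)
  have \<tau>_le: "\<tau> z \<le> K" for z unfolding \<tau>_def by (rule Least_le) (simp add: P_def)
  have \<tau>_less: "avg \<iota> j h z \<le> ennreal l" if "j < \<tau> z" for j z
    using not_less_Least[of j "P z"] that by (auto simp: \<tau>_def P_def)
  \<comment> \<open>The stopping time is constant on the cell at which it stops: the averages up to
    that generation are common to the cell.\<close>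
  have \<tau>_cong: "\<tau> w = \<tau> z" if "\<iota> (\<tau> z) w = \<iota> (\<tau> z) z" for w z
  proof -
    have "avg \<iota> i h w = avg \<iota> i h z" if "i \<le> \<tau> z" for i
      using \<open>\<iota> (\<tau> z) w = \<iota> (\<tau> z) z\<close> nested[OF that] by (intro avg_cong) blast
    then have eq: "P w i \<longleftrightarrow> P z i" if "i \<le> \<tau> z" for i using that by (simp add: P_def)
    show ?thesis unfolding \<tau>_def[of w]
    proof (rule Least_equality)
      show "P w (\<tau> z)" using eq[of "\<tau> z"] \<tau>_P by simp
      fix i assume "P w i"
      show "\<tau> z \<le> i"
      proof (rule ccontr)
        assume "\<not> \<tau> z \<le> i"
        then have "P z i" using eq[of i] \<open>P w i\<close> by simp
        then show False using not_less_Least[of i "P z"] \<open>\<not> \<tau> z \<le> i\<close> by (simp add: \<tau>_def)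
      qed
    qed
  qed
  define g where "g z y = (if ennreal l < avg \<iota> 0 h z then 0 else avg \<iota> (\<tau> z) (\<lambda>w. F w y) z)" for z y
  have "(\<lambda>q. avg \<iota> (\<tau> (fst q)) (\<lambda>w. F w (snd q)) (fst q)) \<in> borel_measurable (borel \<Otimes>\<^sub>M M)"
  proof (rule measurable_compose_countable)
    show "(\<lambda>q. avg \<iota> i (\<lambda>w. F w (snd q)) (fst q)) \<in> borel_measurable (borel \<Otimes>\<^sub>M M)" for i
      using meas_avg_param[OF F, of i] by (simp add: case_prod_unfold)
  qed (rule measurable_compose[OF measurable_fst \<tau>_meas])
  then have g_meas: "case_prod g \<in> borel_measurable (borel \<Otimes>\<^sub>M M)"
    unfolding g_def case_prod_unfold by measurable
  have g_norm: "\<rho> (g z) \<le> min (ennreal (2 * l)) (max_avg \<iota> K h z)" for z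
  proof (cases "ennreal l < avg \<iota> 0 h z")
    case True
    then show ?thesis by (simp add: g_def[abs_def] zero)
  next
    case False
    have "\<rho> (g z) \<le> avg \<iota> (\<tau> z) h z"
      using False norm_avg_le[OF F, of "\<tau> z" z] by (simp add: g_def[abs_def] h_def[abs_def])
    moreover have "avg \<iota> (\<tau> z) h z \<le> max_avg \<iota> K h z"
      unfolding max_avg_def using \<tau>_le by (intro SUP_upper) auto
    moreover have "avg \<iota> (\<tau> z) h z \<le> ennreal (2 * l)"
    proof (cases "\<tau> z")
      case 0
      have "ennreal l \<le> ennreal (2 * l)" using l by (intro ennreal_leI) auto
      then show ?thesis using False 0 by (auto simp: not_less intro: order_trans)
    next
      case (Suc j)
      \<comment> \<open>The generation before the stop has average at most \<open>l\<close>; one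
        step down costs the factor 2 in the threshold.\<close>
      have "avg \<iota> (Suc j) h z \<le> 2 * avg \<iota> j h z" by (rule avg_parent)
      also have "\<dots> \<le> 2 * ennreal l" using \<tau>_less[of j z] Suc by (intro mult_left_mono) auto
      also have "\<dots> = ennreal (2 * l)" using l by (simp add: ennreal_mult)
      finally show ?thesis using Suc by simp
    qed
    ultimately show ?thesis by (auto intro: order_trans)
  qed
  have g_max: "vmax \<iota> K F z y \<le> vmax \<iota> K g z y" if z: "max_avg \<iota> K h z \<le> ennreal l" and y: "y \<in> space M" for z y
    unfolding vmax_def
  proof (intro SUP_mono bexI)
    fix k assume k: "k \<in> {..K}"
    define S where "S = cell \<iota> k z"
    have Fy [measurable]: "(\<lambda>w. F w y) \<in> borel_measurable borel" by (rule meas_section2[OF F y])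
    have gy [measurable]: "(\<lambda>w. g w y) \<in> borel_measurable borel" by (rule meas_section2[OF g_meas y])
    have small: "avg \<iota> i h w \<le> ennreal l" if "w \<in> S" "i \<le> k" for w i
    proof -
      have "\<iota> i w = \<iota> i z" using nested[OF that(2), of w z] that(1) by (simp add: S_def mem_cell)
      then have "avg \<iota> i h w = avg \<iota> i h z" by (rule avg_cong)
      also have "\<dots> \<le> max_avg \<iota> K h z" unfolding max_avg_def using that k by (intro SUP_upper) auto
      finally show ?thesis using z by simp
    qed
    \<comment> \<open>All averages of generation at most \<open>k\<close> over \<open>S\<close> are
      small, so the stopping procedure cannot end above the generation of \<open>S\<close>.\<close>
    have kt: "k \<le> \<tau> w" if "w \<in> S" for w
      using \<tau>_P[of w] small[OF that, of "\<tau> w"] k by (auto simp: P_def not_less intro: ccontr)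
    \<comment> \<open>\<open>S\<close> is thus a disjoint union of complete stopping cells, grouped
      by generation. Averaging over them preserves the integral over \<open>S\<close>.\<close>
    define T where "T j = S \<inter> {w \<in> space borel. \<tau> w = j}" for j
    have [measurable]: "T j \<in> sets borel" for j unfolding T_def S_def by measurable
    have T_sat: "sat j (T j)" for j
      unfolding sat_def
    proof (intro allI impI)
      fix v w assume e: "\<iota> j v = \<iota> j w" and v: "v \<in> T j"
      have tv: "\<tau> v = j" and "v \<in> S" using v by (auto simp: T_def)
      then have "k \<le> j" using kt by auto
      from nested[OF this e] have "w \<in> S" using \<open>v \<in> S\<close> by (simp add: S_def mem_cell)
      moreover have "\<tau> w = j" using \<tau>_cong[of v w] e tv by simp
      ultimately show "w \<in> T j" by (simp add: T_def)
    qed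
    have ind: "indicator S w = (\<Sum>j\<le>K. indicator (T j) w :: ennreal)" for w
    proof (cases "w \<in> S")
      case True
      then have "(\<Sum>j\<le>K. indicator (T j) w :: ennreal) = (\<Sum>j\<le>K. if j = \<tau> w then 1 else 0)"
        by (intro sum.cong) (auto simp: T_def)
      then show ?thesis using True \<tau>_le[of w] by (simp add: sum.delta)
    qed (auto simp: T_def)
    have "(\<integral>\<^sup>+w. F w y * indicator S w \<partial>lborel) = (\<Sum>j\<le>K. \<integral>\<^sup>+w. F w y * indicator (T j) w \<partial>lborel)"
      unfolding ind sum_distrib_left by (subst nn_integral_sum) auto
    also have "\<dots> = (\<Sum>j\<le>K. \<integral>\<^sup>+w. g w y * indicator (T j) w \<partial>lborel)"
    proof (rule sum.cong[OF refl])
      fix j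
      have "(\<integral>\<^sup>+w. F w y * indicator (T j) w \<partial>lborel)
          = (\<integral>\<^sup>+w. avg \<iota> j (\<lambda>w. F w y) w * indicator (T j) w \<partial>lborel)"
        by (rule integral_avg[symmetric, OF T_sat]) auto
      \<comment> \<open>The coarsest average is at most \<open>l\<close> on \<open>S\<close>, so the
        value 0 prescribed on stopped top cells does not occur here.\<close>
      also have "\<dots> = (\<integral>\<^sup>+w. g w y * indicator (T j) w \<partial>lborel)"
        using small[of _ 0] by (intro nn_integral_cong) (auto simp: indicator_def T_def g_def not_less[symmetric])
      finally show "(\<integral>\<^sup>+w. F w y * indicator (T j) w \<partial>lborel) = (\<integral>\<^sup>+w. g w y * indicator (T j) w \<partial>lborel)" .
    qed
    also have "\<dots> = (\<integral>\<^sup>+w. g w y * indicator S w \<partial>lborel)"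
      unfolding ind sum_distrib_left by (subst nn_integral_sum) auto
    finally show "avg \<iota> k (\<lambda>w. F w y) z \<le> avg \<iota> k (\<lambda>w. g w y) z"
      by (simp add: avg_le_iff_integral S_def)
  qed
  show ?thesis
    using g_meas g_norm g_max unfolding h_def by blast
qed

end

text \<open>The value of the integral in \<open>min_powr_integral\<close> at \<open>x = 1\<close>:
  the levels below 1/2 give \<open>2 powr (q - p)\<close>, those above give
  \<open>p / (q - p)\<close> times as much.\<close>

definition marc_const :: "real \<Rightarrow> real \<Rightarrow> real" where
  "marc_const p q = 2 powr (q - p) * (1 + p / (q - p))"

text \<open>This is the integral of Marcinkiewicz interpolation. The minimum changes branch at half
  of \<open>x\<close>; below, the integrand is a multiple of \<open>l powr (p - 1)\<close>, above,
  of \<open>l powr (p - 1 - q)\<close>. Both are integrable there because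
  \<open>0 < p < q\<close>.\<close>

lemma min_powr_integral:
  assumes p: "0 < p" "p < q"
  shows "(\<integral>\<^sup>+l. (if 0 < l then ennreal (p * l powr (p - 1 - q)) * epowr (min (ennreal (2 * l)) x) q else 0) \<partial>lborel)
    \<le> ennreal (marc_const p q) * epowr x p" (is "?L \<le> _")
proof (cases "x = top \<or> x = 0")
  case True
  have "0 < marc_const p q" using p by (auto simp: marc_const_def intro!: mult_pos_pos add_pos_pos)
  then show ?thesis using True by (auto simp: ennreal_mult_top min_def cong: if_cong)
next
  case False
  then obtain r where r: "x = ennreal r" "0 < r" by (cases x) (auto simp: less_le)
  define f1 where "f1 l = (if l \<in> {0..r / 2} then 2 powr q * p * l powr (p - 1) else 0)" for l
  define f2 where "f2 l = (if l \<in> {r / 2..} then r powr q * p * l powr (p - 1 - q) else 0)" for l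
  have [measurable]: "f1 \<in> borel_measurable borel" "f2 \<in> borel_measurable borel"
    unfolding f1_def f2_def by measurable
  have "((\<lambda>l. 2 powr q * p * l powr (p - 1)) has_integral 2 powr q * p * ((r / 2) powr (p - 1 + 1) / (p - 1 + 1))) {0..r / 2}"
    using p r by (intro has_integral_mult_right has_integral_powr_from_0) auto
  then have "((\<lambda>l. 2 powr q * p * l powr (p - 1)) has_integral 2 powr q * (r / 2) powr p) {0..r / 2}"
    using p by simp
  then have h1: "(f1 has_integral 2 powr q * (r / 2) powr p) UNIV"
    by (simp only: f1_def[abs_def] has_integral_restrict_UNIV)
  then have i1: "(\<integral>\<^sup>+l. ennreal (f1 l) \<partial>lborel) = ennreal (2 powr q * (r / 2) powr p)"
    using p by (intro nn_integral_has_integral_lborel[OF _ _ h1]) (auto simp: f1_def)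
  have "((\<lambda>l. r powr q * p * l powr (p - 1 - q)) has_integral r powr q * p * (- ((r / 2) powr (p - 1 - q + 1)) / (p - 1 - q + 1))) {r / 2..}"
    using p r by (intro has_integral_mult_right has_integral_powr_to_inf) auto
  moreover have "- ((r / 2) powr (p - 1 - q + 1)) / (p - 1 - q + 1) = (r / 2) powr (p - q) / (q - p)"
  proof -
    have "p - 1 - q + 1 = - (q - p)" "p - q = - (q - p)" by auto
    then show ?thesis by (simp only: minus_divide_divide)
  qed
  ultimately have h2: "(f2 has_integral r powr q * p * ((r / 2) powr (p - q) / (q - p))) UNIV"
    by (simp only: f2_def[abs_def] has_integral_restrict_UNIV)
  then have i2: "(\<integral>\<^sup>+l. ennreal (f2 l) \<partial>lborel) = ennreal (r powr q * p * ((r / 2) powr (p - q) / (q - p)))"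
    using p by (intro nn_integral_has_integral_lborel[OF _ _ h2]) (auto simp: f2_def)
  have "?L \<le> (\<integral>\<^sup>+l. ennreal (f1 l) + ennreal (f2 l) \<partial>lborel)"
  proof (intro nn_integral_mono)
    fix l :: real
    show "(if 0 < l then ennreal (p * l powr (p - 1 - q)) * epowr (min (ennreal (2 * l)) x) q else 0)
      \<le> ennreal (f1 l) + ennreal (f2 l)"
    proof (cases "0 < l")
      case True
      have eq: "ennreal (p * l powr (p - 1 - q)) * epowr (min (ennreal (2 * l)) x) q
          = ennreal (p * l powr (p - 1 - q) * (min (2 * l) r) powr q)"
      proof -
        have "min (ennreal (2 * l)) x = ennreal (min (2 * l) r)"
          using r True by (subst min_ennreal[symmetric]) auto
        moreover have "0 \<le> min (2 * l) r" using r True by auto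
        ultimately show ?thesis by (simp only: epowr_ennreal ennreal_mult'' powr_ge_zero)
      qed
      show ?thesis
      proof (cases "l \<le> r / 2")
        case le: True
        have "l powr (p - 1 - q) * (2 * l) powr q = 2 powr q * l powr (p - 1)"
          using True by (simp add: powr_mult powr_diff)
        then have "p * l powr (p - 1 - q) * (min (2 * l) r) powr q = f1 l"
          using le True by (simp add: f1_def min_def mult_ac)
        then show ?thesis using True unfolding eq by (simp add: add_increasing2)
      next
        case ge: False
        then have "p * l powr (p - 1 - q) * (min (2 * l) r) powr q = f2 l"
          by (simp add: f2_def min_def mult_ac)
        then show ?thesis using True unfolding eq by (simp add: add_increasing)
      qed
    qed simp
  qed
  also have "\<dots> = ennreal (2 powr q * (r / 2) powr p) + ennreal (r powr q * p * ((r / 2) powr (p - q) / (q - p)))"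
    by (simp add: nn_integral_add i1 i2)
  also have "\<dots> = ennreal (2 powr q * (r / 2) powr p + r powr q * p * ((r / 2) powr (p - q) / (q - p)))"
    using p by (intro ennreal_plus[symmetric]) auto
  also have "2 powr q * (r / 2) powr p + r powr q * p * ((r / 2) powr (p - q) / (q - p)) = marc_const p q * r powr p"
    using p r by (simp add: marc_const_def powr_divide powr_diff field_simps)
  finally show ?thesis using r p by (simp add: epowr_ennreal ennreal_mult marc_const_def)
qed

context normed_filtration
begin

text \<open>Where \<open>N\<close>, the scalar maximal function of the norms, is at most
  \<open>l\<close>, the good part alone accounts for the maximal function. The level set of
  \<open>N\<close> thus absorbs all stopping cells, and Chebyshev with the bound at \<open>q\<close>
  treats the good part. Integration over \<open>l\<close> gives the norm of \<open>N\<close> in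
  \<open>L^p\<close>, which Doob's inequality bounds.\<close>

theorem max_bounded_down:
  assumes bd: "max_bounded M \<rho> \<iota> q C" and p: "1 < p" "p < q"
  shows "max_bounded M \<rho> \<iota> p ((1 + C * ennreal (marc_const p q)) * ennreal (doob_const p))"
  unfolding max_bounded_def
proof (intro allI impI)
  fix K and F :: "real \<Rightarrow> 'y \<Rightarrow> ennreal"
  assume F: "case_prod F \<in> borel_measurable (borel \<Otimes>\<^sub>M M)"
  define N where "N = max_avg \<iota> K (\<lambda>z. \<rho> (F z))"
  have [measurable]: "(\<lambda>z. \<rho> (F z)) \<in> borel_measurable borel" by (rule meas[OF F])
  have [measurable]: "N \<in> borel_measurable borel" by (simp add: N_def)
  define A where "A x = \<rho> (vmax \<iota> K F x)" for x
  have [measurable]: "A \<in> borel_measurable borel"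
    using meas[OF meas_vmax[OF F]] by (simp add: A_def[abs_def])
  have key: "emeasure lborel {x. ennreal l < A x} \<le> emeasure lborel {x. ennreal l < N x}
      + C * ennreal (l powr (- q)) * (\<integral>\<^sup>+z. epowr (min (ennreal (2 * l)) (N z)) q \<partial>lborel)" if l: "0 < l" for l
  proof -
    obtain g where g: "case_prod g \<in> borel_measurable (borel \<Otimes>\<^sub>M M)"
      and gN: "\<And>z. \<rho> (g z) \<le> min (ennreal (2 * l)) (N z)"
      and gmax: "\<And>z y. N z \<le> ennreal l \<Longrightarrow> y \<in> space M \<Longrightarrow> vmax \<iota> K F z y \<le> vmax \<iota> K g z y"
      using stopped_function[OF F l, of K] unfolding N_def by blast
    define B where "B x = \<rho> (vmax \<iota> K g x)" for x
    have [measurable]: "B \<in> borel_measurable borel"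
      using meas[OF meas_vmax[OF g]] by (simp add: B_def[abs_def])
    have "{x. ennreal l < A x} \<subseteq> {x. ennreal l < N x} \<union> {x. ennreal l < B x}"
    proof
      fix x assume x: "x \<in> {x. ennreal l < A x}"
      show "x \<in> {x. ennreal l < N x} \<union> {x. ennreal l < B x}"
      proof (cases "ennreal l < N x")
        case False
        then have "A x \<le> B x" unfolding A_def B_def by (intro mono gmax) auto
        with x show ?thesis by (auto intro: less_le_trans)
      qed auto
    qed
    then have "emeasure lborel {x. ennreal l < A x}
        \<le> emeasure lborel ({x. ennreal l < N x} \<union> {x. ennreal l < B x})"
      by (intro emeasure_mono) auto
    also have "\<dots> \<le> emeasure lborel {x. ennreal l < N x} + emeasure lborel {x. ennreal l < B x}"
      by (intro emeasure_subadditive) auto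
    also have "emeasure lborel {x. ennreal l < B x}
        \<le> C * ennreal (l powr (- q)) * (\<integral>\<^sup>+z. epowr (min (ennreal (2 * l)) (N z)) q \<partial>lborel)"
    proof -
    have "emeasure lborel {x. ennreal l < B x} = (\<integral>\<^sup>+x. indicator {x. ennreal l < B x} x \<partial>lborel)"
      by simp
    also have "\<dots> \<le> (\<integral>\<^sup>+x. ennreal (l powr (- q)) * epowr (B x) q \<partial>lborel)"
    proof (intro nn_integral_mono)
      fix x
      show "indicator {x. ennreal l < B x} x \<le> ennreal (l powr (- q)) * epowr (B x) q"
      proof (cases "ennreal l < B x")
        case True
        have "1 = ennreal (l powr (- q)) * epowr (ennreal l) q"
          using l by (simp add: epowr_ennreal ennreal_mult[symmetric] powr_add[symmetric])
        also have "\<dots> \<le> ennreal (l powr (- q)) * epowr (B x) q"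
          using True p by (intro mult_left_mono epowr_mono) auto
        finally show ?thesis using True by simp
      qed simp
    qed
    also have "\<dots> = ennreal (l powr (- q)) * (\<integral>\<^sup>+x. epowr (B x) q \<partial>lborel)"
      by (simp add: nn_integral_cmult)
    also have "\<dots> \<le> ennreal (l powr (- q)) * (C * (\<integral>\<^sup>+z. epowr (min (ennreal (2 * l)) (N z)) q \<partial>lborel))"
    proof (rule mult_left_mono)
    have "(\<integral>\<^sup>+x. epowr (B x) q \<partial>lborel) \<le> C * (\<integral>\<^sup>+x. epowr (\<rho> (g x)) q \<partial>lborel)"
      using bd g by (simp add: max_bounded_def B_def)
    also have "\<dots> \<le> C * (\<integral>\<^sup>+z. epowr (min (ennreal (2 * l)) (N z)) q \<partial>lborel)"
      using p gN by (intro mult_left_mono nn_integral_mono epowr_mono) auto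
    finally show "(\<integral>\<^sup>+x. epowr (B x) q \<partial>lborel)
        \<le> C * (\<integral>\<^sup>+z. epowr (min (ennreal (2 * l)) (N z)) q \<partial>lborel)" .
    qed simp
    finally show ?thesis by (simp add: mult_ac)
    qed
    finally show ?thesis by (simp add: add_left_mono)
  qed
  have sf: "sigma_finite_measure (lborel :: real measure)" ..
  have "(\<integral>\<^sup>+x. epowr (A x) p \<partial>lborel)
      = (\<integral>\<^sup>+l. (if 0 < l then ennreal (p * l powr (p - 1)) * emeasure lborel {x. ennreal l < A x} else 0) \<partial>lborel)"
    using p layer_cake_emeasure[OF sf, of p A] by (simp cong: if_cong)
  also have "\<dots> \<le> (\<integral>\<^sup>+l. (if 0 < l then ennreal (p * l powr (p - 1)) * emeasure lborel {x. ennreal l < N x} else 0)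
      + C * (\<integral>\<^sup>+z. (if 0 < l then ennreal (p * l powr (p - 1 - q)) * epowr (min (ennreal (2 * l)) (N z)) q else 0) \<partial>lborel) \<partial>lborel)"
  proof (intro nn_integral_mono)
    fix l :: real
    show "(if 0 < l then ennreal (p * l powr (p - 1)) * emeasure lborel {x. ennreal l < A x} else 0)
      \<le> (if 0 < l then ennreal (p * l powr (p - 1)) * emeasure lborel {x. ennreal l < N x} else 0)
      + C * (\<integral>\<^sup>+z. (if 0 < l then ennreal (p * l powr (p - 1 - q)) * epowr (min (ennreal (2 * l)) (N z)) q else 0) \<partial>lborel)"
    proof (cases "0 < l")
      case True
      have "ennreal (p * l powr (p - 1)) * ennreal (l powr (- q)) = ennreal (p * l powr (p - 1 - q))"
        using True p by (simp add: powr_diff powr_minus ennreal_mult[symmetric] divide_inverse mult_ac)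
      from this[symmetric] have "ennreal (p * l powr (p - 1)) * (emeasure lborel {x. ennreal l < N x}
          + C * ennreal (l powr (- q)) * (\<integral>\<^sup>+z. epowr (min (ennreal (2 * l)) (N z)) q \<partial>lborel))
        = ennreal (p * l powr (p - 1)) * emeasure lborel {x. ennreal l < N x}
          + C * (ennreal (p * l powr (p - 1 - q)) * (\<integral>\<^sup>+z. epowr (min (ennreal (2 * l)) (N z)) q \<partial>lborel))"
        by (simp only: distrib_left mult_ac)
      then show ?thesis
        using mult_left_mono[OF key[OF True], of "ennreal (p * l powr (p - 1))"] True
        by (simp add: nn_integral_cmult)
    qed simp
  qed
  also have "\<dots> = (\<integral>\<^sup>+l. (if 0 < l then ennreal (p * l powr (p - 1)) * emeasure lborel {x. ennreal l < N x} else 0) \<partial>lborel)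
      + C * (\<integral>\<^sup>+l. (\<integral>\<^sup>+z. (if 0 < l then ennreal (p * l powr (p - 1 - q)) * epowr (min (ennreal (2 * l)) (N z)) q else 0) \<partial>lborel) \<partial>lborel)"
    by (subst nn_integral_add) (auto simp: nn_integral_cmult)
  also have "(\<integral>\<^sup>+l. (if 0 < l then ennreal (p * l powr (p - 1)) * emeasure lborel {x. ennreal l < N x} else 0) \<partial>lborel)
      = (\<integral>\<^sup>+x. epowr (N x) p \<partial>lborel)"
    using p layer_cake_emeasure[OF sf, of p N] by (simp cong: if_cong)
  also have "(\<integral>\<^sup>+l. (\<integral>\<^sup>+z. (if 0 < l then ennreal (p * l powr (p - 1 - q)) * epowr (min (ennreal (2 * l)) (N z)) q else 0) \<partial>lborel) \<partial>lborel)
    = (\<integral>\<^sup>+z. (\<integral>\<^sup>+l. (if 0 < l then ennreal (p * l powr (p - 1 - q)) * epowr (min (ennreal (2 * l)) (N z)) q else 0) \<partial>lborel) \<partial>lborel)"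
    by (intro lborel_pair.Fubini') measurable
  also have "C * \<dots> \<le> C * (\<integral>\<^sup>+z. ennreal (marc_const p q) * epowr (N z) p \<partial>lborel)"
    using p by (intro mult_left_mono nn_integral_mono min_powr_integral) auto
  also have "\<dots> = C * (ennreal (marc_const p q) * (\<integral>\<^sup>+z. epowr (N z) p \<partial>lborel))"
    by (simp add: nn_integral_cmult)
  finally have "(\<integral>\<^sup>+x. epowr (A x) p \<partial>lborel)
      \<le> (1 + C * ennreal (marc_const p q)) * (\<integral>\<^sup>+z. epowr (N z) p \<partial>lborel)"
    by (simp add: add_left_mono distrib_right mult.assoc)
  also have "\<dots> \<le> (1 + C * ennreal (marc_const p q))
      * (ennreal (doob_const p) * (\<integral>\<^sup>+x. epowr (\<rho> (F x)) p \<partial>lborel))"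
    unfolding N_def by (rule mult_left_mono[OF doob[OF p(1)]]) auto
  finally show "(\<integral>\<^sup>+x. epowr (\<rho> (vmax \<iota> K F x)) p \<partial>lborel)
      \<le> (1 + C * ennreal (marc_const p q)) * ennreal (doob_const p) * (\<integral>\<^sup>+x. epowr (\<rho> (F x)) p \<partial>lborel)"
    by (simp add: A_def mult.assoc)
qed

end

section \<open>Mixed norms of sequences of functions\<close>

lemma upd_coord_nth: "upd_coord x i s $ l = (if l = i then s else x $ l)"
  by (simp add: upd_coord_def)

lemma upd_coord_same [simp]: "upd_coord x i s $ i = s"
  by (simp add: upd_coord_nth)

lemma upd_coord_upd [simp]: "upd_coord (upd_coord x i s) i t = upd_coord x i t"
  by (simp add: upd_coord_def vec_eq_iff)

lemma upd_coord_swap: "i \<noteq> l \<Longrightarrow> upd_coord (upd_coord x i s) l t = upd_coord (upd_coord x l t) i s"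
  by (simp add: upd_coord_def vec_eq_iff)

lemma upd_coord_triv [simp]: "upd_coord x i (x $ i) = x"
  by (simp add: upd_coord_def vec_eq_iff)

lemma upd_coord_eq: "upd_coord x i s = x + (s - x $ i) *\<^sub>R axis i 1"
  by (simp add: upd_coord_def vec_eq_iff axis_def)

lemma measurable_upd_coord [measurable]:
  assumes [measurable]: "f \<in> N \<rightarrow>\<^sub>M borel" "g \<in> borel_measurable N"
  shows "(\<lambda>w. upd_coord (f w) i (g w)) \<in> N \<rightarrow>\<^sub>M borel"
  unfolding upd_coord_eq cart_eq_inner_axis by measurable

lemma coord_norm_lp: "coord_norm q i F x = lp (q $ i) lborel (\<lambda>s. F (upd_coord x i s))"
  by (simp add: coord_norm_def lp_def nn_integral_completion)

lemma lq_norm_cases: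
  fixes u :: ennreal
  assumes "1 < u"
  obtains "u = \<infinity>" | r where "1 < r" "u = ennreal r"
  using assms by (cases u) (auto simp: one_less_ennreal)

text \<open>\<open>L\<close> lists the coordinates already integrated, innermost first; the others
  remain parameters in the argument. Appending on the right adds the next outer norm, so proofs go
  by \<open>rev_induct\<close>.\<close>

definition seq_norm :: "real ^ 'n \<Rightarrow> ennreal \<Rightarrow> 'n list \<Rightarrow> (nat \<Rightarrow> real ^ 'n \<Rightarrow> ennreal) \<Rightarrow> real ^ 'n \<Rightarrow> ennreal" where
  "seq_norm q u L F = fold (coord_norm q) L (\<lambda>x. lq_norm u (\<lambda>j. F j x))"

lemma seq_norm_Nil: "seq_norm q u [] F x = lq_norm u (\<lambda>j. F j x)"
  by (simp add: seq_norm_def)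

lemma seq_norm_snoc:
  "seq_norm q u (L @ [l]) F x = lp (q $ l) lborel (\<lambda>s. seq_norm q u L F (upd_coord x l s))"
  by (simp add: seq_norm_def coord_norm_lp)

lemma measurable_lq_norm:
  fixes G :: "'s \<Rightarrow> 'i::countable \<Rightarrow> ennreal"
  assumes [measurable]: "\<And>j. (\<lambda>s. G s j) \<in> borel_measurable S"
  shows "(\<lambda>s. lq_norm u (G s)) \<in> borel_measurable S"
proof (cases "u = \<infinity>")
  case True
  then show ?thesis by (simp add: lq_norm_def)
next
  case False
  have [measurable]: "(\<lambda>q. G (fst q) (snd q)) \<in> borel_measurable (S \<Otimes>\<^sub>M count_space UNIV)"
    using assms by (intro measurable_compose_countable'[where g = snd and I = UNIV and f = "\<lambda>i q. G (fst q) i"]) auto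
  interpret sigma_finite_measure "count_space (UNIV :: 'i set)"
    by (rule sigma_finite_measure_count_space)
  show ?thesis
    using False unfolding lq_norm_def infsum_ennreal_eq_nn_integral by simp measurable
qed

lemma minkowski_lq_norm:
  fixes G :: "'s \<Rightarrow> 'i::countable \<Rightarrow> ennreal"
  assumes S: "sigma_finite_measure S" and u: "1 \<le> u" and [measurable]: "\<And>j. (\<lambda>s. G s j) \<in> borel_measurable S"
  shows "lq_norm u (\<lambda>j. \<integral>\<^sup>+s. G s j \<partial>S) \<le> (\<integral>\<^sup>+s. lq_norm u (G s) \<partial>S)"
proof (cases u)
  case (real r)
  have r: "1 \<le> r" using u real by simp
  have G: "(\<lambda>q. G (fst q) (snd q)) \<in> borel_measurable (S \<Otimes>\<^sub>M count_space UNIV)"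
    using assms by (intro measurable_compose_countable'[where g = snd and I = UNIV and f = "\<lambda>i q. G (fst q) i"]) auto
  show ?thesis
    using minkowski_lp[OF S sigma_finite_measure_count_space r, of G] G real
    by (simp add: lq_norm_ennreal case_prod_unfold)
next
  case top
  show ?thesis
    unfolding lq_norm_def top by (auto intro!: SUP_least nn_integral_mono SUP_upper)
qed

lemma lq_norm_mono: "0 < u \<Longrightarrow> (\<And>j. a j \<le> b j) \<Longrightarrow> lq_norm u a \<le> lq_norm u (b :: 'i::countable \<Rightarrow> ennreal)"
  by (auto simp: lq_norm_def infsum_ennreal_eq_nn_integral intro!: SUP_mono' epowr_mono nn_integral_mono)

lemma lq_norm_cmult:
  "0 < u \<Longrightarrow> lq_norm u (\<lambda>j. c * a j) = c * lq_norm u (a :: 'i::countable \<Rightarrow> ennreal)"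
  by (cases u) (auto simp: lq_norm_ennreal lp_cmult lq_norm_def[of top] SUP_mult_left_ennreal)

lemma lq_norm_SUP:
  fixes a :: "nat \<Rightarrow> 'i::countable \<Rightarrow> ennreal"
  assumes "0 < u" "\<And>j. incseq (\<lambda>n. a n j)"
  shows "lq_norm u (\<lambda>j. SUP n. a n j) = (SUP n. lq_norm u (a n))"
proof (cases u)
  case (real r)
  then show ?thesis using assms by (auto simp: lq_norm_ennreal incseq_def le_fun_def intro!: lp_SUP)
next
  case top
  then show ?thesis by (auto simp: lq_norm_def intro: SUP_commute)
qed

definition seq_space :: "(nat \<times> (real ^ 'n)) measure" where
  "seq_space = count_space UNIV \<Otimes>\<^sub>M borel"

text \<open>
  In \<open>slice_norm q u L x\<close> the variables outside \<open>L\<close> are frozen at \<open>x\<close>; with one of them as the real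
  parameter, this is the lattice \<open>E\<close> in which the one-dimensional maximal operators take values.
\<close>

definition slice_norm ::
    "real ^ 'n \<Rightarrow> ennreal \<Rightarrow> 'n list \<Rightarrow> real ^ 'n \<Rightarrow> (nat \<times> (real ^ 'n) \<Rightarrow> ennreal) \<Rightarrow> ennreal" where
  "slice_norm q u L x g = seq_norm q u L (\<lambda>j z. g (j, z)) x"

lemma space_seq_space [simp]: "space seq_space = UNIV"
  by (simp add: seq_space_def space_pair_measure)

lemma slice_measurable:
  assumes "case_prod F \<in> borel_measurable (borel \<Otimes>\<^sub>M seq_space)"
  shows "(\<lambda>w. F (fst w) (j, snd w)) \<in> borel_measurable (borel \<Otimes>\<^sub>M borel)"
proof -
  have "(\<lambda>w. (fst w, (j, snd w))) \<in> borel \<Otimes>\<^sub>M borel \<rightarrow>\<^sub>M borel \<Otimes>\<^sub>M seq_space"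
    unfolding seq_space_def by measurable
  from measurable_compose[OF this assms] show ?thesis by simp
qed

lemma slice_measurable_section:
  assumes "g \<in> borel_measurable seq_space" shows "(\<lambda>z. g (j, z)) \<in> borel_measurable borel"
  using measurable_compose[OF measurable_Pair1'[of j "count_space UNIV" borel] assms[unfolded seq_space_def]]
  by simp

context
  fixes q :: "real ^ 'n::finite" and u :: ennreal
  assumes q: "\<And>i. 1 < q $ i" and u: "1 < u"
begin

lemma exponents_ge_1: "0 < q $ i" "1 \<le> q $ i" and seq_exponent_ge_1: "0 < u" "1 \<le> u"
  using q[of i] u by (auto intro: order.strict_trans[of 0 1])

lemma seq_norm_mono: "(\<And>j z. F j z \<le> G j z) \<Longrightarrow> seq_norm q u L F x \<le> seq_norm q u L G x"
proof (induction L arbitrary: x rule: rev_induct)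
  case Nil
  then show ?case by (simp add: seq_norm_Nil lq_norm_mono seq_exponent_ge_1)
next
  case (snoc l L)
  then show ?case by (simp add: seq_norm_snoc lp_mono exponents_ge_1)
qed

text \<open>Measurability has to be joint in the parameter and the point, because each further norm
  integrates over a coordinate of the point.\<close>

lemma measurable_seq_norm_param:
  assumes G: "\<And>j. (\<lambda>w. G (fst w) j (snd w)) \<in> borel_measurable (S \<Otimes>\<^sub>M borel)"
  shows "(\<lambda>w. seq_norm q u L (G (fst w)) (snd w)) \<in> borel_measurable (S \<Otimes>\<^sub>M borel)"
proof (induction L rule: rev_induct)
  case Nil
  then show ?case by (simp add: seq_norm_Nil measurable_lq_norm G)
next
  case (snoc l L)
  have "(\<lambda>w. (fst (fst w), upd_coord (snd (fst w)) l (snd w))) \<in> (S \<Otimes>\<^sub>M borel) \<Otimes>\<^sub>M lborel \<rightarrow>\<^sub>M S \<Otimes>\<^sub>M borel"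
    by measurable
  from measurable_compose[OF this snoc]
  show ?case unfolding seq_norm_snoc lp_def by (measurable, simp)
qed

lemma measurable_seq_norm [measurable]:
  assumes "\<And>j. F j \<in> borel_measurable borel"
  shows "seq_norm q u L F \<in> borel_measurable borel"
proof -
  have "(\<lambda>w. seq_norm q u L F (snd w)) \<in> borel_measurable (count_space {()} \<Otimes>\<^sub>M borel)"
    using assms by (intro measurable_seq_norm_param[of "\<lambda>_. F"]) simp
  from measurable_compose[OF measurable_Pair1'[of "()"] this] show ?thesis by simp
qed

lemma minkowski_seq_norm:
  assumes S: "sigma_finite_measure S"
    and G: "\<And>j. (\<lambda>w. G (fst w) j (snd w)) \<in> borel_measurable (S \<Otimes>\<^sub>M borel)"
  shows "seq_norm q u L (\<lambda>j z. \<integral>\<^sup>+s. G s j z \<partial>S) x \<le> (\<integral>\<^sup>+s. seq_norm q u L (G s) x \<partial>S)"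
proof (induction L arbitrary: x rule: rev_induct)
  case Nil
  have "(\<lambda>s. G s j x) \<in> borel_measurable S" for j
    using measurable_compose[OF measurable_Pair2' G[of j], of x] by simp
  then show ?case by (simp add: seq_norm_Nil minkowski_lq_norm[OF S seq_exponent_ge_1(2)])
next
  case (snoc l L)
  have "(\<lambda>w. (fst w, upd_coord x l (snd w))) \<in> S \<Otimes>\<^sub>M lborel \<rightarrow>\<^sub>M S \<Otimes>\<^sub>M borel" by measurable
  from measurable_compose[OF this measurable_seq_norm_param[OF G]]
  have "(\<lambda>w. seq_norm q u L (G (fst w)) (upd_coord x l (snd w))) \<in> borel_measurable (S \<Otimes>\<^sub>M lborel)"
    by simp
  then have "lp (q $ l) lborel (\<lambda>v. \<integral>\<^sup>+s. seq_norm q u L (G s) (upd_coord x l v) \<partial>S)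
      \<le> (\<integral>\<^sup>+s. lp (q $ l) lborel (\<lambda>v. seq_norm q u L (G s) (upd_coord x l v)) \<partial>S)"
    by (intro minkowski_lp[OF S _ exponents_ge_1(2)] sigma_finite_lborel) (simp add: case_prod_unfold)
  moreover have "lp (q $ l) lborel (\<lambda>v. seq_norm q u L (\<lambda>j z. \<integral>\<^sup>+s. G s j z \<partial>S) (upd_coord x l v))
      \<le> lp (q $ l) lborel (\<lambda>v. \<integral>\<^sup>+s. seq_norm q u L (G s) (upd_coord x l v) \<partial>S)"
    by (intro lp_mono exponents_ge_1 snoc)
  ultimately show ?case by (simp add: seq_norm_snoc)
qed

lemma seq_norm_cmult:
  assumes [measurable]: "\<And>j. F j \<in> borel_measurable borel"
  shows "seq_norm q u L (\<lambda>j z. c * F j z) x = c * seq_norm q u L F x"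
proof (induction L arbitrary: x rule: rev_induct)
  case Nil
  then show ?case by (simp add: seq_norm_Nil lq_norm_cmult seq_exponent_ge_1)
next
  case (snoc l L)
  then show ?case by (simp add: seq_norm_snoc lp_cmult exponents_ge_1)
qed

lemma seq_norm_SUP:
  assumes F [measurable]: "\<And>n j. F n j \<in> borel_measurable borel" and inc: "\<And>j z. incseq (\<lambda>n. F n j z)"
  shows "seq_norm q u L (\<lambda>j z. SUP n. F n j z) x = (SUP n. seq_norm q u L (F n) x)"
proof (induction L arbitrary: x rule: rev_induct)
  case Nil
  then show ?case using inc by (simp add: seq_norm_Nil lq_norm_SUP seq_exponent_ge_1)
next
  case (snoc l L)
  have "incseq (\<lambda>n s. seq_norm q u L (F n) (upd_coord x l s))"
    using inc by (auto simp: incseq_def le_fun_def intro!: seq_norm_mono)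
  then show ?case using snoc by (simp add: seq_norm_snoc lp_SUP exponents_ge_1)
qed

text \<open>A coordinate outside \<open>L\<close> is never integrated, so freezing it before or
  after taking the norms is the same.\<close>

lemma seq_norm_subst:
  "i \<notin> set L \<Longrightarrow> seq_norm q u L (\<lambda>j z. F j (upd_coord z i s)) x = seq_norm q u L F (upd_coord x i s)"
proof (induction L arbitrary: x rule: rev_induct)
  case Nil
  then show ?case by (simp add: seq_norm_Nil)
next
  case (snoc l L)
  then show ?case by (simp add: seq_norm_snoc upd_coord_swap[of i l])
qed

text \<open>A sum of two functions is an integral over the two-point space \<open>bool\<close>,
  which makes the triangle inequality a case of Minkowski's.\<close>

lemma seq_norm_add:
  assumes [measurable]: "\<And>j. F j \<in> borel_measurable borel" "\<And>j. G j \<in> borel_measurable borel"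
  shows "seq_norm q u L (\<lambda>j z. F j z + G j z) x \<le> seq_norm q u L F x + seq_norm q u L G x"
proof -
  define H where "H b = (if b then F else G)" for b
  have "seq_norm q u L (\<lambda>j z. \<integral>\<^sup>+b. H b j z \<partial>count_space UNIV) x
      \<le> (\<integral>\<^sup>+b. seq_norm q u L (H b) x \<partial>count_space UNIV)"
  proof (intro minkowski_seq_norm sigma_finite_measure_count_space_finite)
    fix j
    show "(\<lambda>w. H (fst w) j (snd w)) \<in> borel_measurable (count_space UNIV \<Otimes>\<^sub>M borel)"
      by (intro measurable_compose_countable'[where g = fst and I = UNIV and f = "\<lambda>i q. H i j (snd q)"])
        (auto simp: H_def)
  qed simp
  then show ?thesis by (simp add: nn_integral_count_space_finite UNIV_bool H_def add.commute)
qed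

lemma lattice_norm_slice: "lattice_norm seq_space (slice_norm q u L x)"
proof
  show "slice_norm q u L x g \<le> slice_norm q u L x h" if "\<And>y. y \<in> space seq_space \<Longrightarrow> g y \<le> h y" for g h
    using that unfolding slice_norm_def by (intro seq_norm_mono) simp
  show "(\<lambda>s. slice_norm q u L x (F s)) \<in> borel_measurable borel"
    if "case_prod F \<in> borel_measurable (borel \<Otimes>\<^sub>M seq_space)" for F :: "real \<Rightarrow> nat \<times> (real ^ 'n) \<Rightarrow> ennreal"
    using measurable_compose[OF measurable_Pair2'[of x]
        measurable_seq_norm_param[of "\<lambda>s j z. F s (j, z)", OF slice_measurable[OF that]]]
    by (simp add: slice_norm_def)
  show "slice_norm q u L x (\<lambda>y. \<integral>\<^sup>+s. F s y \<partial>lborel) \<le> (\<integral>\<^sup>+s. slice_norm q u L x (F s) \<partial>lborel)"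
    if F: "case_prod F \<in> borel_measurable (borel \<Otimes>\<^sub>M seq_space)" for F :: "real \<Rightarrow> nat \<times> (real ^ 'n) \<Rightarrow> ennreal"
    unfolding slice_norm_def
    by (rule minkowski_seq_norm[OF sigma_finite_lborel])
      (use slice_measurable[OF F] in \<open>simp cong: measurable_cong_sets\<close>)
  show "slice_norm q u L x (\<lambda>y. c * g y) \<le> c * slice_norm q u L x g"
    if "g \<in> borel_measurable seq_space" "c < top" for c g
    unfolding slice_norm_def using seq_norm_cmult[OF slice_measurable_section[OF that(1)]] by simp
  show "slice_norm q u L x (\<lambda>y. g y + h y) \<le> slice_norm q u L x g + slice_norm q u L x h"
    if "g \<in> borel_measurable seq_space" "h \<in> borel_measurable seq_space" for g h
    unfolding slice_norm_def using that by (intro seq_norm_add slice_measurable_section)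
qed

end

section \<open>Boundedness in mixed norms by induction over the variables\<close>

lemma vmax_eq_max_avg: "vmax \<iota> K F s y = max_avg \<iota> K (\<lambda>z. F z y) s"
  by (simp add: vmax_def max_avg_def)

lemma max_avg_mono: "(\<And>z. g z \<le> h z) \<Longrightarrow> max_avg \<iota> K g x \<le> max_avg \<iota> K h x"
  unfolding max_avg_def avg_def
  by (intro SUP_subset_mono divide_right_mono_ennreal nn_integral_mono mult_right_mono) auto

definition slice_bounded :: "real ^ 'n \<Rightarrow> ennreal \<Rightarrow> 'n list \<Rightarrow> real \<Rightarrow> bool" where
  "slice_bounded q u L r \<longleftrightarrow> (\<exists>C<top. \<forall>\<iota> x. dyadic_filtration \<iota> \<longrightarrow>
     max_bounded seq_space (slice_norm q u L x) \<iota> r C)"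

definition coord_max ::
    "(nat \<Rightarrow> real \<Rightarrow> int) \<Rightarrow> nat \<Rightarrow> 'n \<Rightarrow> (nat \<Rightarrow> real ^ 'n \<Rightarrow> ennreal) \<Rightarrow> nat \<Rightarrow> real ^ 'n \<Rightarrow> ennreal" where
  "coord_max \<iota> K i f j x = max_avg \<iota> K (\<lambda>s. f j (upd_coord x i s)) (x $ i)"

lemma slice_measurable1:
  assumes "case_prod F \<in> borel_measurable (borel \<Otimes>\<^sub>M seq_space)"
  shows "(\<lambda>s. F s (j, x :: real ^ 'n)) \<in> borel_measurable (borel :: real measure)"
  using measurable_compose[OF measurable_Pair2'[of x] slice_measurable[OF assms, of j]] by simp

context
  fixes q :: "real ^ 'n::finite" and u :: ennreal
  assumes q: "\<And>i. 1 < q $ i" and u: "1 < u"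
begin

lemma slice_bounded_all:
  assumes "slice_bounded q u L r" "1 < r" "1 < p"
  shows "slice_bounded q u L p"
proof -
  from assms obtain C where C: "C < top" and bd: "\<And>\<iota> x. dyadic_filtration \<iota> \<Longrightarrow>
     max_bounded seq_space (slice_norm q u L x) \<iota> r C"
    unfolding slice_bounded_def by blast
  have nf: "normed_filtration seq_space (slice_norm q u L x) \<iota>" if "dyadic_filtration \<iota>" for \<iota> x
    using lattice_norm_slice[OF q u] that by (simp add: normed_filtration_def)
  consider "p = r" | "r < p" | "p < r" by linarith
  then show ?thesis
  proof cases
    case 1
    then show ?thesis using assms by simp
  next
    case 2
    show ?thesis unfolding slice_bounded_def
    proof (intro exI[of _ "ennreal (doob_const p) * epowr C (p / r) * ennreal (doob_const (p / r))"] conjI allI impI)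
      show "ennreal (doob_const p) * epowr C (p / r) * ennreal (doob_const (p / r)) < top"
        using C by (simp add: ennreal_mult_less_top)
      fix \<iota> and x :: "real ^ 'n" assume "dyadic_filtration \<iota>"
      then show "max_bounded seq_space (slice_norm q u L x) \<iota> p
          (ennreal (doob_const p) * epowr C (p / r) * ennreal (doob_const (p / r)))"
        using 2 assms by (intro normed_filtration.max_bounded_up[OF nf] bd) auto
    qed
  next
    case 3
    show ?thesis unfolding slice_bounded_def
    proof (intro exI[of _ "(1 + C * ennreal (marc_const p r)) * ennreal (doob_const p)"] conjI allI impI)
      show "(1 + C * ennreal (marc_const p r)) * ennreal (doob_const p) < top"
        using C by (simp add: ennreal_mult_less_top)
      fix \<iota> and x :: "real ^ 'n" assume "dyadic_filtration \<iota>"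
      then show "max_bounded seq_space (slice_norm q u L x) \<iota> p ((1 + C * ennreal (marc_const p r)) * ennreal (doob_const p))"
        using 3 assms by (intro normed_filtration.max_bounded_down[OF nf] bd) auto
    qed
  qed
qed

text \<open>For \<open>u = \<infinity>\<close> an average of \<open>F j\<close> is at most the
  average of the supremum over \<open>j\<close>, so scalar Doob suffices at any exponent; 2 is a
  choice. For finite \<open>u\<close> the exponent \<open>u\<close> itself lets sum and integral be
  exchanged, and Doob is applied term by term.\<close>

lemma slice_bounded_Nil: "\<exists>r>1. slice_bounded q u [] r"
proof (rule lq_norm_cases[OF u])
  assume ui: "u = \<infinity>"
  have "slice_bounded q u [] 2"
    unfolding slice_bounded_def
  proof (intro exI[of _ "ennreal (doob_const 2)"] conjI allI impI)
    fix \<iota> and x :: "real ^ 'n" assume "dyadic_filtration \<iota>"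
    then interpret dyadic_filtration \<iota> .
    show "max_bounded seq_space (slice_norm q u [] x) \<iota> 2 (ennreal (doob_const 2))"
      unfolding max_bounded_def
    proof (intro allI impI)
      fix K and F :: "real \<Rightarrow> nat \<times> (real ^ 'n) \<Rightarrow> ennreal"
      assume F: "case_prod F \<in> borel_measurable (borel \<Otimes>\<^sub>M seq_space)"
      note [measurable] = slice_measurable1[OF F]
      have "(\<integral>\<^sup>+s. epowr (slice_norm q u [] x (vmax \<iota> K F s)) 2 \<partial>lborel)
          \<le> (\<integral>\<^sup>+s. epowr (max_avg \<iota> K (\<lambda>s. SUP j. F s (j, x)) s) 2 \<partial>lborel)"
        by (intro nn_integral_mono epowr_mono)
          (auto simp: slice_norm_def seq_norm_Nil ui lq_norm_def vmax_eq_max_avg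
            intro!: SUP_least max_avg_mono SUP_upper)
      also have "\<dots> \<le> ennreal (doob_const 2) * (\<integral>\<^sup>+s. epowr (SUP j. F s (j, x)) 2 \<partial>lborel)"
        by (rule doob) auto
      finally show "(\<integral>\<^sup>+s. epowr (slice_norm q u [] x (vmax \<iota> K F s)) 2 \<partial>lborel)
          \<le> ennreal (doob_const 2) * (\<integral>\<^sup>+s. epowr (slice_norm q u [] x (F s)) 2 \<partial>lborel)"
        by (simp add: slice_norm_def seq_norm_Nil ui lq_norm_def)
    qed
  qed auto
  then show ?thesis by (intro exI[of _ 2]) simp
next
  fix r assume r: "1 < r" and ur: "u = ennreal r"
  have "slice_bounded q u [] r"
    unfolding slice_bounded_def
  proof (intro exI[of _ "ennreal (doob_const r)"] conjI allI impI)
    fix \<iota> and x :: "real ^ 'n" assume "dyadic_filtration \<iota>"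
    then interpret dyadic_filtration \<iota> .
    show "max_bounded seq_space (slice_norm q u [] x) \<iota> r (ennreal (doob_const r))"
      unfolding max_bounded_def
    proof (intro allI impI)
      fix K and F :: "real \<Rightarrow> nat \<times> (real ^ 'n) \<Rightarrow> ennreal"
      assume F: "case_prod F \<in> borel_measurable (borel \<Otimes>\<^sub>M seq_space)"
      note [measurable] = slice_measurable1[OF F]
      have eq: "epowr (slice_norm q u [] x g) r = (\<Sum>j. epowr (g (j, x)) r)" for g :: "nat \<times> (real ^ 'n) \<Rightarrow> ennreal"
        using r by (simp add: slice_norm_def seq_norm_Nil ur lq_norm_ennreal epowr_lp nn_integral_count_space_nat)
      have "(\<integral>\<^sup>+s. epowr (slice_norm q u [] x (vmax \<iota> K F s)) r \<partial>lborel)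
          = (\<Sum>j. \<integral>\<^sup>+s. epowr (max_avg \<iota> K (\<lambda>s. F s (j, x)) s) r \<partial>lborel)"
        unfolding eq vmax_eq_max_avg by (rule nn_integral_suminf) measurable
      also have "\<dots> \<le> (\<Sum>j. ennreal (doob_const r) * (\<integral>\<^sup>+s. epowr (F s (j, x)) r \<partial>lborel))"
        by (intro suminf_le doob[OF r]) auto
      also have "\<dots> = ennreal (doob_const r) * (\<Sum>j. \<integral>\<^sup>+s. epowr (F s (j, x)) r \<partial>lborel)"
        by simp
      also have "(\<Sum>j. \<integral>\<^sup>+s. epowr (F s (j, x)) r \<partial>lborel) = (\<integral>\<^sup>+s. epowr (slice_norm q u [] x (F s)) r \<partial>lborel)"
        unfolding eq by (rule nn_integral_suminf[symmetric]) measurable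
      finally show "(\<integral>\<^sup>+s. epowr (slice_norm q u [] x (vmax \<iota> K F s)) r \<partial>lborel)
          \<le> ennreal (doob_const r) * (\<integral>\<^sup>+s. epowr (slice_norm q u [] x (F s)) r \<partial>lborel)" .
    qed
  qed auto
  then show ?thesis using r by auto
qed

text \<open>When the exponent in the parameter equals that of the new variable, the
  \<open>q $ l\<close>-th powers are plain integrals. Tonelli exchanges them, and the bound for each
  frozen value of the new variable integrates with the same constant.\<close>

lemma slice_bounded_snoc:
  assumes "slice_bounded q u L (q $ l)"
  shows "slice_bounded q u (L @ [l]) (q $ l)"
proof -
  from assms obtain C where C: "C < top" and bd: "\<And>\<iota> x. dyadic_filtration \<iota> \<Longrightarrow>
     max_bounded seq_space (slice_norm q u L x) \<iota> (q $ l) C"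
    unfolding slice_bounded_def by blast
  show ?thesis unfolding slice_bounded_def
  proof (intro exI[of _ C] conjI C allI impI)
    fix \<iota> and x :: "real ^ 'n" assume \<iota>: "dyadic_filtration \<iota>"
    then have nf: "normed_filtration seq_space (slice_norm q u L x) \<iota>" for x
      using lattice_norm_slice[OF q u] by (simp add: normed_filtration_def)
    show "max_bounded seq_space (slice_norm q u (L @ [l]) x) \<iota> (q $ l) C"
      unfolding max_bounded_def
    proof (intro allI impI)
      fix K and F :: "real \<Rightarrow> nat \<times> (real ^ 'n) \<Rightarrow> ennreal"
      assume F: "case_prod F \<in> borel_measurable (borel \<Otimes>\<^sub>M seq_space)"
      have eq: "(\<integral>\<^sup>+s. epowr (slice_norm q u (L @ [l]) x (G s)) (q $ l) \<partial>lborel)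
        = (\<integral>\<^sup>+v. \<integral>\<^sup>+s. epowr (slice_norm q u L (upd_coord x l v) (G s)) (q $ l) \<partial>lborel \<partial>lborel)"
        if G: "case_prod G \<in> borel_measurable (borel \<Otimes>\<^sub>M seq_space)" for G :: "real \<Rightarrow> nat \<times> (real ^ 'n) \<Rightarrow> ennreal"
      proof -
        have m: "(\<lambda>w. (fst w, upd_coord x l (snd w))) \<in> lborel \<Otimes>\<^sub>M lborel \<rightarrow>\<^sub>M borel \<Otimes>\<^sub>M borel"
          by measurable
        have "(\<lambda>w. seq_norm q u L (\<lambda>j z. G (fst w) (j, z)) (upd_coord x l (snd w))) \<in> borel_measurable (lborel \<Otimes>\<^sub>M lborel)"
          using measurable_compose[OF m measurable_seq_norm_param[OF q u slice_measurable[OF G]]] by simp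
        then have [measurable]: "(\<lambda>w. slice_norm q u L (upd_coord x l (snd w)) (G (fst w))) \<in> borel_measurable (lborel \<Otimes>\<^sub>M lborel)"
          by (simp add: slice_norm_def)
        have "0 < q $ l" by (rule exponents_ge_1[OF q u])
        then have "(\<integral>\<^sup>+s. epowr (slice_norm q u (L @ [l]) x (G s)) (q $ l) \<partial>lborel)
            = (\<integral>\<^sup>+s. \<integral>\<^sup>+v. epowr (slice_norm q u L (upd_coord x l v) (G s)) (q $ l) \<partial>lborel \<partial>lborel)"
          by (simp add: slice_norm_def seq_norm_snoc epowr_lp)
        also have "\<dots> = (\<integral>\<^sup>+v. \<integral>\<^sup>+s. epowr (slice_norm q u L (upd_coord x l v) (G s)) (q $ l) \<partial>lborel \<partial>lborel)"
          by (rule lborel_pair.Fubini'[symmetric]) (simp add: case_prod_unfold)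
        finally show ?thesis .
      qed
      have "(\<integral>\<^sup>+s. epowr (slice_norm q u (L @ [l]) x (vmax \<iota> K F s)) (q $ l) \<partial>lborel)
        = (\<integral>\<^sup>+v. \<integral>\<^sup>+s. epowr (slice_norm q u L (upd_coord x l v) (vmax \<iota> K F s)) (q $ l) \<partial>lborel \<partial>lborel)"
        by (rule eq[OF normed_filtration.meas_vmax[OF nf F]])
      also have "\<dots> \<le> (\<integral>\<^sup>+v. C * (\<integral>\<^sup>+s. epowr (slice_norm q u L (upd_coord x l v) (F s)) (q $ l) \<partial>lborel) \<partial>lborel)"
        using bd[OF \<iota>] F by (intro nn_integral_mono) (simp add: max_bounded_def)
      also have "\<dots> = C * (\<integral>\<^sup>+v. (\<integral>\<^sup>+s. epowr (slice_norm q u L (upd_coord x l v) (F s)) (q $ l) \<partial>lborel) \<partial>lborel)"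
      proof (rule nn_integral_cmult)
        have m: "(\<lambda>w. (snd w, upd_coord x l (fst w))) \<in> lborel \<Otimes>\<^sub>M lborel \<rightarrow>\<^sub>M borel \<Otimes>\<^sub>M borel"
          by measurable
        have "(\<lambda>w. seq_norm q u L (\<lambda>j z. F (snd w) (j, z)) (upd_coord x l (fst w))) \<in> borel_measurable (lborel \<Otimes>\<^sub>M lborel)"
          using measurable_compose[OF m measurable_seq_norm_param[OF q u slice_measurable[OF F]]] by simp
        then have [measurable]: "(\<lambda>w. slice_norm q u L (upd_coord x l (fst w)) (F (snd w))) \<in> borel_measurable (lborel \<Otimes>\<^sub>M lborel)"
          by (simp add: slice_norm_def)
        show "(\<lambda>v. \<integral>\<^sup>+s. epowr (slice_norm q u L (upd_coord x l v) (F s)) (q $ l) \<partial>lborel) \<in> borel_measurable lborel"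
          by measurable
      qed
      also have "(\<integral>\<^sup>+v. (\<integral>\<^sup>+s. epowr (slice_norm q u L (upd_coord x l v) (F s)) (q $ l) \<partial>lborel) \<partial>lborel)
          = (\<integral>\<^sup>+s. epowr (slice_norm q u (L @ [l]) x (F s)) (q $ l) \<partial>lborel)"
        by (rule eq[OF F, symmetric])
      finally show "(\<integral>\<^sup>+s. epowr (slice_norm q u (L @ [l]) x (vmax \<iota> K F s)) (q $ l) \<partial>lborel)
          \<le> C * (\<integral>\<^sup>+s. epowr (slice_norm q u (L @ [l]) x (F s)) (q $ l) \<partial>lborel)" .
    qed
  qed
qed

theorem slice_bounded: "1 < r \<Longrightarrow> slice_bounded q u L r"
proof (induction L arbitrary: r rule: rev_induct)
  case Nil
  then show ?case using slice_bounded_Nil slice_bounded_all by blast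
next
  case (snoc l L)
  then show ?case using slice_bounded_snoc slice_bounded_all q by blast
qed

text \<open>The coordinate in which the operator acts becomes the real parameter, the coordinates in
  \<open>L\<close> become the lattice. The norm in the parameter is then the norm of the next
  coordinate \<open>i\<close>.\<close>

theorem coord_max_bounded:
  assumes i: "i \<notin> set L"
  shows "\<exists>C<top. \<forall>\<iota> K f x. dyadic_filtration \<iota> \<longrightarrow> (\<forall>j. f j \<in> borel_measurable borel) \<longrightarrow>
    seq_norm q u (L @ [i]) (coord_max \<iota> K i f) x \<le> C * seq_norm q u (L @ [i]) f x"
proof -
  obtain C where C: "C < top" and bd: "\<And>\<iota> x. dyadic_filtration \<iota> \<Longrightarrow>
     max_bounded seq_space (slice_norm q u L x) \<iota> (q $ i) C"
    using slice_bounded[of "q $ i" L] q unfolding slice_bounded_def by blast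
  have qi: "0 < q $ i" by (rule exponents_ge_1[OF q u])
  show ?thesis
  proof (intro exI[of _ "epowr C (1 / q $ i)"] conjI allI impI)
    fix \<iota> K and f :: "nat \<Rightarrow> real ^ 'n \<Rightarrow> ennreal" and x :: "real ^ 'n"
    assume \<iota>: "dyadic_filtration \<iota>" and f: "\<forall>j. f j \<in> borel_measurable borel"
    define F where "F s y = f (fst y) (upd_coord (snd y) i s)" for s y
    have "(\<lambda>w. F (fst w) (snd w)) \<in> borel_measurable (borel \<Otimes>\<^sub>M seq_space)"
      unfolding F_def
    proof (rule measurable_compose_countable[where g = "\<lambda>w. fst (snd w)"
          and f = "\<lambda>j w. f j (upd_coord (snd (snd w)) i (fst w))"])
      show "(\<lambda>w. f j (upd_coord (snd (snd w)) i (fst w))) \<in> borel_measurable (borel \<Otimes>\<^sub>M seq_space)" for j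
        unfolding seq_space_def by (rule measurable_compose[OF _ f[rule_format, of j]]) measurable
      show "(\<lambda>w. fst (snd w)) \<in> borel \<Otimes>\<^sub>M seq_space \<rightarrow>\<^sub>M count_space UNIV"
        unfolding seq_space_def by measurable
    qed
    then have F: "case_prod F \<in> borel_measurable (borel \<Otimes>\<^sub>M seq_space)" by (simp add: case_prod_unfold)
    have e1: "slice_norm q u L x (F s) = seq_norm q u L f (upd_coord x i s)" for s
      unfolding slice_norm_def F_def using seq_norm_subst[OF q u i, of f s x] by simp
    have e2: "slice_norm q u L x (vmax \<iota> K F s) = seq_norm q u L (coord_max \<iota> K i f) (upd_coord x i s)" for s
      unfolding slice_norm_def
      using seq_norm_subst[OF q u i, of "coord_max \<iota> K i f" s x]
      by (simp add: vmax_eq_max_avg coord_max_def F_def)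
    have "(\<integral>\<^sup>+s. epowr (seq_norm q u L (coord_max \<iota> K i f) (upd_coord x i s)) (q $ i) \<partial>lborel)
      \<le> C * (\<integral>\<^sup>+s. epowr (seq_norm q u L f (upd_coord x i s)) (q $ i) \<partial>lborel)"
      using bd[OF \<iota>, of x] F unfolding max_bounded_def e1[symmetric] e2[symmetric] by blast
    then have "epowr (seq_norm q u (L @ [i]) (coord_max \<iota> K i f) x) (q $ i)
        \<le> C * epowr (seq_norm q u (L @ [i]) f x) (q $ i)"
      by (simp add: seq_norm_snoc epowr_lp qi)
    then have "seq_norm q u (L @ [i]) (coord_max \<iota> K i f) x
        \<le> epowr (C * epowr (seq_norm q u (L @ [i]) f x) (q $ i)) (1 / q $ i)"
      using qi by (simp add: epowr_le_iff)
    then show "seq_norm q u (L @ [i]) (coord_max \<iota> K i f) x \<le> epowr C (1 / q $ i) * seq_norm q u (L @ [i]) f x"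
      using qi by (simp add: epowr_mult epowr_epowr)
  qed (use C in simp)
qed

end

section \<open>The maximal operator on mixed norm spaces\<close>

text \<open>Cells of index \<open>g\<close> have length \<open>2 powi (- g)\<close>. The shifted
  grid is displaced by a third of a cell, to alternating sides as \<open>g\<close> changes parity: a
  constant sign would not give nested cells.\<close>

definition grid_index :: "bool \<Rightarrow> int \<Rightarrow> real \<Rightarrow> int" where
  "grid_index \<alpha> g x = \<lfloor>2 powi g * x - (if \<alpha> then (if even g then 1 / 3 else - 1 / 3) else 0)\<rfloor>"

text \<open>Generation \<open>0\<close> of \<open>grid \<alpha> m\<close> has cells of length \<open>2\<^sup>m\<close>.\<close>

definition grid :: "bool \<Rightarrow> nat \<Rightarrow> nat \<Rightarrow> real \<Rightarrow> int" where
  "grid \<alpha> m k = grid_index \<alpha> (int k - int m)"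

lemma grid_index_cell:
  "{y. grid_index \<alpha> g y = n} =
    {(of_int n + (if \<alpha> then (if even g then 1 / 3 else - 1 / 3) else 0)) / 2 powi g ..<
     (of_int n + 1 + (if \<alpha> then (if even g then 1 / 3 else - 1 / 3) else 0)) / 2 powi g}"
proof -
  have pos: "0 < (2 :: real) powi g" by simp
  define s :: real where "s = (if \<alpha> then (if even g then 1 / 3 else - 1 / 3) else 0)"
  show ?thesis
    unfolding grid_index_def s_def[symmetric]
    using pos by (auto simp: floor_eq_iff field_simps)
qed

lemma emeasure_grid_index_cell: "emeasure lborel {y. grid_index \<alpha> g y = n} = ennreal (2 powi (- g))"
proof -
  define s :: real where "s = (if \<alpha> then (if even g then 1 / 3 else - 1 / 3) else 0)"
  have "emeasure lborel {(of_int n + s) / 2 powi g ..< (of_int n + 1 + s) / 2 powi g}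
      = ennreal ((of_int n + 1 + s) / 2 powi g - (of_int n + s) / 2 powi g)"
    by (rule emeasure_lborel_Ico) (simp add: divide_right_mono)
  also have "(of_int n + 1 + s) / 2 powi g - (of_int n + s) / 2 powi g = 2 powi (- g)"
    by (simp add: diff_divide_distrib[symmetric] power_int_minus inverse_eq_divide)
  finally show ?thesis by (simp add: grid_index_cell s_def)
qed

text \<open>With \<open>s g\<close> the displacement, \<open>s (g + 1) - 2 * s g\<close> is an
  integer, namely 0 or a sign. The coarse index is therefore half the fine index, corrected by this
  integer and rounded down.\<close>

lemma grid_index_nested:
  assumes "grid_index \<alpha> (g + 1) x = grid_index \<alpha> (g + 1) y"
  shows "grid_index \<alpha> g x = grid_index \<alpha> g y"
proof -
  define s :: "int \<Rightarrow> real" where "s g = (if \<alpha> then (if even g then 1 / 3 else - 1 / 3) else 0)" for g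
  obtain e :: int where e: "s (g + 1) - 2 * s g = of_int e"
  proof (cases "\<alpha>")
    case True
    then show ?thesis using that[of "if even g then -1 else 1"] by (auto simp: s_def)
  next
    case False
    then show ?thesis using that[of 0] by (auto simp: s_def)
  qed
  have "grid_index \<alpha> g z = (grid_index \<alpha> (g + 1) z + e) div 2" for z
  proof -
    have "2 powi g * z - s g = (2 powi (g + 1) * z - s (g + 1) + of_int e) / of_int 2"
      using e by (simp add: power_int_add field_simps)
    then have "\<lfloor>2 powi g * z - s g\<rfloor> = \<lfloor>2 powi (g + 1) * z - s (g + 1) + of_int e\<rfloor> div 2"
      using floor_divide_real_eq_div[of 2 "2 powi (g + 1) * z - s (g + 1) + of_int e"] by (metis zero_le_numeral)
    then show ?thesis by (simp add: grid_index_def s_def)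
  qed
  then show ?thesis using assms by simp
qed

lemma dyadic_filtration_grid: "dyadic_filtration (grid \<alpha> m)"
proof
  have cell: "cell (grid \<alpha> m) k x = {y. grid_index \<alpha> (int k - int m) y = grid_index \<alpha> (int k - int m) x}" for k x
    by (simp add: cell_def grid_def)
  show "grid \<alpha> m k \<in> borel \<rightarrow>\<^sub>M count_space UNIV" for k
    unfolding grid_def grid_index_def
    by (rule measurable_compose[OF _ measurable_real_floor]) measurable
  show "grid \<alpha> m (Suc k) x = grid \<alpha> m (Suc k) y \<Longrightarrow> grid \<alpha> m k x = grid \<alpha> m k y" for k x y
    using grid_index_nested[of \<alpha> "int k - int m" x y] by (simp add: grid_def algebra_simps)
  show "0 < emeasure lborel (cell (grid \<alpha> m) k x)" "emeasure lborel (cell (grid \<alpha> m) k x) < top" for k x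
    by (simp_all add: cell emeasure_grid_index_cell)
  show "emeasure lborel (cell (grid \<alpha> m) k x) \<le> 2 * emeasure lborel (cell (grid \<alpha> m) (Suc k) x)" for k x
  proof -
    have "(2::real) powi (- (int k - int m)) = 2 * 2 powi (- (int (Suc k) - int m))"
      using power_int_add[of "2::real" 1 "- (int (Suc k) - int m)"] by simp
    then show ?thesis
      by (simp add: cell emeasure_grid_index_cell ennreal_mult del: of_nat_Suc)
  qed
qed

text \<open>After scaling, the interval has length at most 1/3. If it crosses an integer, it stays
  too close to it to cross a breakpoint of the shifted grid.\<close>

lemma one_third_trick:
  assumes "0 < \<rho>" "2 powi g * (2 * \<rho>) \<le> 1 / 3"
  obtains \<alpha> where "\<And>x y. \<lbrakk>\<bar>x - c\<bar> \<le> \<rho>; \<bar>y - c\<bar> \<le> \<rho>\<rbrakk> \<Longrightarrow> grid_index \<alpha> g x = grid_index \<alpha> g y"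
proof -
  define a :: real where "a = 2 powi g"
  have a: "0 < a" by (simp add: a_def)
  define lo hi where "lo = a * (c - \<rho>)" and "hi = a * (c + \<rho>)"
  have w: "lo \<le> hi" "hi - lo \<le> 1 / 3"
    using assms a unfolding lo_def hi_def a_def[symmetric] by (auto simp: algebra_simps intro: mult_left_mono)
  have rng: "lo \<le> a * x" "a * x \<le> hi" if "\<bar>x - c\<bar> \<le> \<rho>" for x
    using that a unfolding lo_def hi_def by (auto intro!: mult_left_mono)
  have fl: "\<lfloor>a * x - s\<rfloor> = \<lfloor>lo - s\<rfloor>" if "\<bar>x - c\<bar> \<le> \<rho>" "\<lfloor>lo - s\<rfloor> = \<lfloor>hi - s\<rfloor>" for x s
    using rng[OF that(1)] that(2) floor_mono[of "lo - s" "a * x - s"] floor_mono[of "a * x - s" "hi - s"] by linarith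
  show thesis
  proof (cases "\<lfloor>lo\<rfloor> = \<lfloor>hi\<rfloor>")
    case True
    show thesis
      by (rule that[of False]) (use fl[of _ 0] True in \<open>simp add: grid_index_def a_def[symmetric]\<close>)
  next
    case False
    define s :: real where "s = (if even g then 1 / 3 else - 1 / 3)"
    obtain n where n: "n = \<lfloor>hi\<rfloor>" by simp
    have N: "lo < of_int n" "of_int n \<le> hi" unfolding n using False w by linarith+
    have "\<lfloor>lo - s\<rfloor> = \<lfloor>hi - s\<rfloor>"
    proof (cases "even g")
      case True
      have "\<lfloor>lo - s\<rfloor> = n - 1" "\<lfloor>hi - s\<rfloor> = n - 1"
        using N w True by (auto simp: floor_eq_iff s_def)
      then show ?thesis by simp
    next
      case False
      have "\<lfloor>lo - s\<rfloor> = n" "\<lfloor>hi - s\<rfloor> = n"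
        using N w False by (auto simp: floor_eq_iff s_def)
      then show ?thesis by simp
    qed
    then show thesis
      by (intro that[of True]) (use fl[of _ s] in \<open>simp add: grid_index_def a_def[symmetric] s_def\<close>)
  qed
qed

text \<open>The largest admissible \<open>g\<close> is taken. Without rounding, the cell would have
  three times the length \<open>2 * \<rho>\<close> of the interval; rounding to a power of 2 loses
  at most another factor 2, which gives 12.\<close>

lemma scale_exists:
  fixes \<rho> :: real assumes "0 < \<rho>"
  obtains g where "2 powi g * (2 * \<rho>) \<le> 1 / 3" "2 powi (- g) \<le> 12 * \<rho>"
proof -
  define g where "g = \<lfloor>log 2 (1 / (6 * \<rho>))\<rfloor>"
  have "of_int g \<le> log 2 (1 / (6 * \<rho>))" "log 2 (1 / (6 * \<rho>)) < of_int g + 1"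
    by (auto simp: g_def)
  moreover have pos: "0 < 1 / (6 * \<rho>)" using assms by simp
  ultimately have 1: "2 powr (of_int g) \<le> 1 / (6 * \<rho>)" "1 / (6 * \<rho>) < 2 powr (of_int g + 1)"
    using iffD1[OF le_log_iff[of 2 "1 / (6 * \<rho>)" "of_int g"]]
      iffD1[OF log_less_iff[of 2 "1 / (6 * \<rho>)" "of_int g + 1"]] by linarith+
  define a :: real where "a = 2 powi g"
  have "2 powr (of_int g) = a" "2 powr (of_int g + 1) = 2 * a"
    by (simp_all add: a_def powr_add powr_real_of_int')
  with 1 have a: "a \<le> 1 / (6 * \<rho>)" "1 / (6 * \<rho>) < 2 * a" by simp_all
  have "0 < a" by (simp add: a_def)
  have "a * (2 * \<rho>) \<le> 1 / (6 * \<rho>) * (2 * \<rho>)" using a assms by (intro mult_right_mono) auto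
  moreover have "1 / (6 * \<rho>) * (2 * \<rho>) = 1 / 3" using assms by (simp add: field_simps)
  moreover have "inverse a \<le> 12 * \<rho>"
    using a(2) \<open>0 < a\<close> assms by (simp add: field_simps)
  ultimately show thesis
    by (intro that[of g]) (simp_all add: a_def power_int_minus)
qed

text \<open>Generations 0 to \<open>2 * m\<close> of \<open>grid \<alpha> m\<close> have lengths
  from \<open>2 ^ m\<close> down to \<open>2 powi (- m)\<close>, so the supremum over
  \<open>m\<close> reaches all scales. The two grids are added since the norms satisfy a triangle
  inequality.\<close>

definition strong_max :: "'n \<Rightarrow> (nat \<Rightarrow> real ^ 'n \<Rightarrow> ennreal) \<Rightarrow> nat \<Rightarrow> real ^ 'n \<Rightarrow> ennreal" where
  "strong_max i f j x = (SUP m. coord_max (grid False m) (2 * m) i f j x) + (SUP m. coord_max (grid True m) (2 * m) i f j x)"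

lemma coord_max_grid_le:
  assumes "\<bar>g\<bar> \<le> int m"
  shows "(\<integral>\<^sup>+s. f j (upd_coord x i s) * indicator {s. grid_index \<alpha> g s = grid_index \<alpha> g (x $ i)} s \<partial>lborel)
    \<le> ennreal (2 powi (- g)) * coord_max (grid \<alpha> m) (2 * m) i f j x"
proof -
  define k where "k = nat (g + int m)"
  have k: "int k - int m = g" "k \<le> 2 * m" using assms by (auto simp: k_def)
  have cell: "cell (grid \<alpha> m) k (x $ i) = {s. grid_index \<alpha> g s = grid_index \<alpha> g (x $ i)}"
    by (simp add: cell_def grid_def k)
  let ?I = "\<integral>\<^sup>+s. f j (upd_coord x i s) * indicator {s. grid_index \<alpha> g s = grid_index \<alpha> g (x $ i)} s \<partial>lborel"
  have "?I = ennreal (2 powi (- g)) * (?I / ennreal (2 powi (- g)))"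
  proof -
    have "v * (I / v) = I" if "v \<noteq> 0" "v \<noteq> top" for v I :: ennreal
      using that ennreal_mult_divide_eq[of v I] by (simp add: ennreal_times_divide mult.commute)
    then show ?thesis by simp
  qed
  also have "?I / ennreal (2 powi (- g)) = avg (grid \<alpha> m) k (\<lambda>s. f j (upd_coord x i s)) (x $ i)"
    by (simp add: avg_def cell emeasure_grid_index_cell)
  also have "\<dots> \<le> coord_max (grid \<alpha> m) (2 * m) i f j x"
    unfolding coord_max_def max_avg_def using k by (intro SUP_upper) auto
  finally show ?thesis by (simp add: mult_left_mono)
qed

lemma interval_integral_le_strong_max:
  assumes \<rho>: "0 < \<rho>" and x: "\<bar>x $ i - c\<bar> \<le> \<rho>"
  shows "(\<integral>\<^sup>+s. f j (upd_coord x i s) * indicator {s. \<bar>s - c\<bar> \<le> \<rho>} s \<partial>lborel)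
    \<le> ennreal (12 * \<rho>) * strong_max i f j x"
proof -
  obtain g where g: "2 powi g * (2 * \<rho>) \<le> 1 / 3" "2 powi (- g) \<le> 12 * \<rho>"
    using scale_exists[OF \<rho>] .
  obtain \<alpha> where \<alpha>: "\<And>x y. \<lbrakk>\<bar>x - c\<bar> \<le> \<rho>; \<bar>y - c\<bar> \<le> \<rho>\<rbrakk> \<Longrightarrow> grid_index \<alpha> g x = grid_index \<alpha> g y"
    using one_third_trick[OF \<rho> g(1)] by metis
  define m where "m = nat \<bar>g\<bar>"
  have "(\<integral>\<^sup>+s. f j (upd_coord x i s) * indicator {s. \<bar>s - c\<bar> \<le> \<rho>} s \<partial>lborel)
      \<le> (\<integral>\<^sup>+s. f j (upd_coord x i s) * indicator {s. grid_index \<alpha> g s = grid_index \<alpha> g (x $ i)} s \<partial>lborel)"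
    by (intro nn_integral_mono mult_left_mono) (auto simp: indicator_def intro: \<alpha> x)
  also have "\<dots> \<le> ennreal (2 powi (- g)) * coord_max (grid \<alpha> m) (2 * m) i f j x"
    by (rule coord_max_grid_le) (simp add: m_def)
  also have "\<dots> \<le> ennreal (12 * \<rho>) * strong_max i f j x"
  proof (intro mult_mono ennreal_leI g)
    have "coord_max (grid \<alpha> m) (2 * m) i f j x \<le> (SUP m. coord_max (grid \<alpha> m) (2 * m) i f j x)"
      by (intro SUP_upper) auto
    also have "\<dots> \<le> strong_max i f j x"
      unfolding strong_max_def by (cases \<alpha>) auto
    finally show "coord_max (grid \<alpha> m) (2 * m) i f j x \<le> strong_max i f j x" .
  qed auto
  finally show ?thesis .
qed

text \<open>Passing to \<open>Suc m\<close> adds one coarser and one finer generation and renumbers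
  the others by one. Monotone convergence then applies to the supremum over
  \<open>m\<close>.\<close>

lemma coord_max_grid_incseq: "incseq (\<lambda>m. coord_max (grid \<alpha> m) (2 * m) i f j x)"
proof (rule incseq_SucI)
  fix m
  show "coord_max (grid \<alpha> m) (2 * m) i f j x \<le> coord_max (grid \<alpha> (Suc m)) (2 * Suc m) i f j x"
    unfolding coord_max_def max_avg_def
  proof (rule SUP_least)
    fix k assume k: "k \<in> {..2 * m}"
    have "grid \<alpha> m k = grid \<alpha> (Suc m) (Suc k)" by (simp add: grid_def)
    then have "avg (grid \<alpha> m) k (\<lambda>s. f j (upd_coord x i s)) (x $ i)
        = avg (grid \<alpha> (Suc m)) (Suc k) (\<lambda>s. f j (upd_coord x i s)) (x $ i)"
      by (simp add: avg_def cell_def)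
    also have "\<dots> \<le> (SUP k\<in>{..2 * Suc m}. avg (grid \<alpha> (Suc m)) k (\<lambda>s. f j (upd_coord x i s)) (x $ i))"
      using k by (intro SUP_upper) auto
    finally show "avg (grid \<alpha> m) k (\<lambda>s. f j (upd_coord x i s)) (x $ i)
        \<le> (SUP k\<in>{..2 * Suc m}. avg (grid \<alpha> (Suc m)) k (\<lambda>s. f j (upd_coord x i s)) (x $ i))" .
  qed
qed

lemma measurable_coord_max:
  fixes f :: "nat \<Rightarrow> real ^ 'n \<Rightarrow> ennreal"
  assumes "dyadic_filtration \<iota>" "f j \<in> borel_measurable borel"
  shows "coord_max \<iota> K i f j \<in> borel_measurable borel"
proof -
  interpret dyadic_filtration \<iota> by fact
  have F: "case_prod (\<lambda>s x. f j (upd_coord x i s)) \<in> borel_measurable (borel \<Otimes>\<^sub>M borel)"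
    unfolding case_prod_unfold by (rule measurable_compose[OF _ assms(2)]) measurable
  have "(\<lambda>x. avg \<iota> k (\<lambda>s. f j (upd_coord x i s)) (x $ i)) \<in> borel_measurable borel" for k
  proof -
    have "(\<lambda>x :: real ^ 'n. (x $ i, x)) \<in> borel \<rightarrow>\<^sub>M borel \<Otimes>\<^sub>M borel"
      unfolding cart_eq_inner_axis by measurable
    from measurable_compose[OF this meas_avg_param[OF F, of k]] show ?thesis by simp
  qed
  then show ?thesis unfolding coord_max_def[abs_def] max_avg_def by measurable
qed

lemma measurable_strong_max:
  assumes "f j \<in> borel_measurable borel"
  shows "strong_max i f j \<in> borel_measurable borel"
proof -
  have [measurable]: "coord_max (grid \<alpha> m) K i f j \<in> borel_measurable borel" for \<alpha> m K
    by (rule measurable_coord_max[where f = f, OF dyadic_filtration_grid assms])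
  show ?thesis unfolding strong_max_def[abs_def] by measurable
qed

lemma measurable_fold_strong_max:
  fixes f :: "nat \<Rightarrow> real ^ 'n::finite \<Rightarrow> ennreal"
  assumes "\<And>j. f j \<in> borel_measurable borel"
  shows "fold strong_max J f j \<in> borel_measurable borel"
  using assms by (induction J arbitrary: j rule: rev_induct) (auto intro: measurable_strong_max)

context
  fixes q :: "real ^ 'n::finite" and u :: ennreal
  assumes q: "\<And>i. 1 < q $ i" and u: "1 < u"
begin

lemma strong_max_bounded_last:
  assumes i: "i \<notin> set L"
  shows "\<exists>C<top. \<forall>f x. (\<forall>j. f j \<in> borel_measurable borel) \<longrightarrow>
    seq_norm q u (L @ [i]) (strong_max i f) x \<le> C * seq_norm q u (L @ [i]) f x"
proof -
  obtain C where C: "C < top" and bd: "\<And>\<iota> K f x. dyadic_filtration \<iota> \<Longrightarrow> (\<And>j. f j \<in> borel_measurable borel) \<Longrightarrow>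
    seq_norm q u (L @ [i]) (coord_max \<iota> K i f) x \<le> C * seq_norm q u (L @ [i]) f x"
    using coord_max_bounded[OF q u i] by blast
  show ?thesis
  proof (intro exI[of _ "C + C"] conjI allI impI)
    fix f :: "nat \<Rightarrow> real ^ 'n \<Rightarrow> ennreal" and x
    assume f: "\<forall>j. f j \<in> borel_measurable borel"
    have m [measurable]: "coord_max (grid \<alpha> m) K i f j \<in> borel_measurable borel" for \<alpha> m K j
      using f by (intro measurable_coord_max[OF dyadic_filtration_grid]) auto
    have b: "seq_norm q u (L @ [i]) (\<lambda>j x. SUP m. coord_max (grid \<alpha> m) (2 * m) i f j x) x
        \<le> C * seq_norm q u (L @ [i]) f x" for \<alpha>
      by (subst seq_norm_SUP[OF q u])
        (use f in \<open>auto intro!: SUP_least bd dyadic_filtration_grid coord_max_grid_incseq\<close>)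
    have "seq_norm q u (L @ [i]) (strong_max i f) x
        \<le> seq_norm q u (L @ [i]) (\<lambda>j x. SUP m. coord_max (grid False m) (2 * m) i f j x) x
        + seq_norm q u (L @ [i]) (\<lambda>j x. SUP m. coord_max (grid True m) (2 * m) i f j x) x"
      unfolding strong_max_def[abs_def] by (rule seq_norm_add[OF q u]) measurable
    also have "\<dots> \<le> C * seq_norm q u (L @ [i]) f x + C * seq_norm q u (L @ [i]) f x"
      by (intro add_mono b)
    finally show "seq_norm q u (L @ [i]) (strong_max i f) x \<le> (C + C) * seq_norm q u (L @ [i]) f x"
      by (simp add: distrib_right)
  qed (use C in simp)
qed

text \<open>The bound for the list ending in \<open>i\<close> holds for every value of the remaining
  coordinates, and the outer norms are monotone and homogeneous.\<close>

lemma strong_max_bounded: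
  assumes "i \<in> set L" "distinct L"
  shows "\<exists>C<top. \<forall>f x. (\<forall>j. f j \<in> borel_measurable borel) \<longrightarrow>
    seq_norm q u L (strong_max i f) x \<le> C * seq_norm q u L f x"
proof -
  obtain A B where AB: "L = A @ i # B" using assms by (meson split_list)
  then have "i \<notin> set A" using assms by auto
  then obtain C where C: "C < top" and bd: "\<And>f x. (\<And>j. f j \<in> borel_measurable borel) \<Longrightarrow>
    seq_norm q u (A @ [i]) (strong_max i f) x \<le> C * seq_norm q u (A @ [i]) f x"
    using strong_max_bounded_last by blast
  have "seq_norm q u ((A @ [i]) @ B) (strong_max i f) x \<le> C * seq_norm q u ((A @ [i]) @ B) f x"
    if f: "\<And>j. f j \<in> borel_measurable borel" for f x
  proof (induction B arbitrary: x rule: rev_induct)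
    case Nil
    then show ?case using bd[of f x] f by simp
  next
    case (snoc l B)
    have ql: "0 < q $ l" by (rule exponents_ge_1[OF q u])
    have [measurable]: "seq_norm q u ((A @ [i]) @ B) f \<in> borel_measurable borel"
      using f by (intro measurable_seq_norm[OF q u])
    have "seq_norm q u (((A @ [i]) @ B) @ [l]) (strong_max i f) x
        \<le> lp (q $ l) lborel (\<lambda>s. C * seq_norm q u ((A @ [i]) @ B) f (upd_coord x l s))"
      unfolding seq_norm_snoc by (intro lp_mono ql snoc)
    also have "\<dots> = C * seq_norm q u (((A @ [i]) @ B) @ [l]) f x"
      unfolding seq_norm_snoc by (rule lp_cmult[OF _ ql]) measurable
    finally show ?case by simp
  qed
  then show ?thesis using C AB by auto
qed

lemma fold_strong_max_bounded:
  assumes "set J \<subseteq> set L" "distinct L"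
  shows "\<exists>C<top. \<forall>f x. (\<forall>j. f j \<in> borel_measurable borel) \<longrightarrow>
    seq_norm q u L (fold strong_max J f) x \<le> C * seq_norm q u L f x"
  using assms(1)
proof (induction J rule: rev_induct)
  case Nil
  then show ?case by (intro exI[of _ 1]) auto
next
  case (snoc i J)
  then obtain C where C: "C < top" and bd: "\<And>f x. (\<forall>j. f j \<in> borel_measurable borel) \<Longrightarrow>
    seq_norm q u L (fold strong_max J f) x \<le> C * seq_norm q u L f x" by auto
  from snoc strong_max_bounded[OF _ assms(2), of i] obtain D where D: "D < top" and bd': "\<And>f x. (\<forall>j. f j \<in> borel_measurable borel) \<Longrightarrow>
    seq_norm q u L (strong_max i f) x \<le> D * seq_norm q u L f x" by auto
  show ?case
  proof (intro exI[of _ "D * C"] conjI allI impI)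
    fix f :: "nat \<Rightarrow> real ^ 'n \<Rightarrow> ennreal" and x
    assume f: "\<forall>j. f j \<in> borel_measurable borel"
    have "seq_norm q u L (fold strong_max (J @ [i]) f) x \<le> D * seq_norm q u L (fold strong_max J f) x"
      using bd'[of "fold strong_max J f" x] measurable_fold_strong_max[of f J] f by simp
    also have "\<dots> \<le> D * (C * seq_norm q u L f x)" by (intro mult_left_mono bd f) auto
    finally show "seq_norm q u L (fold strong_max (J @ [i]) f) x \<le> D * C * seq_norm q u L f x"
      by (simp add: mult.assoc)
  qed (use C D in \<open>simp add: ennreal_mult_less_top\<close>)
qed

end

section \<open>Iterated integrals and domination of averages over balls\<close>

definition coord_int :: "'n \<Rightarrow> (real ^ 'n \<Rightarrow> ennreal) \<Rightarrow> real ^ 'n \<Rightarrow> ennreal" where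
  "coord_int i F x = (\<integral>\<^sup>+s. F (upd_coord x i s) \<partial>lborel)"

lemma measurable_vec_lambda [measurable]:
  "(\<lambda>w. \<chi> i. w i) \<in> (\<Pi>\<^sub>M i\<in>UNIV. lborel) \<rightarrow>\<^sub>M (borel :: (real ^ 'n::finite) measure)"
proof (rule borel_measurable_euclidean_space[THEN iffD2], intro ballI)
  fix b :: "real ^ 'n" assume "b \<in> Basis"
  then obtain i where b: "b = axis i 1" by (auto simp: Basis_vec_def)
  show "(\<lambda>w. (\<chi> i. w i) \<bullet> b) \<in> borel_measurable (\<Pi>\<^sub>M i\<in>UNIV. lborel)"
    unfolding b inner_axis by simp
qed

lemma lborel_vec_eq_PiM:
  "(lborel :: (real ^ 'n::finite) measure) = distr (\<Pi>\<^sub>M i\<in>UNIV. lborel) borel (\<lambda>w. \<chi> i. w i)"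
proof (rule lborel_eqI)
  interpret product_sigma_finite "\<lambda>_ :: 'n. lborel :: real measure" ..
  fix l u :: "real ^ 'n" assume le: "\<And>b. b \<in> Basis \<Longrightarrow> l \<bullet> b \<le> u \<bullet> b"
  have le': "l $ i \<le> u $ i" for i
    using le[of "axis i 1"] by (simp add: inner_axis)
  have "emeasure (distr (\<Pi>\<^sub>M i\<in>UNIV. lborel) borel (\<lambda>w. \<chi> i. w i)) (box l u)
      = emeasure (\<Pi>\<^sub>M i\<in>UNIV. lborel) ((\<lambda>w. \<chi> i. w i) -` box l u \<inter> space (\<Pi>\<^sub>M i\<in>UNIV. (lborel :: real measure)))"
    by (rule emeasure_distr) auto
  also have "(\<lambda>w. \<chi> i. w i) -` box l u \<inter> space (\<Pi>\<^sub>M i\<in>UNIV. (lborel :: real measure)) = (\<Pi>\<^sub>E i\<in>UNIV. {l $ i <..< u $ i})"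
    by (auto simp: mem_box_cart space_PiM PiE_UNIV_domain Pi_iff)
  also have "emeasure (\<Pi>\<^sub>M i\<in>UNIV. lborel) (\<Pi>\<^sub>E i\<in>UNIV. {l $ i <..< u $ i}) = (\<Prod>i\<in>UNIV. ennreal (u $ i - l $ i))"
    by (subst emeasure_PiM) (auto simp: le')
  also have "\<dots> = ennreal (\<Prod>i\<in>UNIV. u $ i - l $ i)"
    by (rule prod_ennreal) (simp add: le')
  also have "(\<Prod>i\<in>UNIV. u $ i - l $ i) = (\<Prod>b\<in>Basis. (u - l) \<bullet> b)"
  proof -
    have b: "(Basis :: (real ^ 'n) set) = (\<lambda>i. axis i 1) ` UNIV" by (auto simp: Basis_vec_def)
    have "(\<Prod>b\<in>Basis. (u - l) \<bullet> b) = (\<Prod>i\<in>UNIV. (u - l) \<bullet> axis i 1)"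
      unfolding b by (rule prod.reindex[unfolded o_def]) (auto simp: inj_on_def axis_eq_axis)
    then show ?thesis by (simp add: inner_axis)
  qed
  finally show "emeasure (distr (\<Pi>\<^sub>M i\<in>UNIV. lborel) borel (\<lambda>w. \<chi> i. w i)) (box l u)
      = ennreal (\<Prod>b\<in>Basis. (u - l) \<bullet> b)" .
qed simp

lemma fold_coord_int_PiM:
  fixes F :: "real ^ 'n::finite \<Rightarrow> ennreal"
  assumes F: "F \<in> borel_measurable borel" and "distinct L"
  shows "fold coord_int L F x = (\<integral>\<^sup>+w. F (\<chi> i. if i \<in> set L then w i else x $ i) \<partial>(\<Pi>\<^sub>M i\<in>set L. lborel))"
  using assms(2)
proof (induction L arbitrary: x rule: rev_induct)
  case Nil
  have "(\<chi> i. x $ i) = x" by (simp add: vec_eq_iff)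
  then show ?case by (simp add: PiM_empty nn_integral_count_space_finite)
next
  case (snoc l L)
  interpret product_sigma_finite "\<lambda>_ :: 'n. lborel :: real measure" ..
  have l: "l \<notin> set L" using snoc by simp
  have m: "(\<lambda>w. F (\<chi> i. if i \<in> set (L @ [l]) then w i else x $ i)) \<in> borel_measurable (\<Pi>\<^sub>M i\<in>insert l (set L). lborel)"
  proof (rule measurable_compose[OF _ F], rule borel_measurable_euclidean_space[THEN iffD2], intro ballI)
    fix b :: "real ^ 'n" assume "b \<in> Basis"
    then obtain i where b: "b = axis i 1" by (auto simp: Basis_vec_def)
    show "(\<lambda>w. (\<chi> i. if i \<in> set (L @ [l]) then w i else x $ i) \<bullet> b) \<in> borel_measurable (\<Pi>\<^sub>M i\<in>insert l (set L). lborel)"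
      unfolding b inner_axis by (cases "i \<in> set (L @ [l])") auto
  qed
  have "fold coord_int (L @ [l]) F x
      = (\<integral>\<^sup>+s. \<integral>\<^sup>+w. F (\<chi> i. if i \<in> set L then w i else upd_coord x l s $ i) \<partial>(\<Pi>\<^sub>M i\<in>set L. lborel) \<partial>lborel)"
    using snoc by (simp add: coord_int_def[of l])
  also have "\<dots> = (\<integral>\<^sup>+s. \<integral>\<^sup>+w. F (\<chi> i. if i \<in> set (L @ [l]) then (w(l := s)) i else x $ i) \<partial>(\<Pi>\<^sub>M i\<in>set L. lborel) \<partial>lborel)"
    using l by (intro nn_integral_cong arg_cong[of _ _ F]) (auto simp: vec_eq_iff upd_coord_nth)
  also have "\<dots> = (\<integral>\<^sup>+w. F (\<chi> i. if i \<in> set (L @ [l]) then w i else x $ i) \<partial>(\<Pi>\<^sub>M i\<in>insert l (set L). lborel))"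
    by (rule product_nn_integral_insert_rev[symmetric]) (use l m in auto)
  finally show ?case by simp
qed

theorem fold_coord_int:
  fixes F :: "real ^ 'n::finite \<Rightarrow> ennreal"
  assumes F: "F \<in> borel_measurable borel" and L: "distinct L" "set L = UNIV"
  shows "fold coord_int L F x = (\<integral>\<^sup>+z. F z \<partial>lborel)"
proof -
  have "(\<integral>\<^sup>+z. F z \<partial>lborel) = (\<integral>\<^sup>+w. F (\<chi> i. w i) \<partial>(\<Pi>\<^sub>M i\<in>UNIV. lborel))"
    unfolding lborel_vec_eq_PiM by (rule nn_integral_distr) (use F in auto)
  then show ?thesis using fold_coord_int_PiM[OF F L(1), of x] L by simp
qed

lemma fold_coord_int_eq_0:
  assumes "\<And>z. z $ i = x $ i \<Longrightarrow> F z = 0" "i \<notin> set L"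
  shows "fold coord_int L F x = 0"
  using assms
proof (induction L arbitrary: x rule: rev_induct)
  case (snoc l L)
  have "fold coord_int L F (upd_coord x l s) = 0" for s
    using snoc.prems by (intro snoc.IH) (auto simp: upd_coord_nth)
  then show ?case by (simp add: coord_int_def[of l])
qed simp

text \<open>The cube is integrated out one coordinate at a time. Each coordinate contributes an
  interval of half-length \<open>\<rho>\<close>, hence one factor \<open>12 * \<rho>\<close> and one
  application of \<open>strong_max\<close>.\<close>

lemma fold_coord_int_le_fold_strong_max:
  fixes f :: "nat \<Rightarrow> real ^ 'n::finite \<Rightarrow> ennreal"
  assumes f: "\<And>j. f j \<in> borel_measurable borel" and \<rho>: "0 < \<rho>" and L: "distinct L"
    and x: "\<And>i. \<bar>x $ i - c $ i\<bar> \<le> \<rho>"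
  shows "fold coord_int L (\<lambda>z. f j z * indicator {z. \<forall>i. \<bar>z $ i - c $ i\<bar> \<le> \<rho>} z) x
    \<le> ennreal (12 * \<rho>) ^ length L * fold strong_max L f j x"
  using L x
proof (induction L arbitrary: x rule: rev_induct)
  case Nil
  then show ?case by (simp add: indicator_def)
next
  case (snoc l L)
  let ?F = "\<lambda>z. f j z * indicator {z. \<forall>i. \<bar>z $ i - c $ i\<bar> \<le> \<rho>} z"
  have "fold coord_int (L @ [l]) ?F x = (\<integral>\<^sup>+s. fold coord_int L ?F (upd_coord x l s) \<partial>lborel)"
    by (simp add: coord_int_def[of l])
  also have "\<dots> \<le> (\<integral>\<^sup>+s. ennreal (12 * \<rho>) ^ length L
      * (fold strong_max L f j (upd_coord x l s) * indicator {s. \<bar>s - c $ l\<bar> \<le> \<rho>} s) \<partial>lborel)"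
  proof (rule nn_integral_mono)
    fix s
    show "fold coord_int L ?F (upd_coord x l s) \<le> ennreal (12 * \<rho>) ^ length L
      * (fold strong_max L f j (upd_coord x l s) * indicator {s. \<bar>s - c $ l\<bar> \<le> \<rho>} s)"
    proof (cases "\<bar>s - c $ l\<bar> \<le> \<rho>")
      case True
      then show ?thesis using snoc by (simp add: upd_coord_nth)
    next
      \<comment> \<open>Coordinate \<open>l\<close> is still a parameter of the inner integral;
        outside its interval the indicator of the cube vanishes identically.\<close>
      case False
      then have "fold coord_int L ?F (upd_coord x l s) = 0"
        using snoc.prems by (intro fold_coord_int_eq_0[of l]) (auto simp: indicator_def)
      then show ?thesis by simp
    qed
  qed
  also have "\<dots> \<le> ennreal (12 * \<rho>) ^ length L
      * (\<integral>\<^sup>+s. fold strong_max L f j (upd_coord x l s) * indicator {s. \<bar>s - c $ l\<bar> \<le> \<rho>} s \<partial>lborel)"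
  proof (rule eq_refl, rule nn_integral_cmult)
    have [measurable]: "(\<lambda>s. fold strong_max L f j (upd_coord x l s)) \<in> borel_measurable borel"
      by (rule measurable_compose[OF _ measurable_fold_strong_max[OF f]]) measurable
    show "(\<lambda>s. fold strong_max L f j (upd_coord x l s) * indicator {s. \<bar>s - c $ l\<bar> \<le> \<rho>} s) \<in> borel_measurable lborel"
      by measurable
  qed
  also have "\<dots> \<le> ennreal (12 * \<rho>) ^ length L * (ennreal (12 * \<rho>) * strong_max l (fold strong_max L f) j x)"
    using snoc.prems by (intro mult_left_mono interval_integral_le_strong_max \<rho>) auto
  finally show ?case by (simp add: mult_ac)
qed

definition ball_max :: "(real ^ 'n::finite \<Rightarrow> ennreal) \<Rightarrow> real ^ 'n \<Rightarrow> ennreal" where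
  "ball_max F x = (SUP (c, \<rho>)\<in>{(c, \<rho>). 0 < \<rho> \<and> x \<in> ball c \<rho>}.
     (\<integral>\<^sup>+y\<in>ball c \<rho>. F y \<partial>lborel) / emeasure lborel (ball c \<rho>))"

text \<open>A ball of radius \<open>\<rho>\<close> lies in the cube of half side
  \<open>\<rho>\<close> about its centre. The constant is the loss \<open>(12 * \<rho>) ^ n\<close>
  divided by the volume of the ball, with \<open>n\<close> the dimension.\<close>

theorem ball_max_le_fold_strong_max:
  fixes f :: "nat \<Rightarrow> real ^ 'n::finite \<Rightarrow> ennreal"
  assumes f: "\<And>j. f j \<in> borel_measurable borel" and L: "distinct L" "set L = UNIV"
  shows "ball_max (f j) x \<le> ennreal (12 ^ CARD('n) / unit_ball_vol (real CARD('n))) * fold strong_max L f j x"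
  unfolding ball_max_def
proof (intro SUP_least, clarify)
  fix c :: "real ^ 'n" and \<rho> :: real assume \<rho>: "0 < \<rho>" and x: "x \<in> ball c \<rho>"
  have len: "length L = CARD('n)" using L distinct_card by fastforce
  have comp: "\<bar>z $ i - c $ i\<bar> \<le> \<rho>" if "z \<in> ball c \<rho>" for z i
    using component_le_norm_cart[of "z - c" i] that by (simp add: dist_norm norm_minus_commute)
  let ?F = "\<lambda>z. f j z * indicator {z. \<forall>i. \<bar>z $ i - c $ i\<bar> \<le> \<rho>} z"
  have [measurable]: "(\<lambda>z. z $ i) \<in> borel_measurable (borel :: (real ^ 'n) measure)" for i
    unfolding cart_eq_inner_axis by measurable
  have [measurable]: "f j \<in> borel_measurable borel" by (rule f)
  have "(\<integral>\<^sup>+y\<in>ball c \<rho>. f j y \<partial>lborel) \<le> (\<integral>\<^sup>+z. ?F z \<partial>lborel)"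
    by (intro nn_integral_mono mult_left_mono) (auto simp: indicator_def comp)
  also have "\<dots> = fold coord_int L ?F x"
    by (rule fold_coord_int[symmetric, OF _ L]) measurable
  also have "\<dots> \<le> ennreal (12 * \<rho>) ^ length L * fold strong_max L f j x"
    by (rule fold_coord_int_le_fold_strong_max[OF f \<rho> L(1)]) (use comp[OF x] in simp)
  finally have "(\<integral>\<^sup>+y\<in>ball c \<rho>. f j y \<partial>lborel) / emeasure lborel (ball c \<rho>)
      \<le> ennreal (12 * \<rho>) ^ length L * fold strong_max L f j x / emeasure lborel (ball c \<rho>)"
    by (rule divide_right_mono_ennreal)
  also have "\<dots> = (ennreal (12 * \<rho>) ^ length L / emeasure lborel (ball c \<rho>)) * fold strong_max L f j x"
    by (simp add: divide_ennreal_def mult_ac)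
  also have "ennreal (12 * \<rho>) ^ length L / emeasure lborel (ball c \<rho>)
      = ennreal ((12 * \<rho>) ^ CARD('n) / (unit_ball_vol (real CARD('n)) * \<rho> ^ CARD('n)))"
    using \<rho> by (simp add: emeasure_ball len ennreal_power divide_ennreal)
  also have "(12 * \<rho>) ^ CARD('n) / (unit_ball_vol (real CARD('n)) * \<rho> ^ CARD('n)) = 12 ^ CARD('n) / unit_ball_vol (real CARD('n))"
    using \<rho> by (simp add: power_mult_distrib)
  finally show "(\<integral>\<^sup>+y\<in>ball c \<rho>. f j y \<partial>lborel) / emeasure lborel (ball c \<rho>)
      \<le> ennreal (12 ^ CARD('n) / unit_ball_vol (real CARD('n))) * fold strong_max L f j x" .
qed

theorem fefferman_stein:
  fixes q :: "real ^ 'n::finite" and u :: ennreal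
  assumes q: "\<And>i. 1 < q $ i" and u: "1 < u" and L: "distinct L" "set L = UNIV"
  shows "\<exists>C<top. \<forall>f x. (\<forall>j. f j \<in> borel_measurable borel) \<longrightarrow>
    seq_norm q u L (\<lambda>j. ball_max (f j)) x \<le> C * seq_norm q u L f x"
proof -
  define c where "c = ennreal (12 ^ CARD('n) / unit_ball_vol (real CARD('n)))"
  obtain C where C: "C < top" and bd: "\<And>f x. (\<forall>j. f j \<in> borel_measurable borel) \<Longrightarrow>
    seq_norm q u L (fold strong_max L f) x \<le> C * seq_norm q u L f x"
    using fold_strong_max_bounded[OF q u _ L(1), of L] by auto
  show ?thesis
  proof (intro exI[of _ "c * C"] conjI allI impI)
    fix f :: "nat \<Rightarrow> real ^ 'n \<Rightarrow> ennreal" and x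
    assume f: "\<forall>j. f j \<in> borel_measurable borel"
    have "seq_norm q u L (\<lambda>j. ball_max (f j)) x \<le> seq_norm q u L (\<lambda>j z. c * fold strong_max L f j z) x"
      unfolding c_def using f L by (intro seq_norm_mono[OF q u] ball_max_le_fold_strong_max) auto
    also have "\<dots> = c * seq_norm q u L (fold strong_max L f) x"
      using f by (intro seq_norm_cmult[OF q u] measurable_fold_strong_max) auto
    also have "\<dots> \<le> c * (C * seq_norm q u L f x)" by (intro mult_left_mono bd f) auto
    finally show "seq_norm q u L (\<lambda>j. ball_max (f j)) x \<le> c * C * seq_norm q u L f x"
      by (simp add: mult.assoc)
  qed (use C in \<open>simp add: ennreal_mult_less_top c_def\<close>)
qed

section \<open>Mixed norms of functions supported in a cube\<close>

text \<open>A scalar function is treated as a constant sequence, whose supremum is the function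
  itself. The results on \<open>seq_norm\<close> thereby cover scalar mixed norms.\<close>

lemma mixed_norm_eq_seq_norm: "mixed_norm q F = seq_norm q \<infinity> (sorted_list_of_set UNIV) (\<lambda>_. F) 0"
  by (simp add: mixed_norm_def seq_norm_def lq_norm_def)

lemma mixed_norm_lq_norm: "mixed_norm q (\<lambda>x. lq_norm u (\<lambda>j. F j x)) = seq_norm q u (sorted_list_of_set UNIV) F 0"
  by (simp add: mixed_norm_def seq_norm_def)

section \<open>Mixed norms do not see null sets\<close>

lemma one_less_top_ennreal: "(1::ennreal) < \<infinity>"
  by simp

text \<open>The translates of a null set along the \<open>i\<close>-th axis are null, so by Tonelli
  almost every line in that direction meets the set in a null set. Translation invariance replaces a
  splitting of the space into a product.\<close>

lemma AE_section:
  fixes P :: "real ^ 'n::finite \<Rightarrow> bool"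
  assumes "AE x in lborel. P x"
  shows "AE x in lborel. AE s in lborel. P (upd_coord x i s)"
proof -
  obtain N where N: "N \<in> null_sets lborel" "{x. \<not> P x} \<subseteq> N"
    using assms by (auto simp: eventually_ae_filter)
  then have [measurable]: "N \<in> sets borel" by auto
  let ?e = "axis i 1 :: real ^ 'n"
  have z: "(\<integral>\<^sup>+x. indicator N (x + s *\<^sub>R ?e) \<partial>lborel) = (0::ennreal)" for s
  proof -
    have "(\<integral>\<^sup>+x. indicator N (x + s *\<^sub>R ?e) \<partial>lborel)
        = (\<integral>\<^sup>+x. indicator N x \<partial>distr lborel borel (\<lambda>x. s *\<^sub>R ?e + x))"
      by (subst nn_integral_distr) (auto simp: add.commute)
    also have "distr lborel borel (\<lambda>x. s *\<^sub>R ?e + x) = lborel" by (rule lborel_distr_plus)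
    finally show ?thesis using N by (simp add: null_sets_def)
  qed
  have "(\<integral>\<^sup>+x. \<integral>\<^sup>+s. indicator N (x + s *\<^sub>R ?e) \<partial>lborel \<partial>lborel)
      = (\<integral>\<^sup>+s. \<integral>\<^sup>+x. indicator N (x + s *\<^sub>R ?e) \<partial>lborel \<partial>lborel)"
    by (intro lborel_pair.Fubini'[symmetric]) measurable
  also have "\<dots> = 0" by (simp add: z)
  finally have "AE x in lborel. (\<integral>\<^sup>+s. indicator N (x + s *\<^sub>R ?e) \<partial>lborel) = 0"
    by (subst (asm) nn_integral_0_iff_AE) auto
  then show ?thesis
  proof eventually_elim
    case (elim x)
    have "(\<integral>\<^sup>+s. indicator N (upd_coord x i s) \<partial>lborel) = (\<integral>\<^sup>+s. indicator N (x + (s - x $ i) *\<^sub>R ?e) \<partial>lborel)"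
      by (simp add: upd_coord_eq)
    also have "\<dots> = (\<integral>\<^sup>+s. indicator N (x + s *\<^sub>R ?e) \<partial>distr lborel borel (\<lambda>s. - (x $ i) + s))"
      by (subst nn_integral_distr) (auto simp: add.commute)
    also have "distr lborel borel (\<lambda>s. - (x $ i) + s) = lborel" by (rule lborel_distr_plus)
    finally have "(\<integral>\<^sup>+s. indicator N (upd_coord x i s) \<partial>lborel) = 0" using elim by simp
    then have "AE s in lborel. indicator N (upd_coord x i s) = (0::ennreal)"
      by (subst (asm) nn_integral_0_iff_AE) auto
    then show ?case
      by eventually_elim (use N(2) in \<open>auto simp: indicator_def split: if_splits\<close>)
  qed
qed

lemma fold_coord_norm_cong_AE:
  assumes "AE x in lborel. F x = G x"
  shows "AE x in lborel. fold (coord_norm q) L F x = fold (coord_norm q) L G x"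
proof (induction L rule: rev_induct)
  case (snoc l L)
  from AE_section[OF snoc, of l] show ?case
  proof eventually_elim
    case (elim x)
    then have "(\<integral>\<^sup>+s. epowr (fold (coord_norm q) L F (upd_coord x l s)) (q $ l) \<partial>lborel)
        = (\<integral>\<^sup>+s. epowr (fold (coord_norm q) L G (upd_coord x l s)) (q $ l) \<partial>lborel)"
      by (intro nn_integral_cong_AE) auto
    then show ?case by (simp add: coord_norm_lp[of _ l] lp_def)
  qed
qed (use assms in simp)

lemma fold_coord_norm_upd:
  "i \<in> set L \<Longrightarrow> fold (coord_norm q) L F (upd_coord x i s) = fold (coord_norm q) L F x"
proof (induction L arbitrary: x rule: rev_induct)
  case (snoc l L)
  show ?case
  proof (cases "i = l")
    case True
    then show ?thesis by (simp add: coord_norm_lp)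
  next
    case False
    then show ?thesis using snoc by (simp add: coord_norm_lp upd_coord_swap[of i l])
  qed
qed simp

lemma fold_coord_norm_const:
  fixes F :: "real ^ 'n::finite \<Rightarrow> ennreal"
  assumes "set L = UNIV"
  shows "fold (coord_norm q) L F x = fold (coord_norm q) L F y"
proof -
  have "fold (coord_norm q) L F (\<chi> i. if i \<in> I then x $ i else y $ i) = fold (coord_norm q) L F y" for I :: "'n set"
    using finite[of I]
  proof (induction I)
    case (insert a I)
    have "(\<chi> i. if i \<in> insert a I then x $ i else y $ i) = upd_coord (\<chi> i. if i \<in> I then x $ i else y $ i) a (x $ a)"
      by (auto simp: vec_eq_iff upd_coord_nth)
    then show ?case using insert fold_coord_norm_upd[of a L] assms by simp
  qed (simp add: vec_lambda_unique)
  from this[of UNIV] show ?thesis by (simp add: vec_lambda_unique)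
qed

lemma AE_lborel_const: "(AE x in (lborel :: (real ^ 'n::finite) measure). P) \<longleftrightarrow> P"
proof -
  have "emeasure (lborel :: (real ^ 'n) measure) UNIV \<noteq> 0" by simp
  then have "ae_filter (lborel :: (real ^ 'n) measure) \<noteq> bot" by (simp add: ae_filter_eq_bot_iff)
  then show ?thesis by (simp add: eventually_const_iff)
qed

text \<open>The iterated norms agree almost everywhere as functions. Once every coordinate has been
  integrated they are constant, so they agree at 0.\<close>

lemma mixed_norm_cong_AE:
  fixes F G :: "real ^ 'n::{finite,linorder} \<Rightarrow> ennreal"
  assumes "AE x in lborel. F x = G x"
  shows "mixed_norm q F = mixed_norm q G"
proof -
  let ?L = "sorted_list_of_set (UNIV :: 'n set)"
  have c: "fold (coord_norm q) ?L H x = fold (coord_norm q) ?L H 0" for H x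
    by (rule fold_coord_norm_const) simp
  have "AE x in (lborel :: (real ^ 'n::{finite,linorder}) measure). fold (coord_norm q) ?L F 0 = fold (coord_norm q) ?L G 0"
    using fold_coord_norm_cong_AE[OF assms, of q ?L]
  proof eventually_elim
    case (elim x)
    then show ?case using c[of F x] c[of G x] by (simp only:)
  qed
  then show ?thesis by (simp only: AE_lborel_const mixed_norm_def)
qed

section \<open>Hoelder's inequality on cubes\<close>

lemma seq_norm_eq_0:
  assumes q: "\<And>i. 0 < q $ i" and u: "0 < u"
  shows "(\<And>j z. z $ i = x $ i \<Longrightarrow> F j z = 0) \<Longrightarrow> i \<notin> set L \<Longrightarrow> seq_norm q u L F x = 0"
proof (induction L arbitrary: x rule: rev_induct)
  case Nil
  then have "lq_norm u (\<lambda>j. F j x) = lq_norm u (\<lambda>j. 0 * F j x)" by simp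
  also have "\<dots> = 0" using u by (subst lq_norm_cmult) auto
  finally show ?case by (simp add: seq_norm_Nil)
next
  case (snoc l L)
  have "seq_norm q u L F (upd_coord x l s) = 0" for s
    using snoc.prems by (intro snoc.IH) (auto simp: upd_coord_nth)
  then show ?case by (simp add: seq_norm_snoc lp_def)
qed

lemma integral_le_lp:
  assumes q: "1 \<le> q" and g [measurable]: "g \<in> borel_measurable M" and I [measurable]: "I \<in> sets M"
    and fin: "emeasure M I < top" and supp: "\<And>x. x \<in> space M \<Longrightarrow> x \<notin> I \<Longrightarrow> g x = 0"
  shows "(\<integral>\<^sup>+x. g x \<partial>M) \<le> epowr (emeasure M I) (1 - 1 / q) * lp q M g"
proof -
  have eq: "(\<integral>\<^sup>+x. g x * indicator I x \<partial>M) = (\<integral>\<^sup>+x. g x \<partial>M)"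
    "(\<integral>\<^sup>+x. epowr (g x) q * indicator I x \<partial>M) = (\<integral>\<^sup>+x. epowr (g x) q \<partial>M)"
    by (intro nn_integral_cong; use supp in \<open>auto simp: indicator_def\<close>)+
  have "epowr (\<integral>\<^sup>+x. g x \<partial>M) q \<le> epowr (emeasure M I) (q - 1) * (\<integral>\<^sup>+x. epowr (g x) q \<partial>M)"
    using jensen_weight[OF q g, of "indicator I"] fin by (simp add: eq)
  then have "(\<integral>\<^sup>+x. g x \<partial>M) \<le> epowr (epowr (emeasure M I) (q - 1) * (\<integral>\<^sup>+x. epowr (g x) q \<partial>M)) (1 / q)"
    using q by (subst (asm) epowr_le_iff) auto
  also have "\<dots> = epowr (emeasure M I) (1 - 1 / q) * lp q M g"
    using q by (simp add: epowr_mult epowr_epowr lp_def diff_divide_distrib)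
  finally show ?thesis .
qed

lemma measurable_fold_coord_int:
  fixes F :: "real ^ 'n::finite \<Rightarrow> ennreal"
  assumes F: "F \<in> borel_measurable borel"
  shows "fold coord_int L F \<in> borel_measurable borel"
proof (induction L rule: rev_induct)
  case (snoc l L)
  have "(\<lambda>w. fold coord_int L F (upd_coord (fst w) l (snd w))) \<in> borel_measurable (borel \<Otimes>\<^sub>M lborel)"
    by (rule measurable_compose[OF _ snoc]) measurable
  then have "(\<lambda>x. \<integral>\<^sup>+s. fold coord_int L F (upd_coord x l s) \<partial>lborel) \<in> borel_measurable borel"
    by measurable
  then show ?case by (simp add: coord_int_def[of l, abs_def])
qed (use F in simp)

definition half_open_box :: "real ^ 'n \<Rightarrow> real \<Rightarrow> (real ^ 'n) set" where
  "half_open_box a l = {z. \<forall>i. z $ i \<in> {a $ i ..< a $ i + l}}"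

text \<open>Hoelder's inequality in each coordinate, on an interval of length \<open>l\<close>. The
  factors do not depend on the other coordinates, so they come out of the remaining norms.\<close>

lemma fold_coord_int_le_seq_norm:
  fixes h :: "real ^ 'n::finite \<Rightarrow> ennreal"
  assumes q: "\<And>i. 1 < q $ i" and l: "0 \<le> l" and h: "h \<in> borel_measurable borel"
    and supp: "\<And>z. z \<notin> half_open_box a l \<Longrightarrow> h z = 0" and L: "distinct L"
  shows "fold coord_int L h x \<le> (\<Prod>i\<in>set L. epowr (ennreal l) (1 - 1 / q $ i)) * seq_norm q \<infinity> L (\<lambda>_. h) x"
  using L
proof (induction L arbitrary: x rule: rev_induct)
  case Nil
  then show ?case by (simp add: seq_norm_Nil lq_norm_def)
next
  case (snoc m L)
  let ?P = "\<Prod>i\<in>set L. epowr (ennreal l) (1 - 1 / q $ i)"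
  have [measurable]: "(\<lambda>s. fold coord_int L h (upd_coord x m s)) \<in> borel_measurable borel"
    by (rule measurable_compose[OF _ measurable_fold_coord_int[OF h]]) measurable
  have m2: "(\<lambda>s. seq_norm q \<infinity> L (\<lambda>_. h) (upd_coord x m s)) \<in> borel_measurable lborel"
    unfolding measurable_lborel1 by (rule measurable_compose[OF _ measurable_seq_norm[OF q one_less_top_ennreal h]]) measurable
  have qm: "0 < q $ m" "1 \<le> q $ m" using q[of m] by auto
  have "fold coord_int (L @ [m]) h x = (\<integral>\<^sup>+s. fold coord_int L h (upd_coord x m s) \<partial>lborel)"
    by (simp add: coord_int_def[of m])
  also have "\<dots> \<le> epowr (emeasure lborel {a $ m ..< a $ m + l}) (1 - 1 / q $ m)
      * lp (q $ m) lborel (\<lambda>s. fold coord_int L h (upd_coord x m s))"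
  proof (rule integral_le_lp[OF qm(2)])
    fix s assume "s \<notin> {a $ m..<a $ m + l}"
    then show "fold coord_int L h (upd_coord x m s) = 0"
      using snoc.prems by (intro fold_coord_int_eq_0[of m] supp) (auto simp: half_open_box_def)
  qed (use l in auto)
  also have "emeasure lborel {a $ m ..< a $ m + l} = ennreal l" using l by simp
  also have "epowr (ennreal l) (1 - 1 / q $ m) * lp (q $ m) lborel (\<lambda>s. fold coord_int L h (upd_coord x m s))
      \<le> epowr (ennreal l) (1 - 1 / q $ m) * lp (q $ m) lborel (\<lambda>s. ?P * seq_norm q \<infinity> L (\<lambda>_. h) (upd_coord x m s))"
    using snoc by (intro mult_left_mono lp_mono qm) auto
  also have "lp (q $ m) lborel (\<lambda>s. ?P * seq_norm q \<infinity> L (\<lambda>_. h) (upd_coord x m s))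
      = ?P * lp (q $ m) lborel (\<lambda>s. seq_norm q \<infinity> L (\<lambda>_. h) (upd_coord x m s))"
    by (rule lp_cmult[OF m2 qm(1)])
  finally show ?case using snoc.prems by (simp add: seq_norm_snoc mult.assoc)
qed

lemma seq_norm_bounded_supp_le:
  fixes h :: "real ^ 'n::finite \<Rightarrow> ennreal"
  assumes q: "\<And>i. 1 < q $ i" and l: "0 \<le> l" and le: "\<And>z. h z \<le> c"
    and supp: "\<And>z. z \<notin> half_open_box a l \<Longrightarrow> h z = 0" and L: "distinct L"
  shows "seq_norm q \<infinity> L (\<lambda>_. h) x \<le> (\<Prod>i\<in>set L. epowr (ennreal l) (1 / q $ i)) * c"
  using L
proof (induction L arbitrary: x rule: rev_induct)
  case Nil
  then show ?case by (simp add: seq_norm_Nil lq_norm_def le)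
next
  case (snoc m L)
  let ?P = "\<Prod>i\<in>set L. epowr (ennreal l) (1 / q $ i)"
  have qm: "0 < q $ m" "\<And>i. 0 < q $ i" using q by (auto intro: order.strict_trans[of 0 1])
  have "seq_norm q \<infinity> (L @ [m]) (\<lambda>_. h) x \<le> lp (q $ m) lborel (\<lambda>s. (?P * c) * indicator {a $ m ..< a $ m + l} s)"
    unfolding seq_norm_snoc
  proof (rule lp_mono[OF qm(1)])
    fix s
    show "seq_norm q \<infinity> L (\<lambda>_. h) (upd_coord x m s) \<le> (?P * c) * indicator {a $ m ..< a $ m + l} s"
    proof (cases "s \<in> {a $ m ..< a $ m + l}")
      case True
      then show ?thesis using snoc by simp
    next
      case False
      then have "seq_norm q \<infinity> L (\<lambda>_. h) (upd_coord x m s) = 0"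
        using snoc.prems by (intro seq_norm_eq_0[of q \<infinity> m] supp qm) (auto simp: half_open_box_def)
      then show ?thesis by simp
    qed
  qed
  also have "\<dots> = (?P * c) * lp (q $ m) lborel (indicator {a $ m ..< a $ m + l})"
    by (rule lp_cmult[OF _ qm(1)]) simp
  also have "lp (q $ m) lborel (indicator {a $ m ..< a $ m + l}) = epowr (ennreal l) (1 / q $ m)"
  proof -
    have "(\<integral>\<^sup>+s. epowr (indicator {a $ m ..< a $ m + l} s) (q $ m) \<partial>lborel)
        = (\<integral>\<^sup>+s. indicator {a $ m ..< a $ m + l} s \<partial>lborel)"
      by (intro nn_integral_cong) (auto simp: indicator_def)
    then show ?thesis using l by (simp add: lp_def)
  qed
  finally show ?case using snoc.prems by (simp add: mult_ac)
qed

lemma prod_epowr: "0 < l \<Longrightarrow> (\<Prod>i\<in>I. epowr (ennreal l) (f i)) = ennreal (l powr (\<Sum>i\<in>I. f i))"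
  by (simp add: epowr_ennreal prod_ennreal powr_sum)

lemma integral_le_mixed_norm:
  fixes h :: "real ^ 'n::{finite,linorder} \<Rightarrow> ennreal"
  assumes q: "\<And>i. 1 < q $ i" and l: "0 < l" and h: "h \<in> borel_measurable borel"
    and supp: "\<And>z. z \<notin> half_open_box a l \<Longrightarrow> h z = 0"
  shows "(\<integral>\<^sup>+x. h x \<partial>lborel) \<le> ennreal (l powr (\<Sum>i\<in>UNIV. 1 - 1 / q $ i)) * mixed_norm q h"
proof -
  let ?L = "sorted_list_of_set (UNIV :: 'n set)"
  have "(\<integral>\<^sup>+x. h x \<partial>lborel) = fold coord_int ?L h 0"
    by (rule fold_coord_int[symmetric, OF h]) auto
  also have "\<dots> \<le> (\<Prod>i\<in>set ?L. epowr (ennreal l) (1 - 1 / q $ i)) * seq_norm q \<infinity> ?L (\<lambda>_. h) 0"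
    using l by (intro fold_coord_int_le_seq_norm[OF q _ h supp]) auto
  finally show ?thesis using l by (simp add: mixed_norm_eq_seq_norm prod_epowr)
qed

lemma mixed_norm_bounded_supp_le:
  fixes h :: "real ^ 'n::{finite,linorder} \<Rightarrow> ennreal"
  assumes q: "\<And>i. 1 < q $ i" and l: "0 < l" and le: "\<And>z. h z \<le> c"
    and supp: "\<And>z. z \<notin> half_open_box a l \<Longrightarrow> h z = 0"
  shows "mixed_norm q h \<le> ennreal (l powr (\<Sum>i\<in>UNIV. 1 / q $ i)) * c"
proof -
  let ?L = "sorted_list_of_set (UNIV :: 'n set)"
  have "seq_norm q \<infinity> ?L (\<lambda>_. h) 0 \<le> (\<Prod>i\<in>set ?L. epowr (ennreal l) (1 / q $ i)) * c"
    using l by (intro seq_norm_bounded_supp_le[OF q _ le supp]) auto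
  then show ?thesis using l by (simp add: mixed_norm_eq_seq_norm prod_epowr)
qed

lemma emeasure_half_open_box:
  fixes a :: "real ^ 'n::finite"
  assumes l: "0 \<le> l"
  shows "half_open_box a l \<in> sets borel" "emeasure lborel (half_open_box a l) = ennreal (l ^ CARD('n))"
proof -
  interpret product_sigma_finite "\<lambda>_ :: 'n. lborel :: real measure" ..
  have [measurable]: "(\<lambda>z. z $ i) \<in> borel_measurable (borel :: (real ^ 'n) measure)" for i
    unfolding cart_eq_inner_axis by measurable
  have "{z \<in> space borel. \<forall>i\<in>UNIV. z $ i \<in> {a $ i ..< a $ i + l}} \<in> sets borel" by measurable
  then show s [measurable]: "half_open_box a l \<in> sets borel" by (simp add: half_open_box_def)
  have "emeasure lborel (half_open_box a l)
      = emeasure (\<Pi>\<^sub>M i\<in>UNIV. lborel) ((\<lambda>w. \<chi> i. w i) -` half_open_box a l \<inter> space (\<Pi>\<^sub>M i\<in>UNIV. (lborel :: real measure)))"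
    unfolding lborel_vec_eq_PiM by (rule emeasure_distr) auto
  also have "(\<lambda>w. \<chi> i. w i) -` half_open_box a l \<inter> space (\<Pi>\<^sub>M i\<in>UNIV. (lborel :: real measure))
      = (\<Pi>\<^sub>E i\<in>UNIV. {a $ i ..< a $ i + l})"
    by (auto simp: half_open_box_def space_PiM PiE_UNIV_domain Pi_iff)
  also have "emeasure (\<Pi>\<^sub>M i\<in>UNIV. lborel) (\<Pi>\<^sub>E i\<in>UNIV. {a $ i ..< a $ i + l}) = ennreal l ^ CARD('n)"
    using l by (subst emeasure_PiM) auto
  finally show "emeasure lborel (half_open_box a l) = ennreal (l ^ CARD('n))"
    using l by (simp add: ennreal_power)
qed

section \<open>Sums of functions supported in dyadic cubes\<close>

definition dyadic_index :: "int \<Rightarrow> real ^ 'n::finite \<Rightarrow> int ^ 'n" where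
  "dyadic_index j x = (\<chi> i. \<lfloor>2 powi j * x $ i\<rfloor>)"

text \<open>The result denotes the ancestor \<open>m\<close> generations up, translated by
  \<open>e\<close> in units of its own side.\<close>

definition shift_index :: "nat \<Rightarrow> int ^ 'n::finite \<Rightarrow> int \<times> (int ^ 'n) \<Rightarrow> int \<times> (int ^ 'n)" where
  "shift_index m e = (\<lambda>(j, k). (j - int m, \<chi> i. k $ i div 2 ^ m + e $ i))"

lemma mem_dyadic_cube_iff: "x \<in> dyadic_cube (j, k) \<longleftrightarrow> dyadic_index j x = k"
proof -
  have pos: "0 < (2 :: real) powi j" by simp
  have "2 powi (- j) * of_int (k $ i) \<le> x $ i \<and> x $ i < 2 powi (- j) * (of_int (k $ i) + 1)
      \<longleftrightarrow> \<lfloor>2 powi j * x $ i\<rfloor> = k $ i" for i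
    using pos by (auto simp: floor_eq_iff power_int_minus field_simps)
  then show ?thesis by (simp add: dyadic_cube_def dyadic_index_def vec_eq_iff)
qed

lemma dyadic_cube_eq_box:
  "dyadic_cube (j, k) = half_open_box (\<chi> i. 2 powi (- j) * of_int (k $ i)) (2 powi (- j))"
  by (auto simp: dyadic_cube_def half_open_box_def distrib_left)

lemma sets_dyadic_cube [measurable]: "dyadic_cube i \<in> sets borel"
  by (cases i) (simp add: dyadic_cube_eq_box emeasure_half_open_box)

lemma dyadic_index_coarsen:
  "dyadic_index (j - int m) x $ i = dyadic_index j x $ i div 2 ^ m"
proof -
  have "2 powi (j - int m) * x $ i = 2 powi j * x $ i / of_int (2 ^ m)"
    by (simp add: power_int_diff)
  then show ?thesis
    using floor_divide_real_eq_div[of "2 ^ m" "2 powi j * x $ i"] by (simp add: dyadic_index_def)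
qed

lemma mem_shifted_cube_iff:
  assumes "x \<in> dyadic_cube i"
  shows "y \<in> dyadic_cube (shift_index m e i) \<longleftrightarrow>
    (\<forall>l. dyadic_index (fst i - int m) y $ l = dyadic_index (fst i - int m) x $ l + e $ l)"
  using assms by (cases i)
    (auto simp: shift_index_def mem_dyadic_cube_iff vec_eq_iff dyadic_index_coarsen)

lemma mem_shifted_cube_0: "x \<in> dyadic_cube i \<Longrightarrow> x \<in> dyadic_cube (shift_index m 0 i)"
  by (simp add: mem_shifted_cube_iff)

lemma dyadic_cube_inj:
  assumes "x \<in> dyadic_cube i" "x \<in> dyadic_cube i'" "fst i = fst i'"
  shows "i = i'"
  using assms by (cases i; cases i') (auto simp: mem_dyadic_cube_iff)

text \<open>The cubes sent to \<open>i'\<close> are the descendants, \<open>m\<close> generations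
  down, of one translate of \<open>i'\<close>; each coordinate leaves \<open>2 ^ m\<close>
  choices.\<close>

lemma shift_index_fiber:
  "finite {i. shift_index m e i = (i' :: int \<times> (int ^ 'n::finite))}"
  "card {i. shift_index m e i = (i' :: int \<times> (int ^ 'n::finite))} \<le> (2 ^ m) ^ CARD('n)"
proof -
  obtain j' k' where i': "i' = (j', k')" by (cases i')
  define A where "A i = {2 ^ m * (k' $ i - e $ i) ..< 2 ^ m * (k' $ i - e $ i) + 2 ^ m}" for i
  define g where "g w = (j' + int m, \<chi> i. w i)" for w :: "'n \<Rightarrow> int"
  have sub: "{i. shift_index m e i = i'} \<subseteq> g ` (\<Pi>\<^sub>E i\<in>UNIV. A i)"
  proof
    fix x assume "x \<in> {i. shift_index m e i = i'}"
    then obtain j k where x: "x = (j, k)" "j - int m = j'" "\<And>i. k $ i div 2 ^ m + e $ i = k' $ i"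
      by (cases x) (auto simp: shift_index_def i' vec_eq_iff)
    have "k $ i \<in> A i" for i
    proof -
      have d: "k $ i div 2 ^ m = k' $ i - e $ i" using x(3)[of i] by simp
      have "k $ i = 2 ^ m * (k $ i div 2 ^ m) + k $ i mod 2 ^ m" by simp
      moreover have "0 \<le> k $ i mod 2 ^ m" "k $ i mod 2 ^ m < 2 ^ m" by simp_all
      ultimately show ?thesis unfolding A_def d[symmetric] atLeastLessThan_iff by linarith
    qed
    then show "x \<in> g ` (\<Pi>\<^sub>E i\<in>UNIV. A i)"
      using x by (intro image_eqI[of _ _ "\<lambda>i. k $ i"]) (auto simp: g_def PiE_UNIV_domain vec_eq_iff)
  qed
  have fin: "finite (\<Pi>\<^sub>E i\<in>UNIV. A i)" by (intro finite_PiE) (auto simp: A_def)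
  then show "finite {i. shift_index m e i = i'}" using sub by (meson finite_imageI finite_subset)
  have "card {i. shift_index m e i = i'} \<le> card (\<Pi>\<^sub>E i\<in>UNIV. A i)"
    using card_mono[OF finite_imageI[OF fin] sub] card_image_le[OF fin, of g] by simp
  also have "\<dots> = (2 ^ m) ^ CARD('n)"
    by (subst card_PiE) (auto simp: A_def nat_power_eq)
  finally show "card {i. shift_index m e i = i'} \<le> (2 ^ m) ^ CARD('n)" .
qed

section \<open>Regrouping sums over cubes\<close>

lemma lq_norm_upper:
  fixes c :: "'i::countable \<Rightarrow> ennreal"
  assumes "0 < \<rho>"
  shows "c k \<le> lq_norm (ennreal \<rho>) c"
proof -
  have "epowr (c k) \<rho> \<le> (\<integral>\<^sup>+i. epowr (c i) \<rho> \<partial>count_space UNIV)"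
    by (rule nn_integral_ge_point) simp
  then show ?thesis using assms by (simp add: lq_norm_ennreal lp_def epowr_le_iff)
qed

lemma lq_norm_ge_point:
  fixes c :: "'i::countable \<Rightarrow> ennreal"
  assumes u: "1 < u"
  shows "c k \<le> lq_norm u c"
proof (rule lq_norm_cases[OF u])
  assume "u = \<infinity>"
  then show ?thesis by (auto simp: lq_norm_def intro: SUP_upper)
next
  fix r assume "1 < r" "u = ennreal r"
  then show ?thesis using lq_norm_upper[of r c k] by simp
qed

lemma measurable_countable_sum [measurable]:
  fixes V :: "'i::countable \<Rightarrow> 'a \<Rightarrow> ennreal"
  assumes [measurable]: "\<And>i. V i \<in> borel_measurable M"
  shows "(\<lambda>x. \<integral>\<^sup>+i. V i x \<partial>count_space UNIV) \<in> borel_measurable M"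
proof -
  have "(\<lambda>w. V (snd w) (fst w)) \<in> borel_measurable (M \<Otimes>\<^sub>M count_space UNIV)"
    by (rule measurable_compose_countable'[where g = snd and I = UNIV and f = "\<lambda>i w. V i (fst w)"]) auto
  then show ?thesis
    by (intro sigma_finite_measure.borel_measurable_nn_integral[OF sigma_finite_measure_count_space])
      (simp add: case_prod_unfold)
qed

lemma swap_sums:
  fixes f :: "'i::countable \<Rightarrow> 'k::countable \<Rightarrow> ennreal"
  shows "(\<integral>\<^sup>+x. \<integral>\<^sup>+y. f x y \<partial>count_space UNIV \<partial>count_space UNIV)
    = (\<integral>\<^sup>+y. \<integral>\<^sup>+x. f x y \<partial>count_space UNIV \<partial>count_space UNIV)"
  by (rule nn_integral_count_space_nn_integral) auto

lemma sum_if_eq: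
  fixes z :: ennreal
  shows "(\<integral>\<^sup>+k. (if k0 = k then z else 0) \<partial>count_space UNIV) = z"
proof -
  have "(\<integral>\<^sup>+k. (if k0 = k then z else 0) \<partial>count_space UNIV) = (\<integral>\<^sup>+k. z * indicator {k0} k \<partial>count_space UNIV)"
    by (intro nn_integral_cong) (auto simp: indicator_def)
  then show ?thesis by simp
qed

text \<open>Hoelder's inequality on each fibre, which has at most \<open>N\<close> elements; summing
  over \<open>k\<close> then counts every \<open>i\<close> once.\<close>

lemma lq_norm_fiber_sum:
  fixes c :: "'i::countable \<Rightarrow> ennreal" and T :: "'i \<Rightarrow> 'k::countable"
  assumes \<rho>: "1 \<le> \<rho>" and fin: "\<And>k. finite {i. T i = k}" and card: "\<And>k. card {i. T i = k} \<le> N"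
  shows "lq_norm (ennreal \<rho>) (\<lambda>k. \<integral>\<^sup>+i. (if T i = k then c i else 0) \<partial>count_space UNIV)
    \<le> epowr (of_nat N) (1 - 1 / \<rho>) * lq_norm (ennreal \<rho>) c"
proof -
  let ?S = "\<lambda>k. \<integral>\<^sup>+i. (if T i = k then c i else 0) \<partial>count_space UNIV"
  have "epowr (?S k) \<rho> \<le> epowr (of_nat N) (\<rho> - 1) * (\<integral>\<^sup>+i. (if T i = k then epowr (c i) \<rho> else 0) \<partial>count_space UNIV)" for k
  proof -
    let ?w = "indicator {i. T i = k} :: 'i \<Rightarrow> ennreal"
    have W: "(\<integral>\<^sup>+i. ?w i \<partial>count_space UNIV) = of_nat (card {i. T i = k})"
      using fin by (simp add: emeasure_count_space)
    have "epowr (\<integral>\<^sup>+i. c i * ?w i \<partial>count_space UNIV) \<rho>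
        \<le> epowr (of_nat (card {i. T i = k})) (\<rho> - 1) * (\<integral>\<^sup>+i. epowr (c i) \<rho> * ?w i \<partial>count_space UNIV)"
      using jensen_weight[OF \<rho>, of c "count_space UNIV" ?w] by (simp add: W of_nat_less_top)
    also have "\<dots> \<le> epowr (of_nat N) (\<rho> - 1) * (\<integral>\<^sup>+i. epowr (c i) \<rho> * ?w i \<partial>count_space UNIV)"
      using \<rho> card by (intro mult_right_mono epowr_mono) auto
    also have "(\<integral>\<^sup>+i. c i * ?w i \<partial>count_space UNIV) = ?S k"
      by (intro nn_integral_cong) (auto simp: indicator_def)
    also have "(\<integral>\<^sup>+i. epowr (c i) \<rho> * ?w i \<partial>count_space UNIV) = (\<integral>\<^sup>+i. (if T i = k then epowr (c i) \<rho> else 0) \<partial>count_space UNIV)"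
      by (intro nn_integral_cong) (auto simp: indicator_def)
    finally show ?thesis .
  qed
  then have "(\<integral>\<^sup>+k. epowr (?S k) \<rho> \<partial>count_space UNIV)
      \<le> (\<integral>\<^sup>+k. epowr (of_nat N) (\<rho> - 1) * (\<integral>\<^sup>+i. (if T i = k then epowr (c i) \<rho> else 0) \<partial>count_space UNIV) \<partial>count_space UNIV)"
    by (intro nn_integral_mono)
  also have "\<dots> = epowr (of_nat N) (\<rho> - 1) * (\<integral>\<^sup>+k. (\<integral>\<^sup>+i. (if T i = k then epowr (c i) \<rho> else 0) \<partial>count_space UNIV) \<partial>count_space UNIV)"
    by (rule nn_integral_cmult) simp
  also have "(\<integral>\<^sup>+k. (\<integral>\<^sup>+i. (if T i = k then epowr (c i) \<rho> else 0) \<partial>count_space UNIV) \<partial>count_space UNIV)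
      = (\<integral>\<^sup>+i. (\<integral>\<^sup>+k. (if T i = k then epowr (c i) \<rho> else 0) \<partial>count_space UNIV) \<partial>count_space UNIV)"
    by (rule nn_integral_count_space_nn_integral) auto
  also have "\<dots> = (\<integral>\<^sup>+i. epowr (c i) \<rho> \<partial>count_space UNIV)"
    by (simp only: sum_if_eq)
  finally have "lq_norm (ennreal \<rho>) ?S \<le> epowr (epowr (of_nat N) (\<rho> - 1) * (\<integral>\<^sup>+i. epowr (c i) \<rho> \<partial>count_space UNIV)) (1 / \<rho>)"
    using \<rho> by (simp add: lq_norm_ennreal lp_def epowr_mono)
  also have "\<dots> = epowr (of_nat N) (1 - 1 / \<rho>) * lq_norm (ennreal \<rho>) c"
    using \<rho> by (simp add: lq_norm_ennreal lp_def epowr_mult epowr_epowr diff_divide_distrib)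
  finally show ?thesis .
qed

lemma geometric_sum_finite:
  assumes "0 < a"
  shows "(\<integral>\<^sup>+m. ennreal (2 powr (- (real m * a))) \<partial>count_space UNIV) < top"
proof -
  have eq: "2 powr (- (real m * a)) = (2 powr (- a)) ^ m" for m
    by (simp add: powr_realpow[symmetric] powr_powr mult.commute)
  have "summable (\<lambda>m. (2 powr (- a)) ^ m)"
    using assms by (intro summable_geometric) (simp add: powr_less_one)
  then have "(\<Sum>m. ennreal ((2 powr (- a)) ^ m)) \<noteq> top"
    by (intro ennreal_suminf_neq_top) auto
  then show ?thesis by (simp add: nn_integral_count_space_nat eq less_top)
qed

locale block_params =
  fixes p :: "real ^ 'n::{finite,linorder}" and t \<rho> :: real
  assumes p: "\<And>i. 1 < p $ i" and t: "0 < t" and \<rho>: "1 \<le> \<rho>" and \<rho>t: "1 - 1 / \<rho> < 1 / t"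
    and pt: "real CARD('n) / t < (\<Sum>i\<in>UNIV. 1 / p $ i) \<or> (\<rho> = 1 \<and> real CARD('n) / t \<le> (\<Sum>i\<in>UNIV. 1 / p $ i))"
begin

definition q where "q = (\<chi> i. conj_exp (p $ i))"
definition \<sigma> where "\<sigma> = (\<Sum>i\<in>UNIV. 1 / p $ i)"
definition n where "n = real CARD('n)"

lemma n_pos: "0 < n" by (simp add: n_def)

lemma q_gt: "1 < q $ i"
proof -
  have "0 < 1 - inverse (p $ i)" "1 - inverse (p $ i) < 1" using p[of i] by (auto simp: field_simps)
  then show ?thesis by (simp add: q_def conj_exp_def one_less_inverse)
qed

lemma q_inverse: "1 / q $ i = 1 - 1 / p $ i"
  by (simp add: q_def conj_exp_def inverse_eq_divide)

lemma sum_q: "(\<Sum>i\<in>UNIV. 1 / q $ i) = n - \<sigma>" "(\<Sum>i\<in>UNIV. 1 - 1 / q $ i) = \<sigma>"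
  by (simp_all add: q_inverse sum_subtractf \<sigma>_def n_def)

definition bb :: "int \<times> (int ^ 'n::{finite,linorder}) \<Rightarrow> ennreal" where
  "bb i = ennreal (2 powr (- of_int (fst i) * (n / t - \<sigma>)))"

lemma side_powr: "(2::real) powi (- j) = 2 powr (- of_int j)"
  by (simp add: powr_real_of_int' flip: of_int_minus)

lemma block_bound_eq: "block_bound p t (dyadic_cube i) = bb i"
proof -
  obtain j k where i: "i = (j, k)" by (cases i)
  have "emeasure lebesgue (dyadic_cube i) = ennreal ((2 powi (- j)) ^ CARD('n))"
    by (simp add: i dyadic_cube_eq_box emeasure_half_open_box)
  then have "measure lebesgue (dyadic_cube i) = (2 powi (- j)) ^ CARD('n)"
    by (simp add: measure_def)
  also have "\<dots> = 2 powr (- of_int j * n)"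
    by (simp add: side_powr powr_realpow[symmetric] powr_powr n_def)
  finally show ?thesis
    by (simp add: block_bound_def bb_def powr_powr i \<sigma>_def n_def algebra_simps)
qed

lemma integral_le_bb:
  assumes h: "h \<in> borel_measurable borel" and supp: "\<And>x. x \<notin> dyadic_cube (j, k) \<Longrightarrow> h x = 0"
  shows "(\<integral>\<^sup>+x. h x \<partial>lborel) \<le> ennreal (2 powr (- of_int j * \<sigma>)) * mixed_norm q h"
proof -
  have "(\<integral>\<^sup>+x. h x \<partial>lborel) \<le> ennreal ((2 powi (- j)) powr \<sigma>) * mixed_norm q h"
    using integral_le_mixed_norm[OF q_gt _ h, of "2 powi (- j)" "\<chi> i. 2 powi (- j) * of_int (k $ i)"] supp
    by (simp add: sum_q dyadic_cube_eq_box)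
  then show ?thesis by (simp add: side_powr powr_powr)
qed

lemma mixed_norm_const_le:
  assumes "\<And>x. h x \<le> c" and supp: "\<And>x. x \<notin> dyadic_cube (j, k) \<Longrightarrow> h x = 0"
  shows "mixed_norm q h \<le> ennreal (2 powr (- of_int j * (n - \<sigma>))) * c"
proof -
  have "mixed_norm q h \<le> ennreal ((2 powi (- j)) powr (n - \<sigma>)) * c"
    using mixed_norm_bounded_supp_le[OF q_gt _ assms(1), of "2 powi (- j)" "\<chi> i. 2 powi (- j) * of_int (k $ i)"] supp
    by (simp add: sum_q dyadic_cube_eq_box)
  then show ?thesis by (simp add: side_powr powr_powr)
qed

lemma mixed_norm_mono: "(\<And>x. f x \<le> g x) \<Longrightarrow> mixed_norm q f \<le> mixed_norm q g"
  unfolding mixed_norm_eq_seq_norm by (rule seq_norm_mono[OF q_gt one_less_top_ennreal])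

lemma mixed_norm_cmult: "f \<in> borel_measurable borel \<Longrightarrow> mixed_norm q (\<lambda>x. c * f x) = c * mixed_norm q f"
  unfolding mixed_norm_eq_seq_norm by (rule seq_norm_cmult[OF q_gt one_less_top_ennreal])

lemma mixed_norm_countable_sum:
  fixes f :: "'i::countable \<Rightarrow> real ^ 'n::{finite,linorder} \<Rightarrow> ennreal"
  assumes "\<And>i. f i \<in> borel_measurable borel"
  shows "mixed_norm q (\<lambda>x. \<integral>\<^sup>+i. f i x \<partial>count_space UNIV) \<le> (\<integral>\<^sup>+i. mixed_norm q (f i) \<partial>count_space UNIV)"
  unfolding mixed_norm_eq_seq_norm
proof (rule minkowski_seq_norm[OF q_gt one_less_top_ennreal sigma_finite_measure_count_space])
  show "(\<lambda>w. f (fst w) (snd w)) \<in> borel_measurable (count_space UNIV \<Otimes>\<^sub>M borel)"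
    using assms by (intro measurable_pair_measure_countable1) auto
qed

lemma lq_norm_shift_sum:
  "lq_norm (ennreal \<rho>) (\<lambda>k. \<integral>\<^sup>+i. (if shift_index m e i = k then c i else 0) \<partial>count_space UNIV)
    \<le> ennreal (2 powr (real m * n * (1 - 1 / \<rho>))) * lq_norm (ennreal \<rho>) (c :: int \<times> (int ^ 'n::{finite,linorder}) \<Rightarrow> ennreal)"
proof -
  have "(of_nat ((2 ^ m) ^ CARD('n)) :: ennreal) = ennreal (2 powr (real m * n))"
    by (simp add: ennreal_of_nat_eq_real_of_nat powr_realpow[symmetric] powr_powr n_def)
  then have "epowr (of_nat ((2 ^ m) ^ CARD('n))) (1 - 1 / \<rho>) = ennreal (2 powr (real m * n * (1 - 1 / \<rho>)))"
    by (simp add: epowr_ennreal powr_powr)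
  then show ?thesis
    using lq_norm_fiber_sum[OF \<rho> shift_index_fiber, of m e c] by simp
qed

text \<open>A block decomposition in absolute values: \<open>V i\<close> corresponds to the modulus
  of \<open>\<lambda>_i b_i\<close> and \<open>c i\<close> to that of \<open>\<lambda>_i\<close>.
  Keeping the product avoids dividing by vanishing coefficients until a representation has to be
  produced.\<close>

definition dominated_pieces ::
    "(int \<times> (int ^ 'n::{finite,linorder}) \<Rightarrow> real ^ 'n::{finite,linorder} \<Rightarrow> ennreal) \<Rightarrow> (int \<times> (int ^ 'n::{finite,linorder}) \<Rightarrow> ennreal) \<Rightarrow> bool" where
  "dominated_pieces V c \<longleftrightarrow> (\<forall>i. V i \<in> borel_measurable borel) \<and> (\<forall>i x. x \<notin> dyadic_cube i \<longrightarrow> V i x = 0) \<and>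
     (\<forall>i. mixed_norm q (V i) \<le> c i * bb i) \<and> lq_norm (ennreal \<rho>) c < top"

lemma dominated_piecesD:
  assumes "dominated_pieces V c"
  shows "V i \<in> borel_measurable borel" "x \<notin> dyadic_cube i \<Longrightarrow> V i x = 0"
    "mixed_norm q (V i) \<le> c i * bb i" "lq_norm (ennreal \<rho>) c < top"
  using assms unfolding dominated_pieces_def by blast+

text \<open>Dyadic cubes that meet are nested. If \<open>i\<close> is smaller than the unit cube
  \<open>R\<close>, Hoelder on \<open>i\<close> gives the factor \<open>2 powr (- m n / t)\<close>;
  if it is larger, Hoelder on \<open>R\<close> leaves \<open>bb i\<close>. The conditions in the
  sums over \<open>m\<close> select the level of \<open>i\<close> relative to
  \<open>R\<close>.\<close>

lemma integral_piece_le: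
  assumes V: "dominated_pieces V c" and R: "R = (0, k0)"
  shows "(\<integral>\<^sup>+x. V i x * indicator (dyadic_cube R) x \<partial>lborel)
    \<le> (\<integral>\<^sup>+m. ennreal (2 powr (- (real m * (n / t)))) * (if shift_index m 0 i = R then c i else 0) \<partial>count_space UNIV)
    + (\<integral>\<^sup>+m. ennreal (2 powr (- (real m * (\<sigma> - n / t)))) * (if shift_index m 0 R = i then c i else 0) \<partial>count_space UNIV)"
    (is "?I \<le> ?A + ?B")
proof (cases "\<exists>x. x \<in> dyadic_cube R \<and> x \<in> dyadic_cube i")
  case False
  then have "V i x * indicator (dyadic_cube R) x = 0" for x
    using dominated_piecesD(2)[OF V, of x i] by (auto simp: indicator_def)
  then have "?I = (\<integral>\<^sup>+x. 0 \<partial>(lborel :: (real ^ 'n::{finite,linorder}) measure))"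
    by (intro nn_integral_cong)
  then show ?thesis by simp
next
  case True
  then obtain x where x: "x \<in> dyadic_cube R" "x \<in> dyadic_cube i" by auto
  obtain j k where i: "i = (j, k)" by (cases i)
  have Vi [measurable]: "V i \<in> borel_measurable borel" and mi: "mixed_norm q (V i) \<le> c i * bb i"
    using dominated_piecesD[OF V] by blast+
  show ?thesis
  proof (cases "0 \<le> j")
    case True
    define m where "m = nat j"
    have "shift_index m 0 i = R"
      using mem_shifted_cube_0[OF x(2), of m] x(1) True
      by (intro dyadic_cube_inj[of x]) (auto simp: i R m_def shift_index_def)
    then have "ennreal (2 powr (- (real m * (n / t)))) * c i \<le> ?A"
      using nn_integral_ge_point[of m UNIV "\<lambda>m. ennreal (2 powr (- (real m * (n / t)))) * (if shift_index m 0 i = R then c i else 0)"]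
      by simp
    moreover have "?I \<le> ennreal (2 powr (- (real m * (n / t)))) * c i"
    proof -
      have "?I \<le> (\<integral>\<^sup>+x. V i x \<partial>lborel)" by (intro nn_integral_mono) (auto simp: indicator_def)
      also have "\<dots> \<le> ennreal (2 powr (- of_int j * \<sigma>)) * mixed_norm q (V i)"
        using dominated_piecesD[OF V] by (intro integral_le_bb[of _ j k]) (auto simp: i)
      also have "\<dots> \<le> ennreal (2 powr (- of_int j * \<sigma>)) * (c i * bb i)"
        by (intro mult_left_mono mi) auto
      also have "\<dots> = (ennreal (2 powr (- of_int j * \<sigma>)) * bb i) * c i" by (simp only: mult_ac)
      also have "ennreal (2 powr (- of_int j * \<sigma>)) * bb i = ennreal (2 powr (- (real m * (n / t))))"
        using True by (simp add: bb_def i m_def ennreal_mult[symmetric] powr_add[symmetric] algebra_simps)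
      finally show ?thesis .
    qed
    ultimately show ?thesis by (meson add_increasing2 order_trans zero_le)
  next
    case False
    define m where "m = nat (- j)"
    have "shift_index m 0 R = i"
      using mem_shifted_cube_0[OF x(1), of m] x(2) False
      by (intro dyadic_cube_inj[of x]) (auto simp: i R m_def shift_index_def)
    then have "ennreal (2 powr (- (real m * (\<sigma> - n / t)))) * c i \<le> ?B"
      using nn_integral_ge_point[of m UNIV "\<lambda>m. ennreal (2 powr (- (real m * (\<sigma> - n / t)))) * (if shift_index m 0 R = i then c i else 0)"]
      by simp
    moreover have "?I \<le> ennreal (2 powr (- (real m * (\<sigma> - n / t)))) * c i"
    proof -
      have "?I \<le> ennreal (2 powr (- of_int 0 * \<sigma>)) * mixed_norm q (\<lambda>x. V i x * indicator (dyadic_cube R) x)"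
        by (intro integral_le_bb[of _ 0 k0]) (auto simp: R)
      also have "\<dots> \<le> mixed_norm q (V i)"
        by (simp, intro mixed_norm_mono) (auto simp: indicator_def)
      also have "\<dots> \<le> c i * bb i" by (rule mi)
      also have "bb i = ennreal (2 powr (- (real m * (\<sigma> - n / t))))"
        using False by (simp add: bb_def i m_def algebra_simps)
      finally show ?thesis by (simp add: mult.commute)
    qed
    ultimately show ?thesis by (meson add_increasing order_trans zero_le)
  qed
qed

text \<open>The sum of the pieces is integrable over every unit cube, and these cubes cover the
  space. At level \<open>m\<close>, the small cubes inside \<open>R\<close> lose
  \<open>2 powr (m n / r)\<close> by Hoelder and gain \<open>2 powr (- m n / t)\<close>.\<close>

lemma dominated_pieces_AE_finite:
  assumes V: "dominated_pieces V c"
  shows "AE x in lborel. (\<integral>\<^sup>+i. V i x \<partial>count_space UNIV) < top"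
proof -
  have Vm [measurable]: "V i \<in> borel_measurable borel" for i by (rule dominated_piecesD[OF V])
  have cfin: "lq_norm (ennreal \<rho>) c < top" by (rule dominated_piecesD[OF V])
  have "(\<integral>\<^sup>+x. (\<integral>\<^sup>+i. V i x \<partial>count_space UNIV) * indicator (dyadic_cube (0, k0)) x \<partial>lborel) < top" for k0
  proof -
    define R where "R = (0 :: int, k0)"
    define A where "A m i = ennreal (2 powr (- (real m * (n / t)))) * (if shift_index m 0 i = R then c i else 0)" for m i
    define B where "B m i = ennreal (2 powr (- (real m * (\<sigma> - n / t)))) * (if shift_index m 0 R = i then c i else 0)" for m i
    have "(\<integral>\<^sup>+x. (\<integral>\<^sup>+i. V i x \<partial>count_space UNIV) * indicator (dyadic_cube R) x \<partial>lborel)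
        = (\<integral>\<^sup>+x. (\<integral>\<^sup>+i. V i x * indicator (dyadic_cube R) x \<partial>count_space UNIV) \<partial>lborel)"
      by (simp add: nn_integral_multc)
    also have "\<dots> = (\<integral>\<^sup>+i. (\<integral>\<^sup>+x. V i x * indicator (dyadic_cube R) x \<partial>lborel) \<partial>count_space UNIV)"
      by (rule nn_integral_count_space_nn_integral) auto
    also have "\<dots> \<le> (\<integral>\<^sup>+i. (\<integral>\<^sup>+m. A m i \<partial>count_space UNIV) + (\<integral>\<^sup>+m. B m i \<partial>count_space UNIV) \<partial>count_space UNIV)"
      unfolding A_def B_def by (intro nn_integral_mono integral_piece_le[OF V R_def])
    also have "\<dots> = (\<integral>\<^sup>+i. (\<integral>\<^sup>+m. A m i \<partial>count_space UNIV) \<partial>count_space UNIV)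
        + (\<integral>\<^sup>+i. (\<integral>\<^sup>+m. B m i \<partial>count_space UNIV) \<partial>count_space UNIV)"
      by (rule nn_integral_add) auto
    also have "\<dots> < top"
    proof -
      have "(\<integral>\<^sup>+i. (\<integral>\<^sup>+m. A m i \<partial>count_space UNIV) \<partial>count_space UNIV)
          = (\<integral>\<^sup>+m. (\<integral>\<^sup>+i. A m i \<partial>count_space UNIV) \<partial>count_space UNIV)"
        by (rule nn_integral_count_space_nn_integral) auto
      also have "\<dots> \<le> (\<integral>\<^sup>+m. ennreal (2 powr (- (real m * (n * (1 / t - (1 - 1 / \<rho>)))))) * lq_norm (ennreal \<rho>) c \<partial>count_space UNIV)"
      proof (intro nn_integral_mono)
        fix m :: nat
        let ?S = "\<lambda>R. \<integral>\<^sup>+i. (if shift_index m 0 i = R then c i else 0) \<partial>count_space UNIV"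
        have "(\<integral>\<^sup>+i. A m i \<partial>count_space UNIV) = ennreal (2 powr (- (real m * (n / t)))) * ?S R"
          unfolding A_def by (rule nn_integral_cmult) simp
        also have "?S R \<le> lq_norm (ennreal \<rho>) ?S" using \<rho> by (intro lq_norm_upper) auto
        also have "\<dots> \<le> ennreal (2 powr (real m * n * (1 - 1 / \<rho>))) * lq_norm (ennreal \<rho>) c"
          by (rule lq_norm_shift_sum)
        finally have "(\<integral>\<^sup>+i. A m i \<partial>count_space UNIV) \<le> ennreal (2 powr (- (real m * (n / t))))
            * (ennreal (2 powr (real m * n * (1 - 1 / \<rho>))) * lq_norm (ennreal \<rho>) c)"
          by (simp add: mult_left_mono)
        also have "\<dots> = ennreal (2 powr (- (real m * (n / t))) * 2 powr (real m * n * (1 - 1 / \<rho>))) * lq_norm (ennreal \<rho>) c"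
          by (simp add: ennreal_mult mult.assoc)
        also have "2 powr (- (real m * (n / t))) * 2 powr (real m * n * (1 - 1 / \<rho>)) = 2 powr (- (real m * (n * (1 / t - (1 - 1 / \<rho>)))))"
          by (simp add: powr_add[symmetric] algebra_simps)
        finally show "(\<integral>\<^sup>+i. A m i \<partial>count_space UNIV)
            \<le> ennreal (2 powr (- (real m * (n * (1 / t - (1 - 1 / \<rho>)))))) * lq_norm (ennreal \<rho>) c" .
      qed
      also have "\<dots> = (\<integral>\<^sup>+m. ennreal (2 powr (- (real m * (n * (1 / t - (1 - 1 / \<rho>)))))) \<partial>count_space UNIV) * lq_norm (ennreal \<rho>) c"
        by (rule nn_integral_multc) simp
      also have "\<dots> < top"
        using \<rho>t n_pos cfin by (intro ennreal_mult_less_top[THEN iffD2] disjI2 conjI geometric_sum_finite) auto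
      finally have Afin: "(\<integral>\<^sup>+i. (\<integral>\<^sup>+m. A m i \<partial>count_space UNIV) \<partial>count_space UNIV) < top" .
      \<comment> \<open>There is only one cube per level that contains \<open>R\<close>, so no
        counting loss arises from the large cubes.\<close>
      have Bfin: "(\<integral>\<^sup>+i. (\<integral>\<^sup>+m. B m i \<partial>count_space UNIV) \<partial>count_space UNIV) < top"
      proof (cases "n / t < \<sigma>")
        case True
        have "(\<integral>\<^sup>+i. (\<integral>\<^sup>+m. B m i \<partial>count_space UNIV) \<partial>count_space UNIV)
            = (\<integral>\<^sup>+m. (\<integral>\<^sup>+i. B m i \<partial>count_space UNIV) \<partial>count_space UNIV)"
          by (rule nn_integral_count_space_nn_integral) auto
        also have "\<dots> \<le> (\<integral>\<^sup>+m. ennreal (2 powr (- (real m * (\<sigma> - n / t)))) * lq_norm (ennreal \<rho>) c \<partial>count_space UNIV)"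
        proof (intro nn_integral_mono)
          fix m :: nat
          have "(\<integral>\<^sup>+i. B m i \<partial>count_space UNIV)
              = (\<integral>\<^sup>+i. ennreal (2 powr (- (real m * (\<sigma> - n / t)))) * c (shift_index m 0 R) * indicator {shift_index m 0 R} i \<partial>count_space UNIV)"
            by (intro nn_integral_cong) (auto simp: B_def indicator_def)
          also have "\<dots> = ennreal (2 powr (- (real m * (\<sigma> - n / t)))) * c (shift_index m 0 R)" by simp
          also have "\<dots> \<le> ennreal (2 powr (- (real m * (\<sigma> - n / t)))) * lq_norm (ennreal \<rho>) c"
            using \<rho> by (intro mult_left_mono lq_norm_upper) auto
          finally show "(\<integral>\<^sup>+i. B m i \<partial>count_space UNIV) \<le> ennreal (2 powr (- (real m * (\<sigma> - n / t)))) * lq_norm (ennreal \<rho>) c" .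
        qed
        also have "\<dots> = (\<integral>\<^sup>+m. ennreal (2 powr (- (real m * (\<sigma> - n / t)))) \<partial>count_space UNIV) * lq_norm (ennreal \<rho>) c"
          by (rule nn_integral_multc) simp
        also have "\<dots> < top"
          using True cfin by (intro ennreal_mult_less_top[THEN iffD2] disjI2 conjI geometric_sum_finite) auto
        finally show ?thesis .
      next
        \<comment> \<open>At the endpoint the large cubes have no guaranteed decay, but now the
          coefficients are summable and each cube has only one level.\<close>
        case False
        then have \<rho>1: "\<rho> = 1" and le: "0 \<le> \<sigma> - n / t" using pt by (auto simp: \<sigma>_def n_def)
        have "(\<integral>\<^sup>+i. (\<integral>\<^sup>+m. B m i \<partial>count_space UNIV) \<partial>count_space UNIV) \<le> (\<integral>\<^sup>+i. c i \<partial>count_space UNIV)"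
        proof (intro nn_integral_mono)
          fix i :: "int \<times> (int ^ 'n::{finite,linorder})"
          have "(\<integral>\<^sup>+m. B m i \<partial>count_space UNIV) \<le> (\<integral>\<^sup>+m. c i * indicator {nat (- fst i)} m \<partial>count_space UNIV)"
          proof (intro nn_integral_mono)
            fix m :: nat
            have "2 powr (- (real m * (\<sigma> - n / t))) \<le> 1"
              using le powr_mono[of "- (real m * (\<sigma> - n / t))" 0 2] by simp
            then have "ennreal (2 powr (- (real m * (\<sigma> - n / t)))) * c i \<le> 1 * c i"
              by (intro mult_right_mono) auto
            moreover have "m = nat (- fst i)" if "shift_index m 0 R = i"
              using that by (auto simp: shift_index_def R_def)
            ultimately show "B m i \<le> c i * indicator {nat (- fst i)} m"
              by (auto simp: B_def indicator_def)
          qed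
          also have "\<dots> = c i" by simp
          finally show "(\<integral>\<^sup>+m. B m i \<partial>count_space UNIV) \<le> c i" .
        qed
        also have "\<dots> = lq_norm (ennreal \<rho>) c" by (simp add: \<rho>1 lq_norm_ennreal lp_def del: ennreal_1)
        finally show ?thesis using cfin by simp
      qed
      show ?thesis using Afin Bfin by simp
    qed
    finally show ?thesis by (simp add: R_def)
  qed
  then have "AE x in lborel. (\<integral>\<^sup>+i. V i x \<partial>count_space UNIV) * indicator (dyadic_cube (0, k0)) x \<noteq> top" for k0
    by (intro nn_integral_PInf_AE[simplified]) (auto simp: less_top)
  then have "AE x in lborel. \<forall>k0. (\<integral>\<^sup>+i. V i x \<partial>count_space UNIV) * indicator (dyadic_cube (0, k0)) x \<noteq> top"
    by (subst AE_all_countable) auto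
  then show ?thesis
  proof eventually_elim
    case (elim x)
    then have "(\<integral>\<^sup>+i. V i x \<partial>count_space UNIV) * indicator (dyadic_cube (0, dyadic_index 0 x)) x \<noteq> top"
      by blast
    moreover have "x \<in> dyadic_cube (0, dyadic_index 0 x)" by (simp add: mem_dyadic_cube_iff)
    ultimately show ?case by (simp add: less_top)
  qed
qed

end

section \<open>From nonnegative pieces to block representations\<close>

lemma has_sum_enn2real:
  fixes f :: "'i::countable \<Rightarrow> ennreal"
  assumes s: "(\<integral>\<^sup>+i. f i \<partial>count_space UNIV) = s" "s < top"
  shows "((\<lambda>i. complex_of_real (enn2real (f i))) has_sum complex_of_real (enn2real s)) UNIV"
proof -
  have fi: "f i < top" for i
    using nn_integral_ge_point[of i UNIV f] s by (simp add: le_less_trans)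
  have sum_eq: "ennreal (\<Sum>i\<in>F. enn2real (f i)) = sum f F" for F
    by (subst sum_ennreal[symmetric]) (auto simp: fi)
  have sup: "infsum f UNIV = (SUP F\<in>Collect finite. sum f F)"
    using nonneg_infsum_complete[of UNIV f] by simp
  have le: "sum f F \<le> s" if "finite F" for F
    using that unfolding s(1)[symmetric] infsum_ennreal_eq_nn_integral[symmetric] sup by (intro SUP_upper) simp
  have summ: "(\<lambda>i. enn2real (f i)) summable_on UNIV"
  proof (rule nonneg_bdd_above_summable_on)
    show "bdd_above (sum (\<lambda>i. enn2real (f i)) ` {F. F \<subseteq> UNIV \<and> finite F})"
    proof (rule bdd_aboveI2)
      fix F :: "'i set" assume F: "F \<in> {F. F \<subseteq> UNIV \<and> finite F}"
      have "ennreal (\<Sum>i\<in>F. enn2real (f i)) \<le> ennreal (enn2real s)"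
        using le F s(2) by (simp add: sum_eq)
      then show "(\<Sum>i\<in>F. enn2real (f i)) \<le> enn2real s" by (simp add: ennreal_le_iff)
    qed
  qed auto
  have "ennreal (infsum (\<lambda>i. enn2real (f i)) UNIV) = (SUP F\<in>{F. finite F \<and> F \<subseteq> UNIV}. ennreal (\<Sum>i\<in>F. enn2real (f i)))"
    by (rule infsum_nonneg_is_SUPREMUM_ennreal[OF summ]) simp
  also have "\<dots> = infsum f UNIV" by (simp only: sum_eq sup subset_UNIV simp_thms)
  also have "\<dots> = s" by (simp add: infsum_ennreal_eq_nn_integral s)
  finally have "infsum (\<lambda>i. enn2real (f i)) UNIV = enn2real s"
    by (metis enn2real_ennreal infsum_nonneg enn2real_nonneg)
  then have "((\<lambda>i. enn2real (f i)) has_sum enn2real s) UNIV"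
    using summ by (metis has_sum_infsum)
  then show ?thesis by (rule has_sum_of_real)
qed

context block_params
begin

lemma mixed_norm_0: "mixed_norm q (\<lambda>_. 0) = 0"
  using mixed_norm_cmult[of "\<lambda>_. 0" 0] by simp

text \<open>The block space has the lattice property: multiplying the pieces by the ratio of
  \<open>T\<close> to their sum, which is at most 1, represents \<open>T\<close> with the same
  coefficients.\<close>

theorem block_norm_ext_le:
  assumes V: "dominated_pieces V c" and r: "conj_exp r = ennreal \<rho>"
    and T [measurable]: "T \<in> borel_measurable borel"
    and TV: "AE x in lborel. T x \<le> (\<integral>\<^sup>+i. V i x \<partial>count_space UNIV)"
  shows "block_norm_ext p t r T \<le> lq_norm (ennreal \<rho>) c"
proof -
  note Vm [measurable] = dominated_piecesD(1)[OF V]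
  define S where "S x = (\<integral>\<^sup>+i. V i x \<partial>count_space UNIV)" for x
  have [measurable]: "S \<in> borel_measurable borel" unfolding S_def by measurable
  have Sfin: "AE x in lborel. S x < top" unfolding S_def by (rule dominated_pieces_AE_finite[OF V])
  have cfin: "c i < top" for i
    using lq_norm_upper[of \<rho> c i] \<rho> dominated_piecesD(4)[OF V] by (simp add: le_less_trans)
  have Tfin: "AE x in lebesgue. T x < \<infinity>"
    using AE_completion[OF AE_conjI[OF TV Sfin[unfolded S_def]]] by eventually_elim (auto intro: le_less_trans)
  \<comment> \<open>The minimum keeps the ratio at most 1 also on the null set where
    \<open>T\<close> may exceed \<open>S\<close>, so the block bound needs no exceptional points. A
    piece with coefficient 0 is replaced by the zero block.\<close>
  define W where "W i x = (if c i = 0 \<or> S x = 0 \<or> S x = top then 0 else min (T x) (S x) / S x * (V i x / c i))" for i x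
  have [measurable]: "W i \<in> borel_measurable borel" for i unfolding W_def by measurable
  define b where "b i x = complex_of_real (enn2real (W i x))" for i x
  define lam where "lam i = complex_of_real (enn2real (c i))" for i
  have lam: "ennreal (cmod (lam i)) = c i" for i using cfin by (simp add: lam_def)
  have W_le: "W i x \<le> inverse (c i) * V i x" for i x
  proof (cases "c i = 0 \<or> S x = 0 \<or> S x = top")
    case False
    then have "min (T x) (S x) / S x \<le> S x / S x" by (intro divide_right_mono_ennreal) auto
    also have "S x / S x = 1" using False by (simp add: divide_eq_1_ennreal)
    finally have "min (T x) (S x) / S x * (V i x / c i) \<le> 1 * (V i x / c i)" by (rule mult_right_mono) simp
    then show ?thesis using False by (simp add: W_def divide_ennreal_def mult.commute)
  qed (auto simp: W_def)
  have block: "is_block p t (dyadic_cube i) (b i)" for i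
    unfolding is_block_def
  proof (intro conjI allI impI)
    have "b i \<in> borel_measurable lborel" unfolding b_def by measurable
    then show "b i \<in> borel_measurable lebesgue" by (rule measurable_completion)
    fix x assume "x \<notin> dyadic_cube i"
    then show "b i x = 0" using dominated_piecesD(2)[OF V] by (simp add: b_def W_def)
  next
    have "mixed_norm q (\<lambda>x. ennreal (cmod (b i x))) \<le> mixed_norm q (W i)"
      by (rule mixed_norm_mono) (auto simp: b_def ennreal_enn2real_if)
    also have "\<dots> \<le> bb i"
    proof (cases "c i = 0")
      case True
      then have "W i = (\<lambda>_. 0)" by (auto simp: W_def)
      then show ?thesis by (simp add: mixed_norm_0)
    next
      case False
      have "mixed_norm q (W i) \<le> mixed_norm q (\<lambda>x. inverse (c i) * V i x)"
        by (rule mixed_norm_mono) (rule W_le)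
      also have "\<dots> = inverse (c i) * mixed_norm q (V i)" by (rule mixed_norm_cmult) simp
      also have "\<dots> \<le> inverse (c i) * (c i * bb i)" by (intro mult_left_mono dominated_piecesD[OF V]) auto
      also have "\<dots> = (c i / c i) * bb i" by (simp only: divide_ennreal_def mult_ac)
      also have "c i / c i = 1" using False cfin[of i] by (simp add: divide_eq_1_ennreal less_top)
      finally show ?thesis by simp
    qed
    finally show "mixed_norm (\<chi> i. conj_exp (p $ i)) (\<lambda>x. ennreal (cmod (b i x))) \<le> block_bound p t (dyadic_cube i)"
      by (simp add: block_bound_eq q_def)
  qed
  \<comment> \<open>Dropping a piece with coefficient 0 loses nothing: its mixed norm is 0, hence by
    Hoelder so is its integral.\<close>
  have zero: "AE x in lborel. c i = 0 \<longrightarrow> V i x = 0" for i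
  proof (cases "c i = 0")
    case True
    obtain j k where i: "i = (j, k)" by (cases i)
    have "mixed_norm q (V i) = 0" using dominated_piecesD(3)[OF V, of i] True by simp
    then have "(\<integral>\<^sup>+x. V i x \<partial>lborel) = 0"
      using integral_le_bb[of "V i" j k] dominated_piecesD(2)[OF V, of _ i] by (simp add: i)
    then have "AE x in lborel. V i x = 0" by (subst (asm) nn_integral_0_iff_AE) auto
    then show ?thesis by eventually_elim simp
  qed simp
  have "AE x in lborel. \<forall>i. c i = 0 \<longrightarrow> V i x = 0" using zero by (subst AE_all_countable) blast
  with TV Sfin have "AE x in lborel. ((\<lambda>i. lam i * b i x) has_sum complex_of_real (enn2real (T x))) UNIV"
  proof eventually_elim
    case (elim x)
    have TS: "T x \<le> S x" using elim by (simp add: S_def)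
    have "c i * W i x = T x / S x * V i x" if "S x \<noteq> 0" for i
    proof (cases "c i = 0")
      case False
      have "c i * W i x = T x / S x * (V i x * (c i / c i))"
        using False that elim TS by (simp add: W_def min_absorb1 less_top) (simp only: divide_ennreal_def mult_ac)
      also have "c i / c i = 1" using False cfin[of i] by (simp add: divide_eq_1_ennreal less_top)
      finally show ?thesis by simp
    next
      case True
      then have "V i x = 0" using elim(3) by blast
      then show ?thesis by (simp add: True)
    qed
    then have "(\<integral>\<^sup>+i. c i * W i x \<partial>count_space UNIV) = T x"
    proof (cases "S x = 0")
      case False
      then have "(\<integral>\<^sup>+i. c i * W i x \<partial>count_space UNIV) = (\<integral>\<^sup>+i. T x / S x * V i x \<partial>count_space UNIV)"
        using \<open>\<And>i. S x \<noteq> 0 \<Longrightarrow> c i * W i x = T x / S x * V i x\<close> by simp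
      also have "\<dots> = T x / S x * S x" unfolding S_def by (rule nn_integral_cmult) simp
      also have "\<dots> = T x * (S x / S x)" by (simp only: divide_ennreal_def mult_ac)
      also have "S x / S x = 1" using False elim by (simp add: divide_eq_1_ennreal less_top)
      finally show ?thesis by simp
    qed (use TS in \<open>simp add: W_def\<close>)
    then have "((\<lambda>i. complex_of_real (enn2real (c i * W i x))) has_sum complex_of_real (enn2real (T x))) UNIV"
      using TS elim by (intro has_sum_enn2real) auto
    then show ?case by (simp add: lam_def b_def enn2real_mult)
  qed
  then have "AE x in lebesgue. ((\<lambda>i. lam i * b i x) has_sum complex_of_real (enn2real (T x))) UNIV"
    by (rule AE_completion)
  then have "block_rep p t r (\<lambda>x. complex_of_real (enn2real (T x))) lam"
    unfolding block_rep_def using block dominated_piecesD(4)[OF V] by (auto simp: r lam)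
  then have "block_norm p t r (\<lambda>x. complex_of_real (enn2real (T x))) \<le> lq_norm (conj_exp r) (\<lambda>i. ennreal (cmod (lam i)))"
    unfolding block_norm_def by (intro INF_lower) simp
  then show ?thesis using Tfin by (simp add: block_norm_ext_def r lam)
qed

end

text \<open>The balls need not be centred at \<open>x\<close>, so a superlevel set is a union of
  open balls, whatever \<open>F\<close> is.\<close>

lemma measurable_ball_max [measurable]: "ball_max F \<in> borel_measurable (borel :: (real ^ 'n::finite) measure)"
proof (rule borel_measurableI_greater)
  fix y
  have "{x \<in> space borel. y < ball_max F x} = (\<Union>(c, \<rho>)\<in>{(c, \<rho>). 0 < \<rho> \<and>
      y < (\<integral>\<^sup>+y\<in>ball c \<rho>. F y \<partial>lborel) / emeasure lborel (ball c \<rho>)}. ball c \<rho>)"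
    by (auto simp: ball_max_def less_SUP_iff) blast
  also have "\<dots> \<in> sets borel" by (intro borel_open open_UN) auto
  finally show "{x \<in> space borel. y < ball_max F x} \<in> sets borel" .
qed

lemma ball_max_countable_sum:
  fixes f :: "'i::countable \<Rightarrow> real ^ 'n::finite \<Rightarrow> ennreal"
  assumes [measurable]: "\<And>i. f i \<in> borel_measurable borel"
  shows "ball_max (\<lambda>x. \<integral>\<^sup>+i. f i x \<partial>count_space UNIV) x \<le> (\<integral>\<^sup>+i. ball_max (f i) x \<partial>count_space UNIV)"
  unfolding ball_max_def
proof (intro SUP_least, clarify)
  fix c :: "real ^ 'n" and \<rho> :: real assume \<rho>: "0 < \<rho>" and x: "x \<in> ball c \<rho>"
  have [measurable]: "ball c \<rho> \<in> sets borel" by simp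
  have "(\<integral>\<^sup>+y\<in>ball c \<rho>. (\<integral>\<^sup>+i. f i y \<partial>count_space UNIV) \<partial>lborel)
      = (\<integral>\<^sup>+y. (\<integral>\<^sup>+i. f i y * indicator (ball c \<rho>) y \<partial>count_space UNIV) \<partial>lborel)"
    by (simp add: nn_integral_multc)
  also have "\<dots> = (\<integral>\<^sup>+i. (\<integral>\<^sup>+y. f i y * indicator (ball c \<rho>) y \<partial>lborel) \<partial>count_space UNIV)"
    by (rule nn_integral_count_space_nn_integral) (simp, measurable)
  finally have "(\<integral>\<^sup>+y\<in>ball c \<rho>. (\<integral>\<^sup>+i. f i y \<partial>count_space UNIV) \<partial>lborel) / emeasure lborel (ball c \<rho>)
      = (\<integral>\<^sup>+i. (\<integral>\<^sup>+y. f i y * indicator (ball c \<rho>) y \<partial>lborel) / emeasure lborel (ball c \<rho>) \<partial>count_space UNIV)"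
    by (simp add: nn_integral_divide)
  also have "\<dots> \<le> (\<integral>\<^sup>+i. (SUP (c, \<rho>)\<in>{(c, \<rho>). 0 < \<rho> \<and> x \<in> ball c \<rho>}.
      (\<integral>\<^sup>+y\<in>ball c \<rho>. f i y \<partial>lborel) / emeasure lborel (ball c \<rho>)) \<partial>count_space UNIV)"
    using \<rho> x by (intro nn_integral_mono SUP_upper2[of "(c, \<rho>)"]) auto
  finally show "(\<integral>\<^sup>+y\<in>ball c \<rho>. (\<integral>\<^sup>+i. f i y \<partial>count_space UNIV) \<partial>lborel) / emeasure lborel (ball c \<rho>)
      \<le> (\<integral>\<^sup>+i. (SUP (c, \<rho>)\<in>{(c, \<rho>). 0 < \<rho> \<and> x \<in> ball c \<rho>}.
      (\<integral>\<^sup>+y\<in>ball c \<rho>. f i y \<partial>lborel) / emeasure lborel (ball c \<rho>)) \<partial>count_space UNIV)" .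
qed

definition near_shifts :: "(int ^ 'n::finite) set" where
  "near_shifts = {e. \<forall>l. e $ l \<in> {-1, 0, 1}}"

lemma finite_near_shifts: "finite (near_shifts :: (int ^ 'n::finite) set)"
proof -
  have "near_shifts \<subseteq> (\<lambda>w. \<chi> l. w l) ` (\<Pi>\<^sub>E l\<in>(UNIV :: 'n set). {-1, 0, 1 :: int})"
  proof
    fix e :: "int ^ 'n" assume "e \<in> near_shifts"
    then show "e \<in> (\<lambda>w. \<chi> l. w l) ` (\<Pi>\<^sub>E l\<in>(UNIV :: 'n set). {-1, 0, 1 :: int})"
      by (intro image_eqI[of _ _ "\<lambda>l. e $ l"]) (auto simp: near_shifts_def PiE_UNIV_domain vec_eq_iff)
  qed
  then show ?thesis by (rule finite_subset) (intro finite_imageI finite_PiE, auto)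
qed

definition far_const :: "'n::finite itself \<Rightarrow> real" where
  "far_const _ = 2 ^ CARD('n) / unit_ball_vol (real CARD('n))"

text \<open>If \<open>x\<close> avoids all neighbours of level \<open>m\<close>, some coordinate
  index at that scale differs by at least 2 from that of any point of the cube. A ball through
  \<open>x\<close> meeting the cube thus has radius at least half the side
  \<open>2 powi (m - fst i)\<close>, and \<open>far_const\<close> normalises the reciprocal of its
  volume.\<close>

lemma ball_max_far:
  fixes f :: "real ^ 'n::finite \<Rightarrow> ennreal"
  assumes supp: "\<And>y. y \<notin> dyadic_cube i \<Longrightarrow> f y = 0"
    and x: "\<And>e. e \<in> near_shifts \<Longrightarrow> x \<notin> dyadic_cube (shift_index m e i)"
  shows "ball_max f x \<le> ennreal (far_const TYPE('n) * 2 powr (of_int (fst i - int m) * real CARD('n))) * (\<integral>\<^sup>+y. f y \<partial>lborel)"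
  unfolding ball_max_def
proof (intro SUP_least, clarify)
  fix c :: "real ^ 'n" and \<rho> :: real assume \<rho>: "0 < \<rho>" and xb: "x \<in> ball c \<rho>"
  define g where "g = fst i - int m"
  let ?K = "far_const TYPE('n) * 2 powr (of_int g * real CARD('n))"
  show "(\<integral>\<^sup>+y\<in>ball c \<rho>. f y \<partial>lborel) / emeasure lborel (ball c \<rho>)
      \<le> ennreal (far_const TYPE('n) * 2 powr (of_int (fst i - int m) * real CARD('n))) * (\<integral>\<^sup>+y. f y \<partial>lborel)"
  proof (cases "\<exists>y. y \<in> ball c \<rho> \<and> y \<in> dyadic_cube i")
    case False
    then have "f y * indicator (ball c \<rho>) y = 0" for y using supp[of y] by (auto simp: indicator_def)
    then have "(\<integral>\<^sup>+y\<in>ball c \<rho>. f y \<partial>lborel) = 0" by (simp only: nn_integral_0_iff_AE nn_integral_const mult_zero_left)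
    then show ?thesis by simp
  next
    case True
    then obtain y where y: "y \<in> ball c \<rho>" "y \<in> dyadic_cube i" by auto
    define e where "e = dyadic_index g x - dyadic_index g y"
    have "x \<in> dyadic_cube (shift_index m e i)"
      by (subst mem_shifted_cube_iff[OF y(2)]) (simp add: e_def g_def)
    with x have "e \<notin> near_shifts" by auto
    then obtain l where l: "e $ l \<notin> {-1, 0, 1}" by (auto simp: near_shifts_def)
    define a :: real where "a = 2 powi g"
    have a: "0 < a" by (simp add: a_def)
    have "\<bar>a * x $ l - a * y $ l\<bar> > 1"
    proof -
      have "\<bar>\<lfloor>a * x $ l\<rfloor> - \<lfloor>a * y $ l\<rfloor>\<bar> \<ge> 2"
        using l by (auto simp: e_def dyadic_index_def a_def abs_if)
      then show ?thesis by linarith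
    qed
    then have "1 < a * \<bar>x $ l - y $ l\<bar>" using a by (simp add: abs_mult flip: right_diff_distrib)
    also have "\<dots> \<le> a * dist x y"
      using component_le_norm_cart[of "x - y" l] a by (intro mult_left_mono) (auto simp: dist_norm)
    also have "\<dots> \<le> a * (2 * \<rho>)"
    proof (intro mult_left_mono)
      have "dist x y \<le> dist c x + dist c y" by (metis dist_commute dist_triangle)
      then show "dist x y \<le> 2 * \<rho>" using xb y by simp
    qed (use a in simp)
    finally have r: "1 / (2 * a) \<le> \<rho>" using a by (simp add: field_simps)
    have u: "0 < unit_ball_vol (real CARD('n))" "unit_ball_vol (real CARD('n)) \<noteq> 0"
      using unit_ball_vol_pos[of "real CARD('n)"] by linarith+
    have K: "?K * (unit_ball_vol (real CARD('n)) * (1 / (2 * a)) ^ CARD('n)) = 1"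
    proof -
      have "2 powr (of_int g * real CARD('n)) = a ^ CARD('n)"
        by (simp add: a_def powr_realpow[symmetric] powr_powr[symmetric] powr_real_of_int')
      then show ?thesis using a u by (simp add: far_const_def power_divide power_mult_distrib)
    qed
    have "ennreal (?K * (unit_ball_vol (real CARD('n)) * (1 / (2 * a)) ^ CARD('n)))
        \<le> ennreal (?K * (unit_ball_vol (real CARD('n)) * \<rho> ^ CARD('n)))"
      using r \<rho> a u by (intro ennreal_leI mult_left_mono power_mono) (auto simp: far_const_def)
    also have "\<dots> = ennreal ?K * emeasure lborel (ball c \<rho>)"
      using \<rho> u by (subst ennreal_mult) (auto simp: emeasure_ball far_const_def)
    finally have one_le: "ennreal 1 \<le> ennreal ?K * emeasure lborel (ball c \<rho>)" by (simp only: K)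
    have "(\<integral>\<^sup>+y\<in>ball c \<rho>. f y \<partial>lborel) / emeasure lborel (ball c \<rho>)
        \<le> (ennreal ?K * emeasure lborel (ball c \<rho>)) * ((\<integral>\<^sup>+y\<in>ball c \<rho>. f y \<partial>lborel) / emeasure lborel (ball c \<rho>))"
      using mult_right_mono[OF one_le, of "(\<integral>\<^sup>+y\<in>ball c \<rho>. f y \<partial>lborel) / emeasure lborel (ball c \<rho>)"]
      by (simp only: ennreal_1 mult_1 zero_le)
    also have "\<dots> = ennreal ?K * (\<integral>\<^sup>+y\<in>ball c \<rho>. f y \<partial>lborel) * (emeasure lborel (ball c \<rho>) / emeasure lborel (ball c \<rho>))"
      by (simp only: divide_ennreal_def mult_ac)
    also have "emeasure lborel (ball c \<rho>) / emeasure lborel (ball c \<rho>) = 1"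
      using \<rho> u by (simp add: divide_eq_1_ennreal emeasure_ball)
    also have "ennreal ?K * (\<integral>\<^sup>+y\<in>ball c \<rho>. f y \<partial>lborel) * 1 \<le> ennreal ?K * (\<integral>\<^sup>+y. f y \<partial>lborel)"
      by (simp, intro mult_left_mono nn_integral_mono) (auto simp: indicator_def)
    finally show ?thesis by (simp add: g_def)
  qed
qed

text \<open>Once the side of the level \<open>m\<close> cubes exceeds the distance from
  \<open>x\<close> to the lower corner \<open>y\<close>, the coordinate indices of \<open>x\<close>
  and \<open>y\<close> differ by at most 1.\<close>

lemma near_shifts_cover:
  fixes x :: "real ^ 'n::finite"
  shows "\<exists>m. \<exists>e\<in>near_shifts. x \<in> dyadic_cube (shift_index m e i)"
proof -
  obtain j k where i: "i = (j, k)" by (cases i)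
  define y :: "real ^ 'n" where "y = (\<chi> l. 2 powi (- j) * of_int (k $ l))"
  have "dyadic_index j y = k"
    by (simp add: dyadic_index_def y_def vec_eq_iff power_int_minus field_simps)
  then have y: "y \<in> dyadic_cube i" by (simp add: i mem_dyadic_cube_iff)
  obtain m :: nat where m: "2 powi j * dist x y < 2 ^ m"
    using real_arch_pow[of 2 "2 powi j * dist x y"] by auto
  define g where "g = j - int m"
  define e where "e = dyadic_index g x - dyadic_index g y"
  have close: "\<bar>2 powi g * x $ l - 2 powi g * y $ l\<bar> < 1" for l
  proof -
    have "\<bar>2 powi g * x $ l - 2 powi g * y $ l\<bar> = 2 powi g * \<bar>x $ l - y $ l\<bar>"
      by (simp add: abs_mult flip: right_diff_distrib)
    also have "\<dots> \<le> 2 powi g * dist x y"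
      using component_le_norm_cart[of "x - y" l] by (intro mult_left_mono) (auto simp: dist_norm)
    also have "\<dots> < 1" using m by (simp add: g_def power_int_diff field_simps)
    finally show ?thesis .
  qed
  have "\<bar>\<lfloor>2 powi g * x $ l\<rfloor> - \<lfloor>2 powi g * y $ l\<rfloor>\<bar> \<le> 1" for l
    using close[of l] by linarith
  then have e1: "\<bar>e $ l\<bar> \<le> 1" for l by (simp add: e_def dyadic_index_def)
  have "e $ l = -1 \<or> e $ l = 0 \<or> e $ l = 1" for l using e1[of l] by arith
  then have "e \<in> near_shifts" by (simp add: near_shifts_def)
  moreover have "x \<in> dyadic_cube (shift_index m e i)"
    by (subst mem_shifted_cube_iff[OF y]) (simp add: e_def g_def i)
  ultimately show ?thesis by blast
qed

section \<open>The maximal operator on block spaces\<close>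

context block_params
begin

text \<open>For \<open>w = (m, e)\<close> this is the size, relative to a block, of what a
  normalised piece contributes to its \<open>e\<close>-th neighbour of level \<open>m\<close>. The
  far bound is a constant there; its mixed norm, measured against \<open>bb\<close> of the larger
  cube, leaves exactly this power.\<close>

definition level_weight :: "nat \<times> (int ^ 'n::{finite,linorder}) \<Rightarrow> ennreal" where
  "level_weight w = indicator near_shifts (snd w) * ennreal (2 powr (- (real (fst w) * (n / t))))"

text \<open>Minkowski takes the sequence norm inside the integral of the far bound, and Hoelder on
  the cube brings in the mixed norm of \<open>a\<close>. The result is written for level
  \<open>Suc m\<close>, where \<open>x\<close> will be placed; the change of scale costs
  \<open>2 powr n\<close>.\<close>

lemma far_bound:
  fixes f :: "nat \<Rightarrow> real ^ 'n::{finite,linorder} \<Rightarrow> ennreal"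
  assumes u: "1 < u" and f [measurable]: "\<And>j. f j \<in> borel_measurable borel"
    and fa: "\<And>x. lq_norm u (\<lambda>j. f j x) \<le> a x" and a: "a \<in> borel_measurable borel"
    and supp: "\<And>x. x \<notin> dyadic_cube i \<Longrightarrow> a x = 0" and mixed: "mixed_norm q a \<le> c * bb i"
    and x: "\<And>e. e \<in> near_shifts \<Longrightarrow> x \<notin> dyadic_cube (shift_index m e i)"
  shows "lq_norm u (\<lambda>j. ball_max (f j) x)
    \<le> ennreal (far_const TYPE('n) * 2 powr n * 2 powr (of_int (fst i - int (Suc m)) * n) * 2 powr (- of_int (fst i) * (n / t))) * c"
proof -
  have u0: "0 < u" using u by (rule order.strict_trans[of 0 1, rotated]) simp
  obtain j0 k0 where i: "i = (j0, k0)" by (cases i)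
  let ?K = "ennreal (far_const TYPE('n) * 2 powr (of_int (fst i - int m) * real CARD('n)))"
  have fc: "0 \<le> far_const TYPE('n)" by (simp add: far_const_def)
  have fz: "f j y = 0" if "y \<notin> dyadic_cube i" for j y
  proof -
    have "f j y \<le> lq_norm u (\<lambda>j. f j y)" by (rule lq_norm_ge_point[OF u])
    also have "\<dots> \<le> 0" using fa[of y] supp[OF that] by simp
    finally show ?thesis by simp
  qed
  have "lq_norm u (\<lambda>j. ball_max (f j) x) \<le> lq_norm u (\<lambda>j. ?K * (\<integral>\<^sup>+y. f j y \<partial>lborel))"
    by (intro lq_norm_mono u0 ball_max_far[OF fz x])
  also have "\<dots> = ?K * lq_norm u (\<lambda>j. \<integral>\<^sup>+y. f j y \<partial>lborel)" by (rule lq_norm_cmult[OF u0])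
  also have "\<dots> \<le> ?K * (\<integral>\<^sup>+y. lq_norm u (\<lambda>j. f j y) \<partial>lborel)"
    using u by (intro mult_left_mono minkowski_lq_norm[OF sigma_finite_lborel, of u "\<lambda>y j. f j y"]) auto
  also have "\<dots> \<le> ?K * (\<integral>\<^sup>+y. a y \<partial>lborel)"
    by (intro mult_left_mono nn_integral_mono fa) auto
  also have "\<dots> \<le> ?K * (ennreal (2 powr (- of_int j0 * \<sigma>)) * mixed_norm q a)"
    using supp by (intro mult_left_mono integral_le_bb[OF a, of j0 k0]) (auto simp: i)
  also have "\<dots> \<le> ?K * (ennreal (2 powr (- of_int j0 * \<sigma>)) * (c * bb i))"
    by (intro mult_left_mono mixed) auto
  also have "\<dots> = ?K * ennreal (2 powr (- of_int j0 * \<sigma>)) * bb i * c" by (simp only: mult_ac)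
  also have "?K * ennreal (2 powr (- of_int j0 * \<sigma>)) * bb i
      = ennreal (far_const TYPE('n) * 2 powr (of_int (fst i - int m) * n) * 2 powr (- of_int j0 * \<sigma>) * 2 powr (- of_int j0 * (n / t - \<sigma>)))"
    using fc by (simp add: bb_def i ennreal_mult n_def mult.assoc)
  also have "far_const TYPE('n) * 2 powr (of_int (fst i - int m) * n) * 2 powr (- of_int j0 * \<sigma>) * 2 powr (- of_int j0 * (n / t - \<sigma>))
      = far_const TYPE('n) * 2 powr n * 2 powr (of_int (fst i - int (Suc m)) * n) * 2 powr (- of_int (fst i) * (n / t))"
    by (simp add: i mult.assoc powr_add[symmetric] algebra_simps)
  finally show ?thesis .
qed

text \<open>Every point is assigned to the first level whose neighbours contain it. At level 0 the
  Fefferman--Stein bound is used; at a later level the point lies outside the neighbours of the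
  previous one, so the constant far bound holds. \<open>A\<close> adds the two constants and is
  independent of the cube.\<close>

lemma single_block:
  assumes u: "1 < u"
  shows "\<exists>A<top. \<forall>i a c. \<forall>f :: nat \<Rightarrow> _. (\<forall>j. f j \<in> borel_measurable borel) \<longrightarrow> (\<forall>x. lq_norm u (\<lambda>j. f j x) \<le> a x) \<longrightarrow>
    a \<in> borel_measurable borel \<longrightarrow> (\<forall>x. x \<notin> dyadic_cube i \<longrightarrow> a x = 0) \<longrightarrow> mixed_norm q a \<le> c * bb i \<longrightarrow>
    (\<exists>h. (\<forall>w. h w \<in> borel_measurable borel) \<and>
      (\<forall>w x. x \<notin> dyadic_cube (shift_index (fst w) (snd w) i) \<longrightarrow> h w x = 0) \<and>
      (\<forall>w. mixed_norm q (h w) \<le> A * level_weight w * c * bb (shift_index (fst w) (snd w) i)) \<and>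
      (\<forall>x. lq_norm u (\<lambda>j. ball_max (f j) x) \<le> (\<integral>\<^sup>+w. h w x \<partial>count_space UNIV)))"
proof -
  let ?L = "sorted_list_of_set (UNIV :: 'n set)"
  have L: "distinct ?L" "set ?L = UNIV" by auto
  obtain F where F: "F < top" and fs: "\<And>f x. (\<And>j. f j \<in> borel_measurable borel) \<Longrightarrow>
    seq_norm q u ?L (\<lambda>j. ball_max (f j)) x \<le> F * seq_norm q u ?L f x"
    using fefferman_stein[OF q_gt u L] by blast
  define B where "B = far_const TYPE('n) * 2 powr n"
  have B: "0 \<le> B" by (simp add: B_def far_const_def)
  show ?thesis
  proof (intro exI[of _ "F + ennreal B"] conjI allI impI)
    show "F + ennreal B < top" using F by simp
    fix i :: "int \<times> (int ^ 'n::{finite,linorder})" and a c and f :: "nat \<Rightarrow> real ^ 'n::{finite,linorder} \<Rightarrow> ennreal"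
    assume f: "\<forall>j. f j \<in> borel_measurable borel" and fa: "\<forall>x. lq_norm u (\<lambda>j. f j x) \<le> a x"
      and a: "a \<in> borel_measurable borel" and supp: "\<forall>x. x \<notin> dyadic_cube i \<longrightarrow> a x = 0"
      and mixed: "mixed_norm q a \<le> c * bb i"
    obtain j0 k0 where i: "i = (j0, k0)" by (cases i)
    define T where "T x = lq_norm u (\<lambda>j. ball_max (f j) x)" for x
    have [measurable]: "T \<in> borel_measurable borel"
      unfolding T_def by (rule measurable_lq_norm) simp
    have T_mixed: "mixed_norm q T \<le> F * (c * bb i)"
    proof -
      have "mixed_norm q T \<le> F * mixed_norm q (\<lambda>x. lq_norm u (\<lambda>j. f j x))"
        unfolding T_def mixed_norm_lq_norm using f by (intro fs) auto
      also have "\<dots> \<le> F * mixed_norm q a" using fa by (intro mult_left_mono mixed_norm_mono) auto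
      also have "\<dots> \<le> F * (c * bb i)" by (intro mult_left_mono mixed) auto
      finally show ?thesis .
    qed
    define far where "far M = ennreal (B * 2 powr (of_int (j0 - int M) * n) * 2 powr (- of_int j0 * (n / t))) * c" for M
    define h where "h w x = (if snd w \<in> near_shifts \<and> x \<in> dyadic_cube (shift_index (fst w) (snd w) i)
      then (if fst w = 0 then T x else min (T x) (far (fst w))) else 0)" for w x
    have hm: "h w \<in> borel_measurable borel" for w
    proof -
      have "{x \<in> space borel. x \<in> dyadic_cube (shift_index (fst w) (snd w) i)} \<in> sets borel" by simp
      then show ?thesis unfolding h_def[abs_def] by (cases "snd w \<in> near_shifts"; cases "fst w = 0") (simp, measurable)+
    qed
    have h_mixed: "mixed_norm q (h w) \<le> (F + ennreal B) * level_weight w * c * bb (shift_index (fst w) (snd w) i)" for w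
    proof (cases "snd w \<in> near_shifts")
      case False
      then have "h w = (\<lambda>_. 0)" by (intro ext) (simp add: h_def)
      then show ?thesis by (simp add: mixed_norm_0)
    next
      case True
      obtain M e where w: "w = (M, e)" by (cases w)
      define i' where "i' = shift_index M e i"
      have wi: "shift_index (fst w) (snd w) i = i'" by (simp add: w i'_def)
      have i': "fst i' = j0 - int M" by (simp add: i'_def i shift_index_def)
      have lw: "level_weight w = ennreal (2 powr (- (real M * (n / t))))" using True by (simp add: level_weight_def w)
      show ?thesis
      proof (cases "M = 0")
        case True
        have "mixed_norm q (h w) \<le> mixed_norm q T" by (rule mixed_norm_mono) (auto simp: h_def w True)
        also have "\<dots> \<le> F * (c * bb i)" by (rule T_mixed)
        also have "\<dots> \<le> (F + ennreal B) * (c * bb i)" by (intro mult_right_mono) auto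
        also have "bb i = bb i'" by (simp add: bb_def i' True i)
        finally have "mixed_norm q (h w) \<le> (F + ennreal B) * (c * bb i')" .
        moreover have "level_weight w = 1" using True by (simp add: lw)
        ultimately show ?thesis by (simp only: wi mult_1_right mult.assoc)
      next
        case False
        have "mixed_norm q (h w) \<le> ennreal (2 powr (- of_int (fst i') * (n - \<sigma>))) * far M"
          using False by (intro mixed_norm_const_le[of _ _ "fst i'" "snd i'"]) (auto simp: h_def w i'_def)
        also have "\<dots> = ennreal (2 powr (- of_int (j0 - int M) * (n - \<sigma>)) * (B * 2 powr (of_int (j0 - int M) * n) * 2 powr (- of_int j0 * (n / t)))) * c"
          using B by (simp add: far_def i' ennreal_mult mult.assoc)
        also have "2 powr (- of_int (j0 - int M) * (n - \<sigma>)) * (B * 2 powr (of_int (j0 - int M) * n) * 2 powr (- of_int j0 * (n / t)))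
            = B * 2 powr (- of_int (j0 - int M) * (n - \<sigma>) + of_int (j0 - int M) * n + - of_int j0 * (n / t))"
          by (simp only: powr_add mult_ac)
        also have "- of_int (j0 - int M) * (n - \<sigma>) + of_int (j0 - int M) * n + - of_int j0 * (n / t)
            = - (real M * (n / t)) + - of_int (j0 - int M) * (n / t - \<sigma>)"
          by (simp add: algebra_simps)
        also have "B * 2 powr (- (real M * (n / t)) + - of_int (j0 - int M) * (n / t - \<sigma>))
            = B * (2 powr (- (real M * (n / t))) * 2 powr (- of_int (j0 - int M) * (n / t - \<sigma>)))"
          by (simp only: powr_add)
        also have "ennreal \<dots> = ennreal B * (level_weight w * bb i')"
          using B by (simp add: lw bb_def i' ennreal_mult)
        also have "\<dots> * c \<le> (F + ennreal B) * (level_weight w * bb i') * c"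
          by (intro mult_right_mono) auto
        finally show ?thesis by (simp only: wi mult_ac)
      qed
    qed
    have cover: "T x \<le> (\<integral>\<^sup>+w. h w x \<partial>count_space UNIV)" for x
    proof -
      \<comment> \<open>Minimality of the level is what puts \<open>x\<close> outside all neighbours
        of the preceding level.\<close>
      define P where "P m \<longleftrightarrow> (\<exists>e\<in>near_shifts. x \<in> dyadic_cube (shift_index m e i))" for m
      define M where "M = (LEAST m. P m)"
      have "\<exists>m. P m" unfolding P_def by (rule near_shifts_cover)
      then have "P M" unfolding M_def by (rule LeastI_ex)
      then obtain e where e: "e \<in> near_shifts" "x \<in> dyadic_cube (shift_index M e i)" by (auto simp: P_def)
      have "T x \<le> h (M, e) x"
      proof (cases M)
        case 0
        then show ?thesis using e by (simp add: h_def)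
      next
        case (Suc m)
        then have "\<not> P m" unfolding M_def by (intro not_less_Least) simp
        then have "T x \<le> far (Suc m)"
          unfolding T_def far_def B_def using f fa supp
          by (intro order_trans[OF far_bound[OF u _ _ a _ mixed, where f = f and m = m and x = x]]) (auto simp: P_def i)
        then show ?thesis using e Suc by (simp add: h_def)
      qed
      also have "\<dots> \<le> (\<integral>\<^sup>+w. h w x \<partial>count_space UNIV)"
        by (rule nn_integral_ge_point) simp
      finally show ?thesis .
    qed
    show "\<exists>h. (\<forall>w. h w \<in> borel_measurable borel) \<and>
      (\<forall>w x. x \<notin> dyadic_cube (shift_index (fst w) (snd w) i) \<longrightarrow> h w x = 0) \<and>
      (\<forall>w. mixed_norm q (h w) \<le> (F + ennreal B) * level_weight w * c * bb (shift_index (fst w) (snd w) i)) \<and>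
      (\<forall>x. lq_norm u (\<lambda>j. ball_max (f j) x) \<le> (\<integral>\<^sup>+w. h w x \<partial>count_space UNIV))"
      using hm h_mixed cover by (intro exI[of _ h]) (auto simp: h_def T_def)
  qed
qed

text \<open>The decay of each level times the loss from regrouping, summed over levels and
  neighbours. The exponent at level \<open>m\<close> is
  \<open>- m n (1 / t - 1 / r)\<close>.\<close>

definition regroup_const :: ennreal where
  "regroup_const = (\<integral>\<^sup>+w. level_weight w * ennreal (2 powr (real (fst w) * n * (1 - 1 / \<rho>))) \<partial>count_space UNIV)"

lemma regroup_const_finite: "regroup_const < top"
proof -
  let ?a = "n * (1 / t - (1 - 1 / \<rho>))"
  have "regroup_const = (\<integral>\<^sup>+w. ennreal (2 powr (- (real (fst w) * ?a))) * indicator near_shifts (snd w)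
      \<partial>count_space (UNIV :: (nat \<times> (int ^ 'n::{finite,linorder})) set))"
    unfolding regroup_const_def
  proof (intro nn_integral_cong)
    fix w :: "nat \<times> (int ^ 'n::{finite,linorder})"
    have "level_weight w * ennreal (2 powr (real (fst w) * n * (1 - 1 / \<rho>)))
        = ennreal (2 powr (- (real (fst w) * (n / t))) * 2 powr (real (fst w) * n * (1 - 1 / \<rho>))) * indicator near_shifts (snd w)"
      by (simp add: level_weight_def ennreal_mult mult_ac)
    also have "2 powr (- (real (fst w) * (n / t))) * 2 powr (real (fst w) * n * (1 - 1 / \<rho>)) = 2 powr (- (real (fst w) * ?a))"
      by (simp add: powr_add[symmetric] algebra_simps)
    finally show "level_weight w * ennreal (2 powr (real (fst w) * n * (1 - 1 / \<rho>)))
        = ennreal (2 powr (- (real (fst w) * ?a))) * indicator near_shifts (snd w)" .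
  qed
  also have "\<dots> = (\<integral>\<^sup>+m. \<integral>\<^sup>+e. ennreal (2 powr (- (real m * ?a))) * indicator near_shifts (e :: int ^ 'n::{finite,linorder}) \<partial>count_space UNIV \<partial>count_space UNIV)"
    by (subst nn_integral_fst_count_space[symmetric]) simp
  also have "\<dots> = (\<integral>\<^sup>+m. ennreal (2 powr (- (real m * ?a))) * of_nat (card (near_shifts :: (int ^ 'n::{finite,linorder}) set)) \<partial>count_space UNIV)"
    using finite_near_shifts by (simp add: nn_integral_cmult emeasure_count_space)
  also have "\<dots> = (\<integral>\<^sup>+m. ennreal (2 powr (- (real m * ?a))) \<partial>count_space UNIV) * of_nat (card (near_shifts :: (int ^ 'n::{finite,linorder}) set))"
    by (rule nn_integral_multc) simp
  also have "\<dots> < top"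
    using \<rho>t n_pos by (intro ennreal_mult_less_top[THEN iffD2] disjI2 conjI geometric_sum_finite) (auto simp: of_nat_less_top)
  finally show ?thesis .
qed

text \<open>The double family of contributions, indexed by source cube and by relative position
  \<open>w\<close>, is regrouped by target cube. For fixed \<open>w\<close> the regrouping is
  bounded in the coefficient norm by \<open>lq_norm_shift_sum\<close>, and Minkowski adds up over
  \<open>w\<close>.\<close>

theorem maximal_block_bound:
  assumes u: "1 < u" and r: "conj_exp r = ennreal \<rho>"
  shows "\<exists>C<top. \<forall>a c. \<forall>g :: nat \<Rightarrow> _. dominated_pieces a c \<longrightarrow> (\<forall>j. g j \<in> borel_measurable borel) \<longrightarrow>
    (\<forall>x. lq_norm u (\<lambda>j. g j x) \<le> (\<integral>\<^sup>+i. a i x \<partial>count_space UNIV)) \<longrightarrow>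
    (\<forall>x j. (\<integral>\<^sup>+i. a i x \<partial>count_space UNIV) = top \<longrightarrow> g j x = 0) \<longrightarrow>
    block_norm_ext p t r (\<lambda>x. lq_norm u (\<lambda>j. ball_max (g j) x)) \<le> C * lq_norm (ennreal \<rho>) c"
proof -
  have u0: "0 < u" using u by (rule order.strict_trans[of 0 1, rotated]) simp
  obtain A where A: "A < top" and single: "\<forall>i a c. \<forall>f :: nat \<Rightarrow> _. (\<forall>j. f j \<in> borel_measurable borel) \<longrightarrow>
    (\<forall>x. lq_norm u (\<lambda>j. f j x) \<le> a x) \<longrightarrow>
    a \<in> borel_measurable borel \<longrightarrow> (\<forall>x. x \<notin> dyadic_cube i \<longrightarrow> a x = 0) \<longrightarrow> mixed_norm q a \<le> c * bb i \<longrightarrow>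
    (\<exists>h. (\<forall>w. h w \<in> borel_measurable borel) \<and>
      (\<forall>w x. x \<notin> dyadic_cube (shift_index (fst w) (snd w) i) \<longrightarrow> h w x = 0) \<and>
      (\<forall>w. mixed_norm q (h w) \<le> A * level_weight w * c * bb (shift_index (fst w) (snd w) i)) \<and>
      (\<forall>x. lq_norm u (\<lambda>j. ball_max (f j) x) \<le> (\<integral>\<^sup>+w. h w x \<partial>count_space UNIV)))"
    using single_block[OF u] by (elim exE conjE) (rule that)
  show ?thesis
  proof (intro exI[of _ "A * regroup_const"] conjI allI impI)
    show "A * regroup_const < top" using A regroup_const_finite by (simp add: ennreal_mult_less_top)
    fix a c and g :: "nat \<Rightarrow> real ^ 'n::{finite,linorder} \<Rightarrow> ennreal"
    assume a: "dominated_pieces a c" and g: "\<forall>j. g j \<in> borel_measurable borel"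
      and ga: "\<forall>x. lq_norm u (\<lambda>j. g j x) \<le> (\<integral>\<^sup>+i. a i x \<partial>count_space UNIV)"
      and gtop: "\<forall>x j. (\<integral>\<^sup>+i. a i x \<partial>count_space UNIV) = top \<longrightarrow> g j x = 0"
    note am [measurable] = dominated_piecesD(1)[OF a]
    have gm [measurable]: "g j \<in> borel_measurable borel" for j using g by simp
    define S where "S x = (\<integral>\<^sup>+i. a i x \<partial>count_space UNIV)" for x
    have [measurable]: "S \<in> borel_measurable borel" unfolding S_def by measurable
    \<comment> \<open>Where \<open>S\<close> is 0 or infinite the quotients do not sum to 1, but
      there \<open>g\<close> vanishes by hypothesis.\<close>
    define f where "f i j x = g j x * (a i x / S x)" for i j x
    have fm [measurable]: "f i j \<in> borel_measurable borel" for i j unfolding f_def by measurable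
    have g_upper: "g j x \<le> lq_norm u (\<lambda>j. g j x)" for j x by (rule lq_norm_ge_point[OF u])
    have g_sum: "g j x = (\<integral>\<^sup>+i. f i j x \<partial>count_space UNIV)" for j x
    proof (cases "S x = 0 \<or> S x = top")
      case True
      then have "g j x = 0" using gtop ga g_upper[of j x] unfolding S_def[symmetric] by (metis le_zero_eq order_trans)
      then show ?thesis by (simp add: f_def)
    next
      case False
      have "(\<integral>\<^sup>+i. f i j x \<partial>count_space UNIV) = g j x * (S x / S x)"
        unfolding f_def S_def by (simp add: nn_integral_cmult nn_integral_divide)
      moreover have "S x / S x = 1" using False by (simp add: divide_eq_1_ennreal)
      ultimately show ?thesis by simp
    qed
    have fa: "lq_norm u (\<lambda>j. f i j x) \<le> a i x" for i x
    proof -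
      have "lq_norm u (\<lambda>j. f i j x) = (a i x / S x) * lq_norm u (\<lambda>j. g j x)"
        unfolding f_def by (subst lq_norm_cmult[OF u0, symmetric]) (simp add: mult.commute)
      also have "\<dots> \<le> (a i x / S x) * S x" using ga by (intro mult_left_mono) (auto simp: S_def)
      also have "\<dots> = a i x * (S x / S x)" by (simp only: divide_ennreal_def mult_ac)
      also have "\<dots> \<le> a i x * 1"
      proof (intro mult_left_mono)
        \<comment> \<open>By the conventions of \<open>ennreal\<close> the quotient is 0 when
          \<open>S x\<close> is 0 or infinite.\<close>
        show "S x / S x \<le> 1"
        proof (cases "S x = 0 \<or> S x = top")
          case False
          then have "S x / S x = 1" by (simp add: divide_eq_1_ennreal)
          then show ?thesis by simp
        qed auto
      qed simp
      finally show ?thesis by simp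
    qed
    have "\<forall>i. \<exists>h. (\<forall>w. h w \<in> borel_measurable borel) \<and>
      (\<forall>w x. x \<notin> dyadic_cube (shift_index (fst w) (snd w) i) \<longrightarrow> h w x = 0) \<and>
      (\<forall>w. mixed_norm q (h w) \<le> A * level_weight w * c i * bb (shift_index (fst w) (snd w) i)) \<and>
      (\<forall>x. lq_norm u (\<lambda>j. ball_max (f i j) x) \<le> (\<integral>\<^sup>+w. h w x \<partial>count_space UNIV))"
      by (rule allI, rule single[rule_format, where a = "a i" and c = "c i" and f = "f i" for i])
        (fact fm fa dominated_piecesD(1,3)[OF a] | erule dominated_piecesD(2)[OF a])+
    from choice[OF this] obtain h where h: "\<And>i. (\<forall>w. h i w \<in> borel_measurable borel) \<and>
      (\<forall>w x. x \<notin> dyadic_cube (shift_index (fst w) (snd w) i) \<longrightarrow> h i w x = 0) \<and>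
      (\<forall>w. mixed_norm q (h i w) \<le> A * level_weight w * c i * bb (shift_index (fst w) (snd w) i)) \<and>
      (\<forall>x. lq_norm u (\<lambda>j. ball_max (f i j) x) \<le> (\<integral>\<^sup>+w. h i w x \<partial>count_space UNIV))"
      by (elim exE) (rule that, drule spec)
    have hm [measurable]: "h i w \<in> borel_measurable borel"
      and h_supp: "x \<notin> dyadic_cube (shift_index (fst w) (snd w) i) \<Longrightarrow> h i w x = 0"
      and h_mixed: "mixed_norm q (h i w) \<le> A * level_weight w * c i * bb (shift_index (fst w) (snd w) i)"
      and h_cover: "lq_norm u (\<lambda>j. ball_max (f i j) x) \<le> (\<integral>\<^sup>+w. h i w x \<partial>count_space UNIV)" for i w x
      using h[of i] by blast+
    \<comment> \<open>\<open>V k\<close> collects everything that arrives in the cube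
      \<open>k\<close>, and \<open>c' k\<close> adds the corresponding coefficients in the same
      way.\<close>
    define V where "V k x = (\<integral>\<^sup>+w. \<integral>\<^sup>+i. (if shift_index (fst w) (snd w) i = k then h i w x else 0) \<partial>count_space UNIV \<partial>count_space UNIV)" for k x
    define c' where "c' k = (\<integral>\<^sup>+w. A * level_weight w * (\<integral>\<^sup>+i. (if shift_index (fst w) (snd w) i = k then c i else 0) \<partial>count_space UNIV) \<partial>count_space UNIV)" for k
    define T where "T x = lq_norm u (\<lambda>j. ball_max (g j) x)" for x
    have Tm [measurable]: "T \<in> borel_measurable borel" unfolding T_def by (rule measurable_lq_norm) simp
    have T_le: "T x \<le> (\<integral>\<^sup>+k. V k x \<partial>count_space UNIV)" for x
    proof -
      have "T x \<le> lq_norm u (\<lambda>j. \<integral>\<^sup>+i. ball_max (f i j) x \<partial>count_space UNIV)"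
        unfolding T_def
      proof (rule lq_norm_mono[OF u0])
        fix j
        have "g j = (\<lambda>x. \<integral>\<^sup>+i. f i j x \<partial>count_space UNIV)" using g_sum by blast
        then show "ball_max (g j) x \<le> (\<integral>\<^sup>+i. ball_max (f i j) x \<partial>count_space UNIV)"
          using ball_max_countable_sum[of "\<lambda>i. f i j" x] fm by simp
      qed
      also have "\<dots> \<le> (\<integral>\<^sup>+i. lq_norm u (\<lambda>j. ball_max (f i j) x) \<partial>count_space UNIV)"
        using u by (intro minkowski_lq_norm[OF sigma_finite_measure_count_space]) auto
      also have "\<dots> \<le> (\<integral>\<^sup>+i. \<integral>\<^sup>+w. h i w x \<partial>count_space UNIV \<partial>count_space UNIV)"
        by (intro nn_integral_mono h_cover)
      also have "\<dots> = (\<integral>\<^sup>+w. \<integral>\<^sup>+i. h i w x \<partial>count_space UNIV \<partial>count_space UNIV)"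
        by (rule swap_sums)
      also have "\<dots> = (\<integral>\<^sup>+w. \<integral>\<^sup>+i. \<integral>\<^sup>+k. (if shift_index (fst w) (snd w) i = k then h i w x else 0) \<partial>count_space UNIV \<partial>count_space UNIV \<partial>count_space UNIV)"
        by (simp only: sum_if_eq)
      also have "\<dots> = (\<integral>\<^sup>+w. \<integral>\<^sup>+k. \<integral>\<^sup>+i. (if shift_index (fst w) (snd w) i = k then h i w x else 0) \<partial>count_space UNIV \<partial>count_space UNIV \<partial>count_space UNIV)"
        by (intro nn_integral_cong swap_sums)
      also have "\<dots> = (\<integral>\<^sup>+k. V k x \<partial>count_space UNIV)"
        unfolding V_def by (rule swap_sums)
      finally show ?thesis .
    qed
    have V_mixed: "mixed_norm q (V k) \<le> c' k * bb k" for k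
    proof -
      let ?h = "\<lambda>w i x. if shift_index (fst w) (snd w) i = k then h i w x else 0"
      have [measurable]: "?h w i \<in> borel_measurable borel" for w i by simp
      have "mixed_norm q (V k) \<le> (\<integral>\<^sup>+w. mixed_norm q (\<lambda>x. \<integral>\<^sup>+i. ?h w i x \<partial>count_space UNIV) \<partial>count_space UNIV)"
        unfolding V_def by (rule mixed_norm_countable_sum) measurable
      also have "\<dots> \<le> (\<integral>\<^sup>+w. \<integral>\<^sup>+i. mixed_norm q (?h w i) \<partial>count_space UNIV \<partial>count_space UNIV)"
        by (intro nn_integral_mono mixed_norm_countable_sum) measurable
      also have "\<dots> \<le> (\<integral>\<^sup>+w. \<integral>\<^sup>+i. A * level_weight w * (if shift_index (fst w) (snd w) i = k then c i else 0) * bb k \<partial>count_space UNIV \<partial>count_space UNIV)"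
      proof (intro nn_integral_mono)
        fix w i
        show "mixed_norm q (?h w i) \<le> A * level_weight w * (if shift_index (fst w) (snd w) i = k then c i else 0) * bb k"
          using h_mixed[of i w] by (cases "shift_index (fst w) (snd w) i = k") (auto simp: mixed_norm_0)
      qed
      also have "\<dots> = c' k * bb k"
        unfolding c'_def by (simp add: nn_integral_multc nn_integral_cmult)
      finally show ?thesis .
    qed
    have c'_le: "lq_norm (ennreal \<rho>) c' \<le> A * regroup_const * lq_norm (ennreal \<rho>) c"
    proof -
      let ?N = "\<lambda>w. ennreal (2 powr (real (fst w) * n * (1 - 1 / \<rho>)))"
      have \<rho>0: "(0::ennreal) < ennreal \<rho>" "1 \<le> ennreal \<rho>" using \<rho> by auto
      have "lq_norm (ennreal \<rho>) c' \<le> (\<integral>\<^sup>+w. lq_norm (ennreal \<rho>) (\<lambda>k. A * level_weight w * (\<integral>\<^sup>+i. (if shift_index (fst w) (snd w) i = k then c i else 0) \<partial>count_space UNIV)) \<partial>count_space UNIV)"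
        unfolding c'_def by (rule minkowski_lq_norm[OF sigma_finite_measure_count_space \<rho>0(2)]) simp
      also have "\<dots> \<le> (\<integral>\<^sup>+w. A * (level_weight w * ?N w) * lq_norm (ennreal \<rho>) c \<partial>count_space UNIV)"
      proof (intro nn_integral_mono)
        fix w :: "nat \<times> (int ^ 'n::{finite,linorder})"
        have "A * level_weight w * lq_norm (ennreal \<rho>) (\<lambda>k. \<integral>\<^sup>+i. (if shift_index (fst w) (snd w) i = k then c i else 0) \<partial>count_space UNIV)
            \<le> A * level_weight w * (?N w * lq_norm (ennreal \<rho>) c)"
          by (intro mult_left_mono lq_norm_shift_sum) simp
        then show "lq_norm (ennreal \<rho>) (\<lambda>k. A * level_weight w * (\<integral>\<^sup>+i. (if shift_index (fst w) (snd w) i = k then c i else 0) \<partial>count_space UNIV))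
            \<le> A * (level_weight w * ?N w) * lq_norm (ennreal \<rho>) c"
          by (subst lq_norm_cmult[OF \<rho>0(1)]) (simp only: mult.assoc)
      qed
      also have "\<dots> = A * regroup_const * lq_norm (ennreal \<rho>) c"
        unfolding regroup_const_def by (simp add: nn_integral_multc nn_integral_cmult)
      finally show ?thesis .
    qed
    have "dominated_pieces V c'"
      unfolding dominated_pieces_def
    proof (intro conjI allI impI)
      show "V k \<in> borel_measurable borel" for k
        unfolding V_def by (intro measurable_countable_sum) simp
      show "V k x = 0" if "x \<notin> dyadic_cube k" for k x
      proof -
        have "(if shift_index (fst w) (snd w) i = k then h i w x else 0) = 0" for w i
          using h_supp[of x w i] that by auto
        then show ?thesis unfolding V_def by simp
      qed
      have "A * regroup_const * lq_norm (ennreal \<rho>) c < top"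
        using A regroup_const_finite dominated_piecesD(4)[OF a] by (simp add: ennreal_mult_less_top)
      then show "lq_norm (ennreal \<rho>) c' < top" using c'_le by (rule le_less_trans[rotated])
    qed (rule V_mixed)
    then have "block_norm_ext p t r T \<le> lq_norm (ennreal \<rho>) c'"
      using T_le by (intro block_norm_ext_le[OF _ r Tm]) auto
    also have "\<dots> \<le> A * regroup_const * lq_norm (ennreal \<rho>) c" by (rule c'_le)
    finally show "block_norm_ext p t r (\<lambda>x. lq_norm u (\<lambda>j. ball_max (g j) x)) \<le> A * regroup_const * lq_norm (ennreal \<rho>) c"
      by (simp add: T_def[abs_def])
  qed
qed

end

section \<open>Reduction of complex Lebesgue measurable data to nonnegative Borel data\<close>

lemma has_sum_norm_le_nn_integral:
  fixes h :: "'i::countable \<Rightarrow> complex"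
  assumes "(h has_sum s) UNIV"
  shows "ennreal (cmod s) \<le> (\<integral>\<^sup>+i. ennreal (cmod (h i)) \<partial>count_space UNIV)"
proof (cases "(\<integral>\<^sup>+i. ennreal (cmod (h i)) \<partial>count_space UNIV)")
  case (real B)
  have le: "cmod (sum h F) \<le> B" if "finite F" for F
  proof -
    have "ennreal (\<Sum>i\<in>F. cmod (h i)) = (\<Sum>i\<in>F. ennreal (cmod (h i)))" by simp
    also have "\<dots> \<le> (\<Sum>\<^sub>\<infinity>i. ennreal (cmod (h i)))"
      using that nonneg_infsum_complete[of UNIV "\<lambda>i. ennreal (cmod (h i))"] by (simp, intro SUP_upper) simp
    also have "\<dots> = ennreal B" using real by (simp add: infsum_ennreal_eq_nn_integral)
    finally have "(\<Sum>i\<in>F. cmod (h i)) \<le> B" using real by (simp add: ennreal_le_iff)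
    then show ?thesis using norm_sum[of h F] by linarith
  qed
  have "((\<lambda>F. cmod (sum h F)) \<longlongrightarrow> cmod s) (finite_subsets_at_top UNIV)"
    using assms unfolding has_sum_def by (rule tendsto_norm)
  then have "cmod s \<le> B"
    by (rule tendsto_upperbound) (auto intro!: eventually_finite_subsets_at_top_weakI le)
  then show ?thesis using real by (simp add: ennreal_leI)
qed simp

lemma ball_max_cong_AE:
  assumes "AE x in lborel. F x = G x"
  shows "ball_max F x = ball_max G x"
proof -
  have "(\<integral>\<^sup>+y\<in>ball c \<rho>. F y \<partial>lborel) = (\<integral>\<^sup>+y\<in>ball c \<rho>. G y \<partial>lborel)" for c \<rho>
    by (rule nn_integral_cong_AE) (use assms in eventually_elim, simp)
  then show ?thesis by (simp add: ball_max_def)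
qed

lemma maximal_op_eq_ball_max: "maximal_op f x = ball_max (\<lambda>x. ennreal (cmod (f x))) x"
  by (simp add: maximal_op_def ball_max_def nn_integral_completion)

text \<open>The iterated integrals above are formed for Borel functions, whose sections are all
  measurable; a Lebesgue measurable function need not have this property.\<close>

lemma ennreal_borel_version:
  assumes "f \<in> borel_measurable (lebesgue :: (real ^ 'n::finite) measure)"
  shows "\<exists>g\<in>borel_measurable borel. AE x in lborel. ennreal (cmod (f x)) = g x"
proof -
  have "(\<lambda>x. ennreal (cmod (f x))) \<in> borel_measurable (completion lborel)" using assms by measurable
  from completion_ex_borel_measurable[OF this] show ?thesis by auto
qed

text \<open>The right side is an infimum over representations of the scalar function
  \<open>G\<close>. Each representation yields nonnegative Borel pieces that dominate the sequence,
  and \<open>maximal_block_bound\<close> acts on these with one constant.\<close>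

theorem theorem6p14:
  fixes p :: "real ^ 'n::{finite,linorder}" and t :: real and r u' :: ennreal
  assumes p: "\<forall>i. 1 < p $ i"
    and u': "1 < u'"
    and tr: "(1 < real CARD('n) / (\<Sum>i\<in>UNIV. 1 / p $ i) \<and>
                real CARD('n) / (\<Sum>i\<in>UNIV. 1 / p $ i) < t \<and> ennreal t < r \<and> r < \<infinity>) \<or>
             (1 < real CARD('n) / (\<Sum>i\<in>UNIV. 1 / p $ i) \<and>
                real CARD('n) / (\<Sum>i\<in>UNIV. 1 / p $ i) \<le> t \<and> ennreal t < r \<and> r = \<infinity>)"
  shows "\<exists>C::real. C > 0 \<and> (\<forall>f \<in> vec_block_space p t r u'.
           block_norm_ext p t r (\<lambda>x. lq_norm u' (\<lambda>j. maximal_op (f j) x))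
             \<le> ennreal C * block_norm_ext p t r (\<lambda>x. lq_norm u' (\<lambda>j. ennreal (cmod (f j x)))))"
proof -
  have \<sigma>: "0 < (\<Sum>i\<in>UNIV. 1 / p $ i)"
    using p by (intro sum_pos) (auto intro: order.strict_trans[of 0 1])
  have t1: "1 < t" using tr by auto
  \<comment> \<open>\<open>\<rho>\<close> is 1 for infinite \<open>r\<close>, where the weak
    inequality for \<open>t\<close> suffices, and the real conjugate exponent otherwise.\<close>
  have "\<exists>\<rho>. conj_exp r = ennreal \<rho> \<and> block_params p t \<rho>"
  proof (cases "r = \<infinity>")
    case True
    then have "real CARD('n) / t \<le> (\<Sum>i\<in>UNIV. 1 / p $ i)" using tr \<sigma> t1 by (auto simp: field_simps)
    then have "block_params p t 1" using p t1 by unfold_locales auto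
    moreover have "conj_exp r = ennreal 1" using True conj_exp_top by simp
    ultimately show ?thesis by blast
  next
    case False
    then have lt: "real CARD('n) / t < (\<Sum>i\<in>UNIV. 1 / p $ i)" using tr \<sigma> t1 by (auto simp: field_simps)
    obtain r0 where r0: "r = ennreal r0" "t < r0"
      using False tr t1 by (cases r) (auto simp: ennreal_less_iff)
    have c: "conj_exp r = ennreal (conj_exp r0)" using r0 t1 conj_exp_ennreal[of r0] by simp
    have "1 \<le> conj_exp r0" using r0 t1 by (simp add: conj_exp_def one_le_inverse_iff field_simps)
    moreover have "1 - 1 / conj_exp r0 = 1 / r0" by (simp add: conj_exp_def inverse_eq_divide)
    moreover have "1 / r0 < 1 / t" using r0 t1 by (simp add: field_simps)
    ultimately have "block_params p t (conj_exp r0)" using p t1 lt by unfold_locales auto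
    then show ?thesis using c by blast
  qed
  then obtain \<rho> where r: "conj_exp r = ennreal \<rho>" and "block_params p t \<rho>" by blast
  then interpret block_params p t \<rho> by simp
  obtain C where C: "C < top" and main: "\<And>a c (g :: nat \<Rightarrow> _). \<lbrakk>dominated_pieces a c; \<forall>j. g j \<in> borel_measurable borel;
    \<forall>x. lq_norm u' (\<lambda>j. g j x) \<le> (\<integral>\<^sup>+i. a i x \<partial>count_space UNIV);
    \<forall>x j. (\<integral>\<^sup>+i. a i x \<partial>count_space UNIV) = top \<longrightarrow> g j x = 0\<rbrakk> \<Longrightarrow>
    block_norm_ext p t r (\<lambda>x. lq_norm u' (\<lambda>j. ball_max (g j) x)) \<le> C * lq_norm (ennreal \<rho>) c"
    using maximal_block_bound[OF u' r] by blast
  \<comment> \<open>The summand 1 makes the constant positive.\<close>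
  define K where "K = enn2real C + 1"
  have K: "0 < K" "C \<le> ennreal K" using C by (auto simp: K_def add_nonneg_pos)
  show ?thesis
  proof (intro exI[of _ K] conjI ballI K(1))
    fix f assume f: "f \<in> vec_block_space p t r u'"
    define G where "G x = lq_norm u' (\<lambda>j. ennreal (cmod (f j x)))" for x
    define M where "M = block_norm_ext p t r (\<lambda>x. lq_norm u' (\<lambda>j. maximal_op (f j) x))"
    have "M \<le> ennreal K * block_norm_ext p t r G"
    proof (cases "AE x in lebesgue. G x < \<infinity>")
      \<comment> \<open>If \<open>G\<close> is not finite almost everywhere, the right side is
        infinite by the convention of \<open>block_norm_ext\<close>, because \<open>K\<close> is
        positive.\<close>
      case False
      then show ?thesis using K by (simp add: block_norm_ext_def ennreal_mult_top)
    next
      case Gfin: True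
      have "\<forall>j. \<exists>g\<in>borel_measurable borel. AE x in lborel. ennreal (cmod (f j x)) = g x"
        using f by (intro allI ennreal_borel_version) (simp add: vec_block_space_def)
      then obtain g0 where g0 [measurable]: "\<And>j. g0 j \<in> borel_measurable borel"
        and g0_eq: "\<And>j. AE x in lborel. ennreal (cmod (f j x)) = g0 j x" by metis
      have g0_all: "AE x in lborel. \<forall>j. ennreal (cmod (f j x)) = g0 j x"
        using g0_eq by (subst AE_all_countable) blast
      have bound: "M \<le> ennreal K * lq_norm (conj_exp r) (\<lambda>i. ennreal (cmod (lam i)))"
        if lam: "block_rep p t r (\<lambda>x. complex_of_real (enn2real (G x))) lam" for lam
      proof -
        from lam obtain b where lamfin: "lq_norm (ennreal \<rho>) (\<lambda>i. ennreal (cmod (lam i))) < top"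
          and b: "\<And>i. is_block p t (dyadic_cube i) (b i)"
          and hs: "AE x in lebesgue. ((\<lambda>i. lam i * b i x) has_sum complex_of_real (enn2real (G x))) UNIV"
          unfolding block_rep_def r by auto
        have "\<forall>i. \<exists>g\<in>borel_measurable borel. AE x in lborel. ennreal (cmod (b i x)) = g x"
          using b by (intro allI ennreal_borel_version) (simp add: is_block_def)
        then obtain b0 where b0 [measurable]: "\<And>i. b0 i \<in> borel_measurable borel"
          and b0_eq: "\<And>i. AE x in lborel. ennreal (cmod (b i x)) = b0 i x" by metis
        define c where "c i = ennreal (cmod (lam i))" for i
        \<comment> \<open>The Borel version \<open>b0 i\<close> agrees with the modulus of the block
          only almost everywhere; the indicator restores the support in the cube at every
          point.\<close>
        define a where "a i x = c i * (b0 i x * indicator (dyadic_cube i) x)" for i x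
        have a_eq: "AE x in lborel. b0 i x * indicator (dyadic_cube i) x = ennreal (cmod (b i x))" for i
          using b0_eq[of i]
        proof eventually_elim
          case (elim x)
          then show ?case using b[of i] by (auto simp: is_block_def indicator_def)
        qed
        have am [measurable]: "a i \<in> borel_measurable borel" for i unfolding a_def by measurable
        have a: "dominated_pieces a c"
          unfolding dominated_pieces_def
        proof (intro conjI allI impI)
          fix i
          have "mixed_norm q (a i) = c i * mixed_norm q (\<lambda>x. b0 i x * indicator (dyadic_cube i) x)"
            unfolding a_def by (rule mixed_norm_cmult) measurable
          also have "mixed_norm q (\<lambda>x. b0 i x * indicator (dyadic_cube i) x) = mixed_norm q (\<lambda>x. ennreal (cmod (b i x)))"
            by (rule mixed_norm_cong_AE[OF a_eq])
          also have "\<dots> \<le> bb i" using b[of i] by (simp add: is_block_def block_bound_eq q_def)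
          finally show "mixed_norm q (a i) \<le> c i * bb i" by (simp add: mult_left_mono)
        qed (auto simp: a_def c_def[abs_def] lamfin)
        define S where "S x = (\<integral>\<^sup>+i. a i x \<partial>count_space UNIV)" for x
        have [measurable]: "S \<in> borel_measurable borel" unfolding S_def by measurable
        have [measurable]: "(\<lambda>x. lq_norm u' (\<lambda>j. g0 j x)) \<in> borel_measurable borel"
          by (rule measurable_lq_norm) simp
        \<comment> \<open>Domination by \<open>S\<close> is required at every point but known only
          almost everywhere. On the exceptional null set the sequence is replaced by 0.\<close>
        define g where "g j x = (if lq_norm u' (\<lambda>j. g0 j x) \<le> S x \<and> S x \<noteq> top then g0 j x else 0)" for j x
        have gm: "g j \<in> borel_measurable borel" for j unfolding g_def by measurable
        have "AE x in lborel. \<forall>i. b0 i x * indicator (dyadic_cube i) x = ennreal (cmod (b i x))"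
          using a_eq by (subst AE_all_countable) blast
        moreover have "AE x in lborel. S x < top" unfolding S_def by (rule dominated_pieces_AE_finite[OF a])
        moreover have "AE x in lborel. G x < \<infinity>" using Gfin by (simp add: AE_completion_iff)
        moreover have "AE x in lborel. ((\<lambda>i. lam i * b i x) has_sum complex_of_real (enn2real (G x))) UNIV"
          using hs by (simp add: AE_completion_iff)
        ultimately have g_eq: "AE x in lborel. \<forall>j. ennreal (cmod (f j x)) = g j x"
          using g0_all
        proof eventually_elim
          case (elim x)
          have "G x = ennreal (cmod (complex_of_real (enn2real (G x))))" using elim(3) by simp
          also have "\<dots> \<le> (\<integral>\<^sup>+i. ennreal (cmod (lam i * b i x)) \<partial>count_space UNIV)"
            by (rule has_sum_norm_le_nn_integral[OF elim(4)])
          also have "\<dots> = S x"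
            unfolding S_def a_def c_def
          proof (intro nn_integral_cong)
            fix i
            have "b0 i x * indicator (dyadic_cube i) x = ennreal (cmod (b i x))" using elim(1) by blast
            then show "ennreal (cmod (lam i * b i x))
                = ennreal (cmod (lam i)) * (b0 i x * indicator (dyadic_cube i) x)"
              by (simp add: norm_mult ennreal_mult)
          qed
          finally have "lq_norm u' (\<lambda>j. g0 j x) \<le> S x" using elim(5) by (simp add: G_def)
          then show ?case using elim by (simp add: g_def)
        qed
        \<comment> \<open>Maximal functions are built from integrals, so changing the functions on a
          null set leaves them unchanged at every point.\<close>
        have mx: "maximal_op (f j) x = ball_max (g j) x" for j x
          unfolding maximal_op_eq_ball_max by (rule ball_max_cong_AE) (use g_eq in eventually_elim, blast)
        have lq0: "lq_norm u' (\<lambda>j :: nat. 0) = 0"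
          using lq_norm_cmult[of u' 0 "\<lambda>_ :: nat. 0"] u' by (simp add: order.strict_trans[of 0 1])
        have gS: "lq_norm u' (\<lambda>j. g j x) \<le> S x" for x
        proof (cases "lq_norm u' (\<lambda>j. g0 j x) \<le> S x \<and> S x \<noteq> top")
          case True
          then show ?thesis by (simp add: g_def)
        next
          case False
          then have "(\<lambda>j. g j x) = (\<lambda>_. 0)" by (intro ext) (auto simp: g_def)
          then show ?thesis by (simp add: lq0)
        qed
        have "M \<le> C * lq_norm (ennreal \<rho>) c"
          unfolding M_def mx
        proof (rule main[OF a])
          show "\<forall>x. lq_norm u' (\<lambda>j. g j x) \<le> (\<integral>\<^sup>+i. a i x \<partial>count_space UNIV)"
            using gS by (simp add: S_def)
          show "\<forall>x j. (\<integral>\<^sup>+i. a i x \<partial>count_space UNIV) = top \<longrightarrow> g j x = 0"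
            unfolding S_def[symmetric] by (simp add: g_def)
        qed (simp add: gm)
        also have "\<dots> \<le> ennreal K * lq_norm (ennreal \<rho>) c" using K by (intro mult_right_mono) auto
        finally show ?thesis by (simp add: r c_def[abs_def])
      qed
      \<comment> \<open>Dividing by the positive finite \<open>K\<close> turns the bound for each
        representation into a lower bound for the infimum.\<close>
      have "M / ennreal K \<le> block_norm p t r (\<lambda>x. complex_of_real (enn2real (G x)))"
        unfolding block_norm_def
        using K bound by (intro INF_greatest divide_le_posI_ennreal) (auto simp: mult.commute)
      then have "ennreal K * (M / ennreal K) \<le> ennreal K * block_norm p t r (\<lambda>x. complex_of_real (enn2real (G x)))"
        by (rule mult_left_mono) simp
      moreover have "ennreal K * (M / ennreal K) = M"
        using K ennreal_mult_divide_eq[of "ennreal K" M] by (simp add: ennreal_times_divide mult.commute)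
      ultimately show ?thesis using Gfin by (simp add: block_norm_ext_def)
    qed
    then show "block_norm_ext p t r (\<lambda>x. lq_norm u' (\<lambda>j. maximal_op (f j) x))
        \<le> ennreal K * block_norm_ext p t r (\<lambda>x. lq_norm u' (\<lambda>j. ennreal (cmod (f j x))))"
      by (simp add: M_def G_def[abs_def])
  qed
qed

end
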